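(* Let $\vec\Phi$ be a smooth immersion of the two-dimensional disc $D^2$ into the Riemannian manifold $(M^m,h)$, and let $g=\vec\Phi^*h$. Then the following identity holds on $D^2$: $$\frac12\,D_g^{*_g}\Big[D_g\vec H-3\,\pi_{\vec n}(D_g\vec H)+\star_h\big(( *_gD_g\vec n)\wedge_M\vec H\big)\Big]=\Delta_\perp\vec H+\tilde A(\vec H)-2|\vec H|^2\,\vec H-R^\perp_{\vec\Phi}(T\vec\Phi).$$
   Context: $(M^m,h)$ is a compact connected Riemannian manifold of dimension $m\ge3$ with Levi-Civita connection $D$, and $\mathrm{Riem}^h(X,Y)Z=D_XD_YZ-D_YD_XZ-D_{[X,Y]}Z$. For a smooth immersion $\vec\Phi$ of an oriented surface $\Sigma$ (here $\Sigma=D^2$) into $M$, put $g=\vec\Phi^*h$ and let $T_{\vec\Phi}M$ be the pull-back of $TM$. $(f_1,f_2)$ denotes a positive $g$-orthonormal frame of $T\Sigma$, $\vec e_i=\vec\Phi_*f_i$, and $D_{\vec e_i}$ is the covariant derivative of sections along $\vec\Phi$ in the direction $f_i$. $\pi_T$ and $\pi_{\vec n}$ are the orthogonal projections of $T_{\vec\Phi}M$ onto the tangent plane $\vec\Phi_*(T\Sigma)$ and onto its orthogonal complement. Second fundamental form and mean curvature: $\vec{\mathbb I}(X,Y)=\pi_{\vec n}(D_XY)$, $\vec H=\frac12(\vec{\mathbb I}(\vec e_1,\vec e_1)+\vec{\mathbb I}(\vec e_2,\vec e_2))$. Hodge operators: $\star_h:\wedge^pT_xM\to\wedge^{m-p}T_xM$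 is defined by $\beta\wedge\star_h\alpha=\langle\beta,\alpha\rangle_h\,\vec E_1\wedge\dots\wedge\vec E_m$ for a positive orthonormal basis $(\vec E_i)$ of $T_xM$ (a local orientation of $M$ is used); $*_g$ is defined in the same way on multivectors of $(T\Sigma,g)$, so $*_gf_1=f_2$, $*_gf_2=-f_1$. The Gauss map is $\vec n=\star_h(\vec e_1\wedge\vec e_2)$, an $(m-2)$-vector. Operators: for a section $\xi$ of $\wedge^pT_{\vec\Phi}M$, $D_g\xi=\sum_{i=1}^2D_{\vec e_i}\xi\otimes f_i$, a section of $\wedge^pT_{\vec\Phi}M\otimes T\Sigma$; $D_g^{*_g}$ is the formal $L^2(dvol_g)$-adjoint of $D_g$; in coordinates $D_g^{*_g}(\sum_iV^i\otimes\partial_{x^i})=-(\det g)^{-1/2}\sum_iD_{\partial_{x^i}\vec\Phi}\big((\det g)^{1/2}V^i\big)$. The maps $\star_h$, $\pi_{\vec n}$ act on the $\wedge^pT_{\vec\Phi}M$ factor, $*_g$ acts on the $T\Sigma$ factor, and $(\eta\otimes v)\wedge_M\tau=(\eta\wedge\tau)\otimes v$. $\Delta_\perp$ is the (nonpositive) covariant Laplacian of the normal bundle: $\Delta_\perp\xi=-\pi_{\vec n}\big(D_g^{*_g}[\pi_{\vec n}(D_g\xi)]\big)$ for normal $\xi$. Further, $\tilde A(\vec X)=\sum_{i,j=1}^2\vec{\mathbb I}(\vec e_i,\vec e_j)\langle\vec{\mathbb I}(\vec e_i,\vec e_j),\vec X\rangle$ and $R^\perp_{\vec\Phi}(T\vec\Phi)=\big(\pi_T[\mathrm{Riem}^h(\vec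 e_1,\vec e_2)\vec H]\big)^\perp$, where $(\cdot)^\perp$ is the rotation by $\pi/2$ in the tangent plane from $\vec e_1$ towards $\vec e_2$. *)

theory Defs
  imports "HOL-Analysis.Analysis"
begin

section \<open>Smooth maps, manifolds and Riemannian metrics\<close>

text \<open>Continuous differentiability to finite and infinite order; meaningful on open sets of
  Euclidean spaces, to which it is only applied.\<close>

primrec Ck_on :: "nat \<Rightarrow> 'a::euclidean_space set \<Rightarrow> ('a \<Rightarrow> 'b::euclidean_space) \<Rightarrow> bool" where
  "Ck_on 0 S f \<longleftrightarrow> continuous_on S f"
| "Ck_on (Suc k) S f \<longleftrightarrow> (\<forall>x\<in>S. f differentiable (at x)) \<and>
     (\<forall>v. Ck_on k S (\<lambda>x. frechet_derivative f (at x) v))"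

definition smooth_on :: "'a::euclidean_space set \<Rightarrow> ('a \<Rightarrow> 'b::euclidean_space) \<Rightarrow> bool" where
  "smooth_on S f \<longleftrightarrow> (\<forall>k. Ck_on k S f)"

text \<open>The manifold \<open>M\<close> is the whole of a Hausdorff second countable type \<open>'a\<close>; a chart is
  its domain together with the coordinate map.\<close>

type_synonym ('a, 'm) chart = "'a set \<times> ('a \<Rightarrow> real ^ 'm)"

definition transition :: "('a, 'm::finite) chart \<Rightarrow> ('a, 'm) chart \<Rightarrow> real ^ 'm \<Rightarrow> real ^ 'm" where
  "transition c d = snd d \<circ> inv_into (fst c) (snd c)"

definition smooth_atlas ::
    "('a::{t2_space, second_countable_topology}, 'm::finite) chart set \<Rightarrow> bool" where
  "smooth_atlas A \<longleftrightarrow>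
     (\<Union>c\<in>A. fst c) = UNIV \<and>
     (\<forall>c\<in>A. open (fst c) \<and> open (snd c ` fst c) \<and>
        (\<exists>\<psi>. homeomorphism (fst c) (snd c ` fst c) (snd c) \<psi>)) \<and>
     (\<forall>c\<in>A. \<forall>d\<in>A. smooth_on (snd c ` (fst c \<inter> fst d)) (transition c d))"

text \<open>Inner product with Gram matrix \<open>G\<close>.\<close>

definition ip :: "real ^ 'n ^ 'n \<Rightarrow> real ^ 'n \<Rightarrow> real ^ 'n \<Rightarrow> real" where
  "ip G v w = v \<bullet> (G *v w)"

text \<open>A tensor on \<open>M\<close> is the family of its component functions in the charts of the atlas; those of
  the metric, \<open>h c\<close>, are functions on the image of the chart \<open>c\<close>. The last conjunct says that the
  components in two charts define the same inner product on the tangent spaces.\<close>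

definition riemannian_metric ::
    "('a, 'm::finite) chart set \<Rightarrow> (('a, 'm) chart \<Rightarrow> real ^ 'm \<Rightarrow> real ^ 'm ^ 'm) \<Rightarrow> bool" where
  "riemannian_metric A h \<longleftrightarrow>
     (\<forall>c\<in>A. smooth_on (snd c ` fst c) (h c) \<and>
        (\<forall>y\<in>snd c ` fst c. transpose (h c y) = h c y \<and> (\<forall>v. v \<noteq> 0 \<longrightarrow> ip (h c y) v v > 0))) \<and>
     (\<forall>c\<in>A. \<forall>d\<in>A. \<forall>x\<in>fst c \<inter> fst d. \<forall>v w.
        ip (h c (snd c x)) v w =
        ip (h d (snd d x)) (frechet_derivative (transition c d) (at (snd c x)) v)
                           (frechet_derivative (transition c d) (at (snd c x)) w))"

abbreviation disc :: "(real ^ 2) set" where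
  "disc \<equiv> ball 0 1"

definition smooth_immersion ::
    "('a::topological_space, 'm::finite) chart set \<Rightarrow> (real ^ 2 \<Rightarrow> 'a) \<Rightarrow> bool" where
  "smooth_immersion A \<Phi> \<longleftrightarrow> continuous_on disc \<Phi> \<and>
     (\<forall>c\<in>A. smooth_on (disc \<inter> \<Phi> -` fst c) (snd c \<circ> \<Phi>) \<and>
        (\<forall>z\<in>disc \<inter> \<Phi> -` fst c. inj (frechet_derivative (snd c \<circ> \<Phi>) (at z))))"


section \<open>Levi-Civita connection and curvature in a chart\<close>

definition partial :: "(real ^ 'm::finite \<Rightarrow> 'b::real_normed_vector) \<Rightarrow> 'm \<Rightarrow> real ^ 'm \<Rightarrow> 'b" where
  "partial F i y = frechet_derivative F (at y) (axis i 1)"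

definition christoffel :: "(real ^ 'm::finite \<Rightarrow> real ^ 'm ^ 'm) \<Rightarrow> real ^ 'm \<Rightarrow> 'm \<Rightarrow> 'm \<Rightarrow> 'm \<Rightarrow> real" where
  "christoffel h y k i j =
     (1/2) * (\<Sum>l\<in>UNIV. matrix_inv (h y) $ k $ l *
        (partial h i y $ j $ l + partial h j y $ i $ l - partial h l y $ i $ j))"

definition Gam :: "(real ^ 'm::finite \<Rightarrow> real ^ 'm ^ 'm) \<Rightarrow> real ^ 'm \<Rightarrow> real ^ 'm \<Rightarrow> real ^ 'm \<Rightarrow> real ^ 'm" where
  "Gam h y v w = (\<chi> k. \<Sum>i\<in>UNIV. \<Sum>j\<in>UNIV. christoffel h y k i j * v $ i * w $ j)"

definition nabla :: "(real ^ 'm::finite \<Rightarrow> real ^ 'm ^ 'm) \<Rightarrow> (real ^ 'm \<Rightarrow> real ^ 'm) \<Rightarrow>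
    (real ^ 'm \<Rightarrow> real ^ 'm) \<Rightarrow> real ^ 'm \<Rightarrow> real ^ 'm" where
  "nabla h X Y y = frechet_derivative Y (at y) (X y) + Gam h y (X y) (Y y)"

definition lie_bracket :: "(real ^ 'm::finite \<Rightarrow> real ^ 'm) \<Rightarrow> (real ^ 'm \<Rightarrow> real ^ 'm) \<Rightarrow>
    real ^ 'm \<Rightarrow> real ^ 'm" where
  "lie_bracket X Y y = frechet_derivative Y (at y) (X y) - frechet_derivative X (at y) (Y y)"

definition Riem_field :: "(real ^ 'm::finite \<Rightarrow> real ^ 'm ^ 'm) \<Rightarrow> (real ^ 'm \<Rightarrow> real ^ 'm) \<Rightarrow>
    (real ^ 'm \<Rightarrow> real ^ 'm) \<Rightarrow> (real ^ 'm \<Rightarrow> real ^ 'm) \<Rightarrow> real ^ 'm \<Rightarrow> real ^ 'm" where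
  "Riem_field h X Y Z y = nabla h X (nabla h Y Z) y - nabla h Y (nabla h X Z) y
     - nabla h (lie_bracket X Y) Z y"

text \<open>The curvature is tensorial, so its value on tangent vectors at \<open>y\<close> can be computed with any
  extension of them to vector fields; take the one with constant components.\<close>

definition Riem :: "(real ^ 'm::finite \<Rightarrow> real ^ 'm ^ 'm) \<Rightarrow> real ^ 'm \<Rightarrow>
    real ^ 'm \<Rightarrow> real ^ 'm \<Rightarrow> real ^ 'm \<Rightarrow> real ^ 'm" where
  "Riem h y u v w = Riem_field h (\<lambda>_. u) (\<lambda>_. v) (\<lambda>_. w) y"


section \<open>Multivectors and Hodge operators\<close>

text \<open>A \<open>p\<close>-vector \<open>\<alpha>\<close> is given by its components \<open>\<alpha> [i\<^sub>1, \<dots>, i\<^sub>p]\<close> as an alternating contravariant tensor,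
  extended by zero to lists of other lengths, so that
  \<open>\<alpha> = \<Sum> \<alpha> [i\<^sub>1, \<dots>, i\<^sub>p] \<partial>\<^sub>i\<^sub>1 \<and> \<dots> \<and> \<partial>\<^sub>i\<^sub>p\<close> with the sum over increasing indices
  for any linear order of \<open>'m\<close>.\<close>

type_synonym 'm mv = "'m list \<Rightarrow> real"

definition multivector :: "nat \<Rightarrow> 'm mv \<Rightarrow> bool" where
  "multivector p \<alpha> \<longleftrightarrow> (\<forall>I. length I \<noteq> p \<longrightarrow> \<alpha> I = 0) \<and>
     (\<forall>I r s. r < s \<and> s < length I \<longrightarrow> \<alpha> (I[r := I ! s, s := I ! r]) = - \<alpha> I)"

definition of_vec :: "real ^ 'm::finite \<Rightarrow> 'm mv" where
  "of_vec v I = (if length I = 1 then v $ hd I else 0)"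

definition to_vec :: "'m mv \<Rightarrow> real ^ 'm::finite" where
  "to_vec \<alpha> = (\<chi> i. \<alpha> [i])"

definition mv_one :: "'m mv" where
  "mv_one I = (if I = [] then 1 else 0)"

text \<open>Sign of the shuffle that moves the positions in \<open>S\<close> in front of the remaining ones.\<close>

definition shuffle_sign :: "nat \<Rightarrow> nat set \<Rightarrow> real" where
  "shuffle_sign n S = (-1) ^ card {(r, s). r < s \<and> s < n \<and> r \<notin> S \<and> s \<in> S}"

text \<open>The normalization is \<open>v \<and> w = v \<otimes> w - w \<otimes> v\<close>.\<close>

definition wedge :: "'m mv \<Rightarrow> 'm mv \<Rightarrow> 'm mv" where
  "wedge \<alpha> \<beta> I = (\<Sum>S\<in>Pow {..<length I}.
     shuffle_sign (length I) S * \<alpha> (nths I S) * \<beta> (nths I (- S)))"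

definition wedge_list :: "(real ^ 'm::finite) list \<Rightarrow> 'm mv" where
  "wedge_list vs = foldr (\<lambda>v. wedge (of_vec v)) vs mv_one"

text \<open>The inner product for which
  \<open>\<langle>v\<^sub>1 \<and> \<dots> \<and> v\<^sub>p, w\<^sub>1 \<and> \<dots> \<and> w\<^sub>p\<rangle> = det (\<langle>v\<^sub>i, w\<^sub>j\<rangle>)\<close>.\<close>

definition mv_ip :: "real ^ 'm ^ 'm \<Rightarrow> nat \<Rightarrow> 'm::finite mv \<Rightarrow> 'm mv \<Rightarrow> real" where
  "mv_ip G p \<alpha> \<beta> = (1 / fact p) * (\<Sum>I | length I = p. \<Sum>J | length J = p.
     (\<Prod>r<p. G $ (I ! r) $ (J ! r)) * \<alpha> I * \<beta> J)"

text \<open>The orientation is the one for which the coordinate vectors in the order of the list \<open>es\<close> form a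
  positive basis. A basis \<open>E\<close> is indexed by \<open>'m\<close> and taken in the order \<open>es\<close> as well, whence its
  positivity is that of \<open>det E\<close>.\<close>

definition pos_onb :: "real ^ 'm ^ 'm \<Rightarrow> real ^ 'm ^ 'm::finite \<Rightarrow> bool" where
  "pos_onb G E \<longleftrightarrow> (\<forall>i j. ip G (E $ i) (E $ j) = (if i = j then 1 else 0)) \<and> det E > 0"

definition hodge :: "real ^ 'm ^ 'm \<Rightarrow> 'm list \<Rightarrow> nat \<Rightarrow> 'm::finite mv \<Rightarrow> 'm mv" where
  "hodge G es p \<alpha> = (THE \<gamma>. multivector (CARD('m) - p) \<gamma> \<and>
     (\<forall>\<beta> E. multivector p \<beta> \<longrightarrow> pos_onb G E \<longrightarrow>
        wedge \<beta> \<gamma> = (\<lambda>I. mv_ip G p \<beta> \<alpha> * wedge_list (map (($) E) es) I)))"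


section \<open>Geometry of an immersed disc in a chart\<close>

text \<open>
  Over a chart of \<open>M\<close> the immersion becomes a map \<open>imm\<close> into \<open>\<real>\<^sup>m\<close>, and sections of the
  pull-back of \<open>TM\<close> and of its exterior powers are given by their components in that chart:
  \<^item> a section of the pull-back of \<open>TM\<close> is a map \<open>real ^ 2 \<Rightarrow> real ^ 'm\<close>;
  \<^item> a section of its \<open>p\<close>-th exterior power is a map \<open>real ^ 2 \<Rightarrow> 'm mv\<close>;
  \<^item> an element of the tensor product of either with \<open>T\<Sigma>\<close> is \<open>V :: _ ^ 2\<close>,
    standing for \<open>V $ 1 \<otimes> \<partial>\<^sub>1 + V $ 2 \<otimes> \<partial>\<^sub>2\<close>.

  The record also holds the orthonormal frame \<open>(f\<^sub>1, f\<^sub>2)\<close> of \<open>T\<Sigma>\<close> and the order of the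
  coordinates which gives the local orientation of \<open>M\<close>.
\<close>

record 'm patch =
  met :: "real ^ 'm \<Rightarrow> real ^ 'm ^ 'm"
  imm :: "real ^ 2 \<Rightarrow> real ^ 'm"
  frm :: "2 \<Rightarrow> real ^ 2 \<Rightarrow> real ^ 2"
  coord_order :: "'m list"

definition push :: "'m::finite patch \<Rightarrow> real ^ 2 \<Rightarrow> real ^ 2 \<Rightarrow> real ^ 'm" where
  "push P z v = frechet_derivative (imm P) (at z) v"

definition ip_M :: "'m::finite patch \<Rightarrow> real ^ 2 \<Rightarrow> real ^ 'm \<Rightarrow> real ^ 'm \<Rightarrow> real" where
  "ip_M P z = ip (met P (imm P z))"

definition pullback_metric :: "'m::finite patch \<Rightarrow> real ^ 2 \<Rightarrow> real ^ 2 ^ 2" where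
  "pullback_metric P z = (\<chi> i j. ip_M P z (push P z (axis i 1)) (push P z (axis j 1)))"

definition pos_orthonormal_frame :: "'m::finite patch \<Rightarrow> real ^ 2 \<Rightarrow> bool" where
  "pos_orthonormal_frame P z \<longleftrightarrow> pos_onb (pullback_metric P z) (\<chi> i. frm P i z)"

definition e_vec :: "'m::finite patch \<Rightarrow> 2 \<Rightarrow> real ^ 2 \<Rightarrow> real ^ 'm" where
  "e_vec P i z = push P z (frm P i z)"

subsection \<open>Orthogonal projections\<close>

definition pi_T :: "'m::finite patch \<Rightarrow> real ^ 2 \<Rightarrow> real ^ 'm \<Rightarrow> real ^ 'm" where
  "pi_T P z X = (THE Y. Y \<in> range (push P z) \<and> (\<forall>v. ip_M P z (X - Y) (push P z v) = 0))"

definition pi_n :: "'m::finite patch \<Rightarrow> real ^ 2 \<Rightarrow> real ^ 'm \<Rightarrow> real ^ 'm" where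
  "pi_n P z X = X - pi_T P z X"

definition pi_n_tensor :: "'m::finite patch \<Rightarrow> real ^ 2 \<Rightarrow> real ^ 'm ^ 2 \<Rightarrow> real ^ 'm ^ 2" where
  "pi_n_tensor P z V = (\<chi> a. pi_n P z (V $ a))"

subsection \<open>Covariant derivatives along the immersion\<close>

definition cov :: "'m::finite patch \<Rightarrow> real ^ 2 \<Rightarrow> (real ^ 2 \<Rightarrow> real ^ 'm) \<Rightarrow> real ^ 2 \<Rightarrow> real ^ 'm" where
  "cov P v \<xi> z = frechet_derivative \<xi> (at z) v + Gam (met P) (imm P z) (push P z v) (\<xi> z)"

definition cov_mv :: "'m::finite patch \<Rightarrow> real ^ 2 \<Rightarrow> (real ^ 2 \<Rightarrow> 'm mv) \<Rightarrow> real ^ 2 \<Rightarrow> 'm mv" where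
  "cov_mv P v \<xi> z I = frechet_derivative (\<lambda>z. \<xi> z I) (at z) v +
     (\<Sum>r<length I. \<Sum>k\<in>UNIV.
        Gam (met P) (imm P z) (push P z v) (axis k 1) $ (I ! r) * \<xi> z (I[r := k]))"

definition D_g :: "'m::finite patch \<Rightarrow> (real ^ 2 \<Rightarrow> real ^ 'm) \<Rightarrow> real ^ 2 \<Rightarrow> real ^ 'm ^ 2" where
  "D_g P \<xi> z = (\<chi> a. \<Sum>i\<in>UNIV. frm P i z $ a *\<^sub>R cov P (frm P i z) \<xi> z)"

definition D_g_mv :: "'m::finite patch \<Rightarrow> (real ^ 2 \<Rightarrow> 'm mv) \<Rightarrow> real ^ 2 \<Rightarrow> 'm mv ^ 2" where
  "D_g_mv P \<xi> z = (\<chi> a. (\<lambda>I. \<Sum>i\<in>UNIV. frm P i z $ a * cov_mv P (frm P i z) \<xi> z I))"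

definition D_g_star :: "'m::finite patch \<Rightarrow> (real ^ 2 \<Rightarrow> real ^ 'm ^ 2) \<Rightarrow> real ^ 2 \<Rightarrow> real ^ 'm" where
  "D_g_star P V z = - ((1 / sqrt (det (pullback_metric P z))) *\<^sub>R
     (\<Sum>a\<in>UNIV. cov P (axis a 1) (\<lambda>z. sqrt (det (pullback_metric P z)) *\<^sub>R V z $ a) z))"

subsection \<open>Second fundamental form, mean curvature and Gauss map\<close>

definition II :: "'m::finite patch \<Rightarrow> (real ^ 2 \<Rightarrow> real ^ 2) \<Rightarrow> (real ^ 2 \<Rightarrow> real ^ 2) \<Rightarrow>
    real ^ 2 \<Rightarrow> real ^ 'm" where
  "II P X Y z = pi_n P z (cov P (X z) (\<lambda>z. push P z (Y z)) z)"

definition mean_curv :: "'m::finite patch \<Rightarrow> real ^ 2 \<Rightarrow> real ^ 'm" where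
  "mean_curv P z = (1/2) *\<^sub>R (II P (frm P 1) (frm P 1) z + II P (frm P 2) (frm P 2) z)"

definition star_h :: "'m::finite patch \<Rightarrow> real ^ 2 \<Rightarrow> nat \<Rightarrow> 'm mv \<Rightarrow> 'm mv" where
  "star_h P z p = hodge (met P (imm P z)) (coord_order P) p"

definition gauss_map :: "'m::finite patch \<Rightarrow> real ^ 2 \<Rightarrow> 'm mv" where
  "gauss_map P z = star_h P z 2 (wedge (of_vec (e_vec P 1 z)) (of_vec (e_vec P 2 z)))"

definition star_g :: "'m::finite patch \<Rightarrow> real ^ 2 \<Rightarrow> real ^ 2 \<Rightarrow> real ^ 2" where
  "star_g P z v = to_vec (hodge (pullback_metric P z) [1, 2] 1 (of_vec v))"

definition star_g_tensor :: "'m::finite patch \<Rightarrow> real ^ 2 \<Rightarrow> 'm mv ^ 2 \<Rightarrow> 'm mv ^ 2" where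
  "star_g_tensor P z T = (\<chi> b. (\<lambda>I. \<Sum>a\<in>UNIV. (T $ a) I * star_g P z (axis a 1) $ b))"

definition wedge_M :: "'m mv ^ 2 \<Rightarrow> 'm mv \<Rightarrow> 'm mv ^ 2" where
  "wedge_M T \<tau> = (\<chi> a. wedge (T $ a) \<tau>)"

text \<open>\<open>\<star>\<^sub>h\<close> on tensors with values in \<open>(m-1)\<close>-vectors; the result is vector valued.\<close>

definition star_h_tensor :: "'m::finite patch \<Rightarrow> real ^ 2 \<Rightarrow> 'm mv ^ 2 \<Rightarrow> real ^ 'm ^ 2" where
  "star_h_tensor P z T = (\<chi> a. to_vec (star_h P z (CARD('m) - 1) (T $ a)))"

subsection \<open>The terms of the Willmore operator\<close>

definition Lap_perp :: "'m::finite patch \<Rightarrow> (real ^ 2 \<Rightarrow> real ^ 'm) \<Rightarrow> real ^ 2 \<Rightarrow> real ^ 'm" where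
  "Lap_perp P \<xi> z = - pi_n P z (D_g_star P (\<lambda>z. pi_n_tensor P z (D_g P \<xi> z)) z)"

definition A_tilde :: "'m::finite patch \<Rightarrow> real ^ 2 \<Rightarrow> real ^ 'm \<Rightarrow> real ^ 'm" where
  "A_tilde P z X = (\<Sum>i\<in>UNIV. \<Sum>j\<in>UNIV.
     ip_M P z (II P (frm P i) (frm P j) z) X *\<^sub>R II P (frm P i) (frm P j) z)"

definition rot_T :: "'m::finite patch \<Rightarrow> real ^ 2 \<Rightarrow> real ^ 'm \<Rightarrow> real ^ 'm" where
  "rot_T P z X = ip_M P z X (e_vec P 1 z) *\<^sub>R e_vec P 2 z - ip_M P z X (e_vec P 2 z) *\<^sub>R e_vec P 1 z"

definition R_perp :: "'m::finite patch \<Rightarrow> real ^ 2 \<Rightarrow> real ^ 'm" where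
  "R_perp P z = rot_T P z (pi_T P z
     (Riem (met P) (imm P z) (e_vec P 1 z) (e_vec P 2 z) (mean_curv P z)))"

text \<open>The patch of an immersion \<open>\<Phi>\<close> in the chart \<open>c\<close>.\<close>

definition patch_in :: "(('a, 'm::finite) chart \<Rightarrow> real ^ 'm \<Rightarrow> real ^ 'm ^ 'm) \<Rightarrow> (real ^ 2 \<Rightarrow> 'a) \<Rightarrow>
    (2 \<Rightarrow> real ^ 2 \<Rightarrow> real ^ 2) \<Rightarrow> ('a, 'm) chart \<Rightarrow> 'm list \<Rightarrow> 'm patch" where
  "patch_in h \<Phi> f c es = \<lparr>met = h c, imm = snd c \<circ> \<Phi>, frm = f, coord_order = es\<rparr>"

text \<open>A smooth frame \<open>(f\<^sub>1, f\<^sub>2)\<close> on the disc, positive and orthonormal for the metric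
  induced by \<open>\<Phi>\<close>; the condition does not depend on the chart nor on \<open>es\<close>.\<close>

definition smooth_pos_orthonormal_frame :: "('a, 'm::finite) chart set \<Rightarrow>
    (('a, 'm) chart \<Rightarrow> real ^ 'm \<Rightarrow> real ^ 'm ^ 'm) \<Rightarrow> (real ^ 2 \<Rightarrow> 'a) \<Rightarrow>
    (2 \<Rightarrow> real ^ 2 \<Rightarrow> real ^ 2) \<Rightarrow> bool" where
  "smooth_pos_orthonormal_frame A h \<Phi> f \<longleftrightarrow> (\<forall>i. smooth_on disc (f i)) \<and>
     (\<forall>c\<in>A. \<forall>z\<in>disc \<inter> \<Phi> -` fst c. pos_orthonormal_frame (patch_in h \<Phi> f c []) z)"

end

theory Submission
  imports Defs
begin

text \<open>
  Everything is computed in the frame \<open>e\<^sub>1, e\<^sub>2\<close>. Put \<open>h\<^sub>i\<^sub>j = \<langle>H, II(e\<^sub>i, e\<^sub>j)\<rangle>\<close>, \<open>N\<^sub>i = \<pi>\<^sub>n(D\<^sub>i H)\<close> and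
  \<open>\<omega>\<^sub>i = \<langle>D\<^sub>i e\<^sub>1, e\<^sub>2\<rangle>\<close>. Since the volume form is parallel, \<open>D\<^sub>i n = \<star>(D\<^sub>i e\<^sub>1 \<and> e\<^sub>2 + e\<^sub>1 \<and> D\<^sub>i e\<^sub>2)\<close>, and
  \<open>\<star>(\<star>(a \<and> b) \<and> X) = \<langle>a, X\<rangle> b - \<langle>b, X\<rangle> a\<close>, so that the Hodge term is tangential and linear in the \<open>h\<^sub>i\<^sub>j\<close>. With
  \<open>D\<^sub>i H = N\<^sub>i - \<Sum>\<^sub>j h\<^sub>i\<^sub>j e\<^sub>j\<close> the bracket becomes \<open>W\<^sub>1 \<otimes> f\<^sub>1 + W\<^sub>2 \<otimes> f\<^sub>2\<close>, where \<open>W\<^sub>i\<close> is \<open>-2 N\<^sub>i\<close> plus a tangential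
  part. Its divergence is expanded by the structure equations of the frame. The normal components match term by term.
  The tangential ones match because \<open>\<langle>Riem(e\<^sub>1, e\<^sub>2) H, e\<^sub>k\<rangle>\<close>, written as the commutator of covariant derivatives of \<open>H\<close>
  along the immersion, consists of the same derivatives of the \<open>h\<^sub>i\<^sub>j\<close>; no separate Codazzi equation is needed.
\<close>

section \<open>Calculus of smooth maps\<close>

text \<open>Where the constants come from: the tangential part of D H is minus the symmetric 2x2
  matrix h, and the Hodge term contributes the adjugate of h, which is (tr h) Id - h. Together they
  give -2 h0, with h0 the trace-free part of h. The factor 3 turns the normal part N into (1 - 3) N
  = -2 N, so half of the adjoint is exactly the divergence of N + h0. The normal part of that
  divergence is the normal Laplacian of H plus the sum of h0_ij II(e_i, e_j); since tr h = 2 |H|^2,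
  this sum is the A-tilde term minus 2 |H|^2 H. The tangential part is div h0 minus the sum of <N_i,
  II(e_i, e_k)> e_k. Two obstacles shape the development. The Hodge operators are definite
  descriptions that quantify over all multivectors and all positive orthonormal bases, so explicit
  component formulas, built on the alternating symbol, have to be proved before anything can be
  differentiated. And frame relations get differentiated, so they are kept on an open set; the
  density sqrt(det g) in the adjoint is traded for the reciprocal of the determinant of the
  frame.\<close>

lemma Ck_on_cong:
  assumes "open S" "\<And>x. x \<in> S \<Longrightarrow> f x = g x" "Ck_on k S f"
  shows "Ck_on k S g"
  using assms(2,3)
proof (induction k arbitrary: f g)
  case 0
  then show ?case using continuous_on_cong[of S S f g] by simp
next
  case (Suc k)
  have d: "f differentiable (at x)" if "x \<in> S" for x using Suc.prems that by simp
  have eq: "frechet_derivative f (at x) = frechet_derivative g (at x)" if "x \<in> S" for x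
    by (rule frechet_derivative_transform_within_open[OF d[OF that] \<open>open S\<close> that]) (use Suc.prems in auto)
  have "g differentiable (at x)" if "x \<in> S" for x
    using d[OF that] has_derivative_transform_within_open[OF _ \<open>open S\<close> that, of f _ UNIV g] Suc.prems(1)
    by (auto simp: differentiable_def)
  moreover have "Ck_on k S (\<lambda>x. frechet_derivative g (at x) v)" for v
    by (rule Suc.IH[of "\<lambda>x. frechet_derivative f (at x) v"]) (use eq Suc.prems in auto)
  ultimately show ?case by simp
qed

text \<open>\<open>Ck_on\<close> is phrased with the chosen \<open>frechet_derivative\<close>;
  uniqueness of derivatives lets any explicit derivative family stand in for it on an open set. The
  closure proofs use this as their induction step.\<close>

lemma Ck_on_SucI:
  assumes "open S" "\<And>x. x \<in> S \<Longrightarrow> (f has_derivative f' x) (at x)" "\<And>v. Ck_on k S (\<lambda>x. f' x v)"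
  shows "Ck_on (Suc k) S f"
proof -
  have "Ck_on k S (\<lambda>x. frechet_derivative f (at x) v)" for v
    by (rule Ck_on_cong[OF \<open>open S\<close> _ assms(3)[of v]])
       (use frechet_derivative_at[OF assms(2)] in metis)
  then show ?thesis using assms(2) by (auto simp: differentiable_def)
qed

lemma Ck_on_has_derivative:
  "Ck_on (Suc k) S f \<Longrightarrow> x \<in> S \<Longrightarrow> (f has_derivative frechet_derivative f (at x)) (at x)"
  by (simp add: frechet_derivative_works)

lemma Ck_on_Suc_imp: "open S \<Longrightarrow> Ck_on (Suc k) S f \<Longrightarrow> Ck_on k S f"
proof (induction k arbitrary: f)
  case 0
  then show ?case
    by (auto simp: continuous_on_eq_continuous_at differentiable_imp_continuous_within)
next
  case (Suc k)
  then show ?case by (metis Ck_on.simps(2))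
qed

lemma Ck_on_subset: "Ck_on k S f \<Longrightarrow> T \<subseteq> S \<Longrightarrow> Ck_on k T f"
  by (induction k arbitrary: f) (auto intro: continuous_on_subset)

lemma Ck_on_const: "open S \<Longrightarrow> Ck_on k S (\<lambda>x. c)"
  by (induction k arbitrary: c) (auto simp: continuous_on_const)

lemma Ck_on_bounded_linear:
  assumes "bounded_linear L" "open S" "Ck_on k S f"
  shows "Ck_on k S (\<lambda>x. L (f x))"
  using assms(3)
proof (induction k arbitrary: f)
  case 0
  then show ?case using bounded_linear.continuous_on[OF assms(1)] by simp
next
  case (Suc k)
  show ?case
  proof (rule Ck_on_SucI[OF \<open>open S\<close>])
    fix x assume "x \<in> S"
    show "((\<lambda>x. L (f x)) has_derivative (\<lambda>v. L (frechet_derivative f (at x) v))) (at x)"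
      by (rule bounded_linear.has_derivative[OF assms(1) Ck_on_has_derivative[OF Suc.prems \<open>x \<in> S\<close>]])
  next
    fix v show "Ck_on k S (\<lambda>x. L (frechet_derivative f (at x) v))"
      by (rule Suc.IH) (use Suc.prems in simp)
  qed
qed

lemma Ck_on_add:
  assumes "open S" "Ck_on k S f" "Ck_on k S g"
  shows "Ck_on k S (\<lambda>x. f x + g x)"
  using assms(2,3)
proof (induction k arbitrary: f g)
  case 0
  then show ?case by (auto intro: continuous_on_add)
next
  case (Suc k)
  show ?case
  proof (rule Ck_on_SucI[OF \<open>open S\<close>])
    fix x assume "x \<in> S"
    show "((\<lambda>x. f x + g x) has_derivative
        (\<lambda>v. frechet_derivative f (at x) v + frechet_derivative g (at x) v)) (at x)"
      by (intro has_derivative_add Ck_on_has_derivative[OF Suc.prems(1) \<open>x \<in> S\<close>]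
            Ck_on_has_derivative[OF Suc.prems(2) \<open>x \<in> S\<close>])
  next
    fix v show "Ck_on k S (\<lambda>x. frechet_derivative f (at x) v + frechet_derivative g (at x) v)"
      by (rule Suc.IH) (use Suc.prems in simp_all)
  qed
qed

text \<open>Leibniz's rule pairs each derivative with the undifferentiated other factor, so the
  hypotheses of order \<open>Suc k\<close> are also used lowered to order \<open>k\<close>.\<close>

lemma Ck_on_bilinear:
  assumes "bounded_bilinear B" "open S" "Ck_on k S f" "Ck_on k S g"
  shows "Ck_on k S (\<lambda>x. B (f x) (g x))"
  using assms(3,4)
proof (induction k arbitrary: f g)
  case 0
  then show ?case using bounded_bilinear.continuous_on[OF assms(1)] by auto
next
  case (Suc k)
  show ?case
  proof (rule Ck_on_SucI[OF \<open>open S\<close>])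
    fix x assume "x \<in> S"
    show "((\<lambda>x. B (f x) (g x)) has_derivative
        (\<lambda>v. B (f x) (frechet_derivative g (at x) v) + B (frechet_derivative f (at x) v) (g x))) (at x)"
      by (intro bounded_bilinear.FDERIV[OF assms(1)] Ck_on_has_derivative[OF Suc.prems(1) \<open>x \<in> S\<close>]
            Ck_on_has_derivative[OF Suc.prems(2) \<open>x \<in> S\<close>])
  next
    fix v show "Ck_on k S (\<lambda>x. B (f x) (frechet_derivative g (at x) v) + B (frechet_derivative f (at x) v) (g x))"
      using Suc.prems Ck_on_Suc_imp[OF \<open>open S\<close> Suc.prems(1)] Ck_on_Suc_imp[OF \<open>open S\<close> Suc.prems(2)]
      by (intro Ck_on_add[OF \<open>open S\<close>] Suc.IH) auto
  qed
qed

lemma Ck_on_sum: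
  assumes "open S" "\<And>i. i \<in> I \<Longrightarrow> Ck_on k S (f i)"
  shows "Ck_on k S (\<lambda>x. \<Sum>i\<in>I. f i x)"
  using assms(2)
  by (induction I rule: infinite_finite_induct) (auto intro: Ck_on_const Ck_on_add \<open>open S\<close>)

lemma linear_basis_expansion:
  fixes f :: "'a::euclidean_space \<Rightarrow> 'b::real_vector"
  assumes "linear f"
  shows "f v = (\<Sum>b\<in>Basis. (v \<bullet> b) *\<^sub>R f b)"
proof -
  have "f v = f (\<Sum>b\<in>Basis. (v \<bullet> b) *\<^sub>R b)" by (simp add: euclidean_representation)
  then show ?thesis using assms by (simp add: linear_sum linear_scale)
qed

text \<open>The chain rule feeds a moving vector into the derivative of \<open>g\<close>, whereas
  \<open>Ck_on\<close> controls derivatives in fixed directions only. Expanding that vector over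
  \<open>Basis\<close> leaves fixed directions with scalar coefficients of order \<open>k\<close>,
  and the induction hypothesis applies to each directional derivative of \<open>g\<close>.\<close>

lemma Ck_on_compose:
  assumes "open S" "open V" "f ` S \<subseteq> V" "Ck_on k V g" "Ck_on k S f"
  shows "Ck_on k S (\<lambda>x. g (f x))"
  using assms(4,5)
proof (induction k arbitrary: g)
  case 0
  then show ?case using continuous_on_compose2[OF _ _ assms(3)] by auto
next
  case (Suc k)
  have D: "(g has_derivative frechet_derivative g (at (f x))) (at (f x))" if "x \<in> S" for x
    using Ck_on_has_derivative[OF Suc.prems(1)] that assms(3) by auto
  show ?case
  proof (rule Ck_on_SucI[OF \<open>open S\<close>])
    fix x assume "x \<in> S"
    show "((\<lambda>x. g (f x)) has_derivative
        (\<lambda>v. \<Sum>b\<in>Basis. (frechet_derivative f (at x) v \<bullet> b) *\<^sub>R frechet_derivative g (at (f x)) b)) (at x)"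
    proof (rule has_derivative_eq_rhs)
      show "((\<lambda>x. g (f x)) has_derivative (\<lambda>v. frechet_derivative g (at (f x)) (frechet_derivative f (at x) v))) (at x)"
        by (rule has_derivative_compose[OF Ck_on_has_derivative[OF Suc.prems(2) \<open>x \<in> S\<close>] D[OF \<open>x \<in> S\<close>]])
      have l: "linear (frechet_derivative g (at (f x)))"
        using D[OF \<open>x \<in> S\<close>] has_derivative_linear by blast
      show "(\<lambda>v. frechet_derivative g (at (f x)) (frechet_derivative f (at x) v)) =
        (\<lambda>v. \<Sum>b\<in>Basis. (frechet_derivative f (at x) v \<bullet> b) *\<^sub>R frechet_derivative g (at (f x)) b)"
        using linear_basis_expansion[OF l] by blast
    qed
  next
    fix v
    show "Ck_on k S (\<lambda>x. \<Sum>b\<in>Basis. (frechet_derivative f (at x) v \<bullet> b) *\<^sub>R frechet_derivative g (at (f x)) b)"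
    proof (intro Ck_on_sum \<open>open S\<close> Ck_on_bilinear[OF bounded_bilinear_scaleR])
      fix b :: 'b
      show "Ck_on k S (\<lambda>x. frechet_derivative f (at x) v \<bullet> b)"
        by (rule Ck_on_bounded_linear[OF bounded_linear_inner_left \<open>open S\<close>]) (use Suc.prems in simp)
      show "Ck_on k S (\<lambda>x. frechet_derivative g (at (f x)) b)"
        by (rule Suc.IH) (use Suc.prems Ck_on_Suc_imp[OF \<open>open S\<close> Suc.prems(2)] in simp_all)
    qed
  qed
qed

text \<open>The derivative contains the reciprocal of \<open>f\<close> again, but only at order
  \<open>k\<close>, where the induction hypothesis supplies it.\<close>

lemma Ck_on_inverse:
  fixes f :: "'a::euclidean_space \<Rightarrow> real"
  assumes "open S" "\<And>x. x \<in> S \<Longrightarrow> f x \<noteq> 0" "Ck_on k S f"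
  shows "Ck_on k S (\<lambda>x. inverse (f x))"
  using assms(3)
proof (induction k)
  case 0
  then show ?case using continuous_on_inverse[of S f] assms(2) by auto
next
  case (Suc k)
  show ?case
  proof (rule Ck_on_SucI[OF \<open>open S\<close>])
    fix x assume "x \<in> S"
    show "((\<lambda>x. inverse (f x)) has_derivative
        (\<lambda>v. - (inverse (f x) * frechet_derivative f (at x) v * inverse (f x)))) (at x)"
      by (rule Deriv.has_derivative_inverse[OF assms(2)[OF \<open>x \<in> S\<close>] Ck_on_has_derivative[OF Suc.prems \<open>x \<in> S\<close>]])
  next
    fix v
    have i: "Ck_on k S (\<lambda>x. inverse (f x))"
      using Suc.IH Ck_on_Suc_imp[OF \<open>open S\<close> Suc.prems] by blast
    show "Ck_on k S (\<lambda>x. - (inverse (f x) * frechet_derivative f (at x) v * inverse (f x)))"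
      by (rule Ck_on_bounded_linear[of uminus, OF bounded_linear_minus[OF bounded_linear_ident] \<open>open S\<close>])
         (intro Ck_on_bilinear[OF bounded_bilinear_mult \<open>open S\<close>] i, use Suc.prems in simp)
  qed
qed

section \<open>Closure properties of smooth maps\<close>

lemma smooth_on_cong: "open S \<Longrightarrow> (\<And>x. x \<in> S \<Longrightarrow> f x = g x) \<Longrightarrow> smooth_on S f \<longleftrightarrow> smooth_on S g"
  unfolding smooth_on_def using Ck_on_cong by metis

lemma smooth_on_subset: "smooth_on S f \<Longrightarrow> T \<subseteq> S \<Longrightarrow> smooth_on T f"
  unfolding smooth_on_def using Ck_on_subset by blast

lemma smooth_on_const: "open S \<Longrightarrow> smooth_on S (\<lambda>x. c)"
  by (simp add: smooth_on_def Ck_on_const)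

lemma smooth_on_bounded_linear:
  "open S \<Longrightarrow> bounded_linear L \<Longrightarrow> smooth_on S f \<Longrightarrow> smooth_on S (\<lambda>x. L (f x))"
  by (simp add: smooth_on_def Ck_on_bounded_linear)

lemma smooth_on_add: "open S \<Longrightarrow> smooth_on S f \<Longrightarrow> smooth_on S g \<Longrightarrow> smooth_on S (\<lambda>x. f x + g x)"
  by (simp add: smooth_on_def Ck_on_add)

lemma smooth_on_bilinear:
  "open S \<Longrightarrow> bounded_bilinear B \<Longrightarrow> smooth_on S f \<Longrightarrow> smooth_on S g \<Longrightarrow> smooth_on S (\<lambda>x. B (f x) (g x))"
  by (simp add: smooth_on_def Ck_on_bilinear)

lemmas smooth_on_scaleR = smooth_on_bilinear[OF _ bounded_bilinear_scaleR]
lemmas smooth_on_mult =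
  smooth_on_bilinear[OF _ bounded_bilinear_mult[where 'a = "'a::{real_normed_algebra,euclidean_space}"]]
lemmas smooth_on_inner = smooth_on_bilinear[OF _ bounded_bilinear_inner]

lemma smooth_on_minus: "open S \<Longrightarrow> smooth_on S f \<Longrightarrow> smooth_on S (\<lambda>x. - f x)"
  using smooth_on_bounded_linear[of S uminus f] bounded_linear_minus[OF bounded_linear_ident] by blast

lemma smooth_on_diff: "open S \<Longrightarrow> smooth_on S f \<Longrightarrow> smooth_on S g \<Longrightarrow> smooth_on S (\<lambda>x. f x - g x)"
  using smooth_on_add[of S f "\<lambda>x. - g x"] smooth_on_minus[of S g] by simp

lemma smooth_on_sum: "open S \<Longrightarrow> (\<And>i. i \<in> I \<Longrightarrow> smooth_on S (f i)) \<Longrightarrow> smooth_on S (\<lambda>x. \<Sum>i\<in>I. f i x)"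
  by (simp add: smooth_on_def Ck_on_sum)

lemma smooth_on_prod:
  fixes f :: "'i \<Rightarrow> 'a::euclidean_space \<Rightarrow> real"
  assumes "open S" "\<And>i. i \<in> I \<Longrightarrow> smooth_on S (f i)"
  shows "smooth_on S (\<lambda>x. \<Prod>i\<in>I. f i x)"
  using assms(2)
  by (induction I rule: infinite_finite_induct) (auto intro: smooth_on_const smooth_on_mult \<open>open S\<close>)

lemma smooth_on_compose:
  "open S \<Longrightarrow> open V \<Longrightarrow> f ` S \<subseteq> V \<Longrightarrow> smooth_on V g \<Longrightarrow> smooth_on S f \<Longrightarrow> smooth_on S (\<lambda>x. g (f x))"
  by (simp add: smooth_on_def Ck_on_compose)

lemma smooth_on_inverse:
  fixes f :: "'a::euclidean_space \<Rightarrow> real"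
  shows "open S \<Longrightarrow> (\<And>x. x \<in> S \<Longrightarrow> f x \<noteq> 0) \<Longrightarrow> smooth_on S f \<Longrightarrow> smooth_on S (\<lambda>x. inverse (f x))"
  by (simp add: smooth_on_def Ck_on_inverse)

lemma smooth_on_nth:
  fixes f :: "'a::euclidean_space \<Rightarrow> 'b::euclidean_space ^ 'n"
  shows "open S \<Longrightarrow> smooth_on S f \<Longrightarrow> smooth_on S (\<lambda>x. f x $ i)"
  by (rule smooth_on_bounded_linear[OF _ bounded_linear_vec_nth])

lemma bounded_linear_axis: "bounded_linear (axis i :: 'b::euclidean_space \<Rightarrow> 'b ^ 'n::finite)"
  unfolding linear_conv_bounded_linear[symmetric]
  by (rule linearI) (simp_all add: vec_eq_iff axis_def)

lemma smooth_on_vec: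
  fixes f :: "'n::finite \<Rightarrow> 'a::euclidean_space \<Rightarrow> 'b::euclidean_space"
  assumes "open S" "\<And>i. smooth_on S (f i)"
  shows "smooth_on S (\<lambda>x. \<chi> i. f i x)"
proof -
  have "(\<lambda>x. \<chi> i. f i x) = (\<lambda>x. \<Sum>i\<in>UNIV. axis i (f i x))"
    by (auto simp: vec_eq_iff axis_def)
  then show ?thesis
    using assms by (simp add: smooth_on_sum smooth_on_bounded_linear[OF _ bounded_linear_axis])
qed

lemma smooth_on_det:
  fixes F :: "'a::euclidean_space \<Rightarrow> real ^ 'n ^ 'n"
  assumes "open S" "smooth_on S F"
  shows "smooth_on S (\<lambda>x. det (F x))"
  unfolding det_def
  by (intro smooth_on_sum smooth_on_mult smooth_on_const smooth_on_prod smooth_on_nth assms)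

lemma invertible_matrix_inv:
  fixes A :: "real ^ 'n ^ 'n"
  assumes "invertible A"
  shows "A ** matrix_inv A = mat 1" "matrix_inv A ** A = mat 1"
  using someI_ex[OF assms[unfolded invertible_def]] by (auto simp: matrix_inv_def)

text \<open>By Cramer's rule an entry of the inverse is a quotient of determinants, hence of
  polynomials in the entries of \<open>F x\<close>. This is what makes the Christoffel symbols
  smooth.\<close>

lemma smooth_on_matrix_inv_nth:
  fixes F :: "'a::euclidean_space \<Rightarrow> real ^ 'n ^ 'n"
  assumes "open S" "smooth_on S F" "\<And>x. x \<in> S \<Longrightarrow> det (F x) \<noteq> 0"
  shows "smooth_on S (\<lambda>x. matrix_inv (F x) $ k $ l)"
proof -
  have "matrix_inv (F x) $ k $ l =
      det (\<chi> i j. if j = k then axis l 1 $ i else F x $ i $ j) * inverse (det (F x))" if "x \<in> S" for x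
  proof -
    have inv: "invertible (F x)" using assms(3)[OF that] by (simp add: invertible_det_nz)
    have "F x *v column l (matrix_inv (F x)) = axis l 1"
      by (metis invertible_matrix_inv(1)[OF inv] matrix_vector_mul_assoc matrix_vector_mult_basis matrix_vector_mul_lid)
    then have "column l (matrix_inv (F x)) = (\<chi> k. det (\<chi> i j. if j = k then axis l 1 $ i else F x $ i $ j) / det (F x))"
      using cramer[OF assms(3)[OF that]] by blast
    then show ?thesis by (simp add: column_def vec_eq_iff divide_inverse)
  qed
  moreover have "smooth_on S (\<lambda>x. \<chi> i j. if j = k then axis l 1 $ i else F x $ i $ j)"
  proof (intro smooth_on_vec assms(1))
    fix i j show "smooth_on S (\<lambda>x. if j = k then axis l 1 $ i else F x $ i $ j)"
      by (cases "j = k") (simp_all add: smooth_on_const smooth_on_nth assms)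
  qed
  ultimately show ?thesis
    using smooth_on_cong[OF \<open>open S\<close>, of "\<lambda>x. matrix_inv (F x) $ k $ l"]
    by (auto intro!: smooth_on_mult smooth_on_inverse smooth_on_det assms)
qed

lemma smooth_on_differentiable: "smooth_on S f \<Longrightarrow> x \<in> S \<Longrightarrow> f differentiable (at x)"
  unfolding smooth_on_def by (metis Ck_on.simps(2))

lemma smooth_on_has_derivative:
  "smooth_on S f \<Longrightarrow> x \<in> S \<Longrightarrow> (f has_derivative frechet_derivative f (at x)) (at x)"
  using smooth_on_differentiable frechet_derivative_works by blast

lemma smooth_on_linear_derivative:
  "smooth_on S f \<Longrightarrow> x \<in> S \<Longrightarrow> linear (frechet_derivative f (at x))"
  using smooth_on_has_derivative has_derivative_linear by blast

lemma smooth_on_imp_continuous_on: "smooth_on S f \<Longrightarrow> continuous_on S f"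
  unfolding smooth_on_def by (metis Ck_on.simps(1))

lemma smooth_on_derivative_const:
  "smooth_on S f \<Longrightarrow> smooth_on S (\<lambda>x. frechet_derivative f (at x) v)"
  unfolding smooth_on_def by (metis Ck_on.simps(2))

lemma smooth_on_derivative:
  assumes "open S" "smooth_on S f" "smooth_on S X"
  shows "smooth_on S (\<lambda>x. frechet_derivative f (at x) (X x))"
proof -
  have "smooth_on S (\<lambda>x. \<Sum>b\<in>Basis. (X x \<bullet> b) *\<^sub>R frechet_derivative f (at x) b)"
    by (intro smooth_on_sum smooth_on_scaleR smooth_on_inner smooth_on_const
        smooth_on_derivative_const assms)
  then show ?thesis
    using linear_basis_expansion[OF smooth_on_linear_derivative[OF assms(2)]]
    by (subst smooth_on_cong[OF \<open>open S\<close>]) auto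
qed

subsection \<open>Symmetry of second derivatives\<close>

text \<open>The mean value theorem is applied first in the direction \<open>u\<close>, to the
  difference of \<open>F\<close> across the side \<open>h *\<^sub>R v\<close>, and then in the
  direction \<open>v\<close> to the resulting derivative. The left side is symmetric in
  \<open>u\<close> and \<open>v\<close> while the right side is not, whence the symmetry of second
  derivatives.\<close>

lemma second_difference:
  fixes F :: "'a::euclidean_space \<Rightarrow> real"
  assumes "open S" "smooth_on S F" "h > 0"
    and rectangle: "\<forall>s\<in>{0..h}. \<forall>t\<in>{0..h}. z + s *\<^sub>R u + t *\<^sub>R v \<in> S"
  shows "\<exists>s t. 0 \<le> s \<and> s \<le> h \<and> 0 \<le> t \<and> t \<le> h \<and>
    F (z + h *\<^sub>R u + h *\<^sub>R v) - F (z + h *\<^sub>R u) - F (z + h *\<^sub>R v) + F z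
     = h^2 * frechet_derivative (\<lambda>x. frechet_derivative F (at x) u) (at (z + s *\<^sub>R u + t *\<^sub>R v)) v"
proof -
  have in_S: "z + s *\<^sub>R u + t *\<^sub>R v \<in> S" if "0 \<le> s" "s \<le> h" "0 \<le> t" "t \<le> h" for s t
    using rectangle that by simp
  define G where "G = (\<lambda>x. frechet_derivative F (at x) u)"
  have GS: "smooth_on S G" unfolding G_def by (rule smooth_on_derivative_const[OF assms(2)])
  have d1: "((\<lambda>s. F (z + s *\<^sub>R u + t *\<^sub>R v)) has_real_derivative G (z + s *\<^sub>R u + t *\<^sub>R v)) (at s)"
    if "0 \<le> s" "s \<le> h" "0 \<le> t" "t \<le> h" for s t
  proof -
    have "((\<lambda>s. z + s *\<^sub>R u + t *\<^sub>R v) has_derivative (\<lambda>r. r *\<^sub>R u)) (at s)"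
      by (auto intro!: derivative_eq_intros)
    from has_derivative_compose[OF this smooth_on_has_derivative[OF assms(2) in_S[OF that]]]
    show ?thesis
      unfolding has_field_derivative_def G_def
      by (rule has_derivative_eq_rhs)
         (auto simp: fun_eq_iff linear_scale[OF smooth_on_linear_derivative[OF assms(2) in_S[OF that]]])
  qed
  have d2: "((\<lambda>t. G (z + s *\<^sub>R u + t *\<^sub>R v)) has_real_derivative
      frechet_derivative G (at (z + s *\<^sub>R u + t *\<^sub>R v)) v) (at t)"
    if "0 \<le> s" "s \<le> h" "0 \<le> t" "t \<le> h" for s t
  proof -
    have "((\<lambda>t. z + s *\<^sub>R u + t *\<^sub>R v) has_derivative (\<lambda>r. r *\<^sub>R v)) (at t)"
      by (auto intro!: derivative_eq_intros)
    from has_derivative_compose[OF this smooth_on_has_derivative[OF GS in_S[OF that]]]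
    show ?thesis
      unfolding has_field_derivative_def
      by (rule has_derivative_eq_rhs)
         (auto simp: fun_eq_iff linear_scale[OF smooth_on_linear_derivative[OF GS in_S[OF that]]])
  qed
  have D1: "((\<lambda>s. F (z + s *\<^sub>R u + h *\<^sub>R v) - F (z + s *\<^sub>R u + 0 *\<^sub>R v)) has_real_derivative
      G (z + s *\<^sub>R u + h *\<^sub>R v) - G (z + s *\<^sub>R u + 0 *\<^sub>R v)) (at s)" if "0 \<le> s" "s \<le> h" for s
    using that \<open>0 < h\<close> by (intro DERIV_diff d1) auto
  have "\<exists>s. 0 < s \<and> s < h \<and>
    (F (z + h *\<^sub>R u + h *\<^sub>R v) - F (z + h *\<^sub>R u + 0 *\<^sub>R v)) - (F (z + 0 *\<^sub>R u + h *\<^sub>R v) - F (z + 0 *\<^sub>R u + 0 *\<^sub>R v))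
     = (h - 0) * (G (z + s *\<^sub>R u + h *\<^sub>R v) - G (z + s *\<^sub>R u + 0 *\<^sub>R v))"
    by (rule MVT2[OF \<open>0 < h\<close> D1])
  then obtain s where s: "0 < s" "s < h"
    "(F (z + h *\<^sub>R u + h *\<^sub>R v) - F (z + h *\<^sub>R u + 0 *\<^sub>R v)) - (F (z + 0 *\<^sub>R u + h *\<^sub>R v) - F (z + 0 *\<^sub>R u + 0 *\<^sub>R v))
     = (h - 0) * (G (z + s *\<^sub>R u + h *\<^sub>R v) - G (z + s *\<^sub>R u + 0 *\<^sub>R v))"
    by (elim exE conjE) (rule that)
  have D2: "((\<lambda>t. G (z + s *\<^sub>R u + t *\<^sub>R v)) has_real_derivative
      frechet_derivative G (at (z + s *\<^sub>R u + t *\<^sub>R v)) v) (at t)" if "0 \<le> t" "t \<le> h" for t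
    using that s by (intro d2) auto
  have "\<exists>t. 0 < t \<and> t < h \<and>
    G (z + s *\<^sub>R u + h *\<^sub>R v) - G (z + s *\<^sub>R u + 0 *\<^sub>R v)
      = (h - 0) * frechet_derivative G (at (z + s *\<^sub>R u + t *\<^sub>R v)) v"
    by (rule MVT2[OF \<open>0 < h\<close> D2])
  then obtain t where t: "0 < t" "t < h"
    "G (z + s *\<^sub>R u + h *\<^sub>R v) - G (z + s *\<^sub>R u + 0 *\<^sub>R v)
      = (h - 0) * frechet_derivative G (at (z + s *\<^sub>R u + t *\<^sub>R v)) v"
    by (elim exE conjE) (rule that)
  show ?thesis
    by (intro exI[of _ s] exI[of _ t]) (use s t in \<open>auto simp: G_def power2_eq_square\<close>)
qed

lemma second_derivative_symmetric_real:
  fixes F :: "'a::euclidean_space \<Rightarrow> real"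
  assumes "open S" "smooth_on S F" "z \<in> S"
  shows "frechet_derivative (\<lambda>x. frechet_derivative F (at x) u) (at z) v =
         frechet_derivative (\<lambda>x. frechet_derivative F (at x) v) (at z) u"
proof (rule ccontr)
  define A where "A = (\<lambda>x. frechet_derivative (\<lambda>x. frechet_derivative F (at x) u) (at x) v)"
  define B where "B = (\<lambda>x. frechet_derivative (\<lambda>x. frechet_derivative F (at x) v) (at x) u)"
  assume "\<not> ?thesis"
  then have "A z \<noteq> B z" by (simp add: A_def B_def)
  define e where "e = \<bar>A z - B z\<bar> / 2"
  have "e > 0" using \<open>A z \<noteq> B z\<close> by (simp add: e_def)
  have "isCont A z" "isCont B z"
    using smooth_on_imp_continuous_on[OF smooth_on_derivative_const[OF smooth_on_derivative_const[OF assms(2)]]]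
      assms(1,3) unfolding A_def B_def by (simp_all add: continuous_on_eq_continuous_at)
  then obtain d1 d2 where d: "d1 > 0" "d2 > 0" "\<And>x. dist x z < d1 \<Longrightarrow> dist (A x) (A z) < e"
      "\<And>x. dist x z < d2 \<Longrightarrow> dist (B x) (B z) < e"
    unfolding continuous_at_eps_delta using \<open>e > 0\<close> by metis
  obtain d3 where d3: "d3 > 0" "ball z d3 \<subseteq> S" using assms open_contains_ball by blast
  \<comment> \<open>The side is so short that the whole parallelogram stays in \<open>S\<close> and
    within the continuity radii of \<open>A\<close> and \<open>B\<close>; the summand 1 keeps the
    denominator positive when \<open>u\<close> and \<open>v\<close> vanish.\<close>
  define h where "h = min d1 (min d2 d3) / (norm u + norm v + 1)"
  have "h > 0" using d d3 by (auto simp: h_def intro!: divide_pos_pos add_nonneg_pos)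
  have near: "norm (s *\<^sub>R u + t *\<^sub>R v) < min d1 (min d2 d3)" if "0 \<le> s" "s \<le> h" "0 \<le> t" "t \<le> h" for s t
  proof -
    have "norm (s *\<^sub>R u + t *\<^sub>R v) \<le> s * norm u + t * norm v"
      using norm_triangle_ineq[of "s *\<^sub>R u" "t *\<^sub>R v"] that by simp
    also have "\<dots> \<le> h * norm u + h * norm v" using that by (intro add_mono mult_right_mono) auto
    also have "\<dots> < h * (norm u + norm v + 1)" using \<open>h > 0\<close> by (simp add: algebra_simps)
    also have "\<dots> = min d1 (min d2 d3)" unfolding h_def
      by (smt (verit) norm_ge_zero nonzero_eq_divide_eq)
    finally show ?thesis .
  qed
  have rect1: "\<forall>s\<in>{0..h}. \<forall>t\<in>{0..h}. z + s *\<^sub>R u + t *\<^sub>R v \<in> S"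
  proof (intro ballI)
    fix s t assume "s \<in> {0..h}" "t \<in> {0..h}"
    then have "dist (z + (s *\<^sub>R u + t *\<^sub>R v)) z < d3" using near[of s t] by (simp add: dist_norm)
    then have "z + (s *\<^sub>R u + t *\<^sub>R v) \<in> ball z d3" by (simp only: mem_ball dist_commute)
    then show "z + s *\<^sub>R u + t *\<^sub>R v \<in> S" using d3(2) by (auto simp: add.assoc)
  qed
  have rect2: "\<forall>s\<in>{0..h}. \<forall>t\<in>{0..h}. z + s *\<^sub>R v + t *\<^sub>R u \<in> S"
  proof (intro ballI)
    fix s t assume "s \<in> {0..h}" "t \<in> {0..h}"
    then have "z + t *\<^sub>R u + s *\<^sub>R v \<in> S" using rect1 by blast
    then show "z + s *\<^sub>R v + t *\<^sub>R u \<in> S" by (simp only: add.assoc add.commute[of "s *\<^sub>R v"])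
  qed
  obtain s t where 1: "0 \<le> s" "s \<le> h" "0 \<le> t" "t \<le> h"
    "F (z + h *\<^sub>R u + h *\<^sub>R v) - F (z + h *\<^sub>R u) - F (z + h *\<^sub>R v) + F z = h^2 * A (z + s *\<^sub>R u + t *\<^sub>R v)"
    using second_difference[OF assms(1,2) \<open>h > 0\<close> rect1] unfolding A_def by (elim exE conjE)
  obtain s' t' where 2: "0 \<le> s'" "s' \<le> h" "0 \<le> t'" "t' \<le> h"
    "F (z + h *\<^sub>R v + h *\<^sub>R u) - F (z + h *\<^sub>R v) - F (z + h *\<^sub>R u) + F z = h^2 * B (z + s' *\<^sub>R v + t' *\<^sub>R u)"
    using second_difference[OF assms(1,2) \<open>h > 0\<close> rect2] unfolding B_def by (elim exE conjE)
  have "h^2 * A (z + s *\<^sub>R u + t *\<^sub>R v) = h^2 * B (z + s' *\<^sub>R v + t' *\<^sub>R u)"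
    using 1(5) 2(5) by (simp add: algebra_simps)
  then have "A (z + s *\<^sub>R u + t *\<^sub>R v) = B (z + s' *\<^sub>R v + t' *\<^sub>R u)" using \<open>h > 0\<close> by simp
  moreover have "dist (A (z + s *\<^sub>R u + t *\<^sub>R v)) (A z) < e"
    by (rule d(3)) (use near[OF 1(1-4)] in \<open>simp add: dist_norm add.assoc\<close>)
  moreover have "dist (B (z + s' *\<^sub>R v + t' *\<^sub>R u)) (B z) < e"
    by (rule d(4)) (use near[OF 2(3,4,1,2)] in \<open>simp add: dist_norm algebra_simps\<close>)
  ultimately show False by (simp add: dist_real_def e_def abs_if split: if_splits)
qed

lemma frechet_derivative_bounded_linear:
  "bounded_linear L \<Longrightarrow> f differentiable (at x) \<Longrightarrow>
    frechet_derivative (\<lambda>x. L (f x)) (at x) v = L (frechet_derivative f (at x) v)"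
  using frechet_derivative_at[OF bounded_linear.has_derivative[OF _ frechet_derivative_works[THEN iffD1]]]
  by metis

lemma second_derivative_symmetric:
  fixes F :: "'a::euclidean_space \<Rightarrow> 'b::euclidean_space"
  assumes "open S" "smooth_on S F" "z \<in> S"
  shows "frechet_derivative (\<lambda>x. frechet_derivative F (at x) u) (at z) v =
         frechet_derivative (\<lambda>x. frechet_derivative F (at x) v) (at z) u"
proof (rule euclidean_eqI)
  fix b :: 'b
  have *: "frechet_derivative (\<lambda>x. frechet_derivative F (at x) u) (at z) v \<bullet> b =
      frechet_derivative (\<lambda>x. frechet_derivative (\<lambda>x. F x \<bullet> b) (at x) u) (at z) v" for u v
  proof -
    have "frechet_derivative (\<lambda>x. frechet_derivative F (at x) u) (at z) v \<bullet> b =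
        frechet_derivative (\<lambda>x. frechet_derivative F (at x) u \<bullet> b) (at z) v"
      by (rule frechet_derivative_bounded_linear[symmetric, OF bounded_linear_inner_left])
         (rule smooth_on_differentiable[OF smooth_on_derivative_const[OF assms(2)] assms(3)])
    also have "frechet_derivative (\<lambda>x. frechet_derivative F (at x) u \<bullet> b) (at z) =
        frechet_derivative (\<lambda>x. frechet_derivative (\<lambda>x. F x \<bullet> b) (at x) u) (at z)"
    proof (rule frechet_derivative_transform_within_open[OF _ assms(1,3)])
      show "(\<lambda>x. frechet_derivative F (at x) u \<bullet> b) differentiable at z"
        by (intro smooth_on_differentiable[OF _ assms(3)] smooth_on_inner smooth_on_const
            smooth_on_derivative_const assms)
    qed (simp add: frechet_derivative_bounded_linear[OF bounded_linear_inner_left] smooth_on_differentiable[OF assms(2)])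
    finally show ?thesis .
  qed
  show "frechet_derivative (\<lambda>x. frechet_derivative F (at x) u) (at z) v \<bullet> b =
        frechet_derivative (\<lambda>x. frechet_derivative F (at x) v) (at z) u \<bullet> b"
    unfolding * by (rule second_derivative_symmetric_real[OF assms(1) _ assms(3)])
      (intro smooth_on_inner smooth_on_const assms)
qed

section \<open>Derivatives along moving directions\<close>

lemma frechet_derivativeI: "(f has_derivative f') (at z) \<Longrightarrow> frechet_derivative f (at z) = f'"
  by (rule frechet_derivative_at[symmetric])

lemma has_derivative_nth:
  "(f has_derivative f') F \<Longrightarrow> ((\<lambda>x. f x $ i) has_derivative (\<lambda>v. f' v $ i)) F"
  by (rule bounded_linear.has_derivative[OF bounded_linear_vec_nth])

text \<open>By symmetry \<open>u\<close> may be moved to the outer differentiation, where linearity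
  is that of a derivative.\<close>

lemma linear_second_derivative:
  assumes "smooth_on S F" "z \<in> S" "open S"
  shows "linear (\<lambda>u. frechet_derivative (\<lambda>w. frechet_derivative F (at w) u) (at z) v)"
proof -
  have lin: "linear (\<lambda>u. frechet_derivative (\<lambda>w. frechet_derivative F (at w) v) (at z) u)"
    by (rule smooth_on_linear_derivative[OF smooth_on_derivative_const[OF assms(1)] assms(2)])
  then show ?thesis using second_derivative_symmetric[OF assms(3,1,2)] by simp
qed

text \<open>Product rule for a derivative taken in a direction that itself varies, obtained by
  expanding \<open>Y\<close> over \<open>Basis\<close>. It serves to differentiate pushed-forward
  vector fields and iterated covariant derivatives.\<close>

lemma derivative_along:
  assumes "open S" "smooth_on S F" "z \<in> S" "(Y has_derivative Y') (at z)"
  shows "((\<lambda>w. frechet_derivative F (at w) (Y w)) has_derivative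
    (\<lambda>v. frechet_derivative (\<lambda>w. frechet_derivative F (at w) (Y z)) (at z) v
       + frechet_derivative F (at z) (Y' v))) (at z)"
proof (rule has_derivative_transform_within_open[OF _ assms(1,3)])
  let ?S = "\<lambda>b v. frechet_derivative (\<lambda>w. frechet_derivative F (at w) b) (at z) v"
  show "((\<lambda>w. \<Sum>b\<in>Basis. (Y w \<bullet> b) *\<^sub>R frechet_derivative F (at w) b) has_derivative
    (\<lambda>v. ?S (Y z) v + frechet_derivative F (at z) (Y' v))) (at z)"
  proof (rule has_derivative_eq_rhs)
    show "((\<lambda>w. \<Sum>b\<in>Basis. (Y w \<bullet> b) *\<^sub>R frechet_derivative F (at w) b) has_derivative
      (\<lambda>v. \<Sum>b\<in>Basis. (Y z \<bullet> b) *\<^sub>R ?S b v + (Y' v \<bullet> b) *\<^sub>R frechet_derivative F (at z) b)) (at z)"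
      by (intro has_derivative_sum has_derivative_scaleR has_derivative_inner_left assms(4)
          smooth_on_has_derivative[OF smooth_on_derivative_const[OF assms(2)] assms(3)])
    show "(\<lambda>v. \<Sum>b\<in>Basis. (Y z \<bullet> b) *\<^sub>R ?S b v + (Y' v \<bullet> b) *\<^sub>R frechet_derivative F (at z) b) =
      (\<lambda>v. ?S (Y z) v + frechet_derivative F (at z) (Y' v))"
      by (rule ext) (simp only: sum.distrib
          linear_basis_expansion[OF linear_second_derivative[OF assms(2,3,1)], of "Y z", symmetric]
          linear_basis_expansion[OF smooth_on_linear_derivative[OF assms(2,3)], symmetric])
  qed
  show "(\<Sum>b\<in>Basis. (Y w \<bullet> b) *\<^sub>R frechet_derivative F (at w) b) = frechet_derivative F (at w) (Y w)"
    if "w \<in> S" for w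
    by (rule linear_basis_expansion[symmetric, OF smooth_on_linear_derivative[OF assms(2) that]])
qed

subsection \<open>The derivative of the determinant\<close>

text \<open>In the differentiated Leibniz formula one factor is removed from each product. A
  permutation other than the identity moves at least the two points \<open>a\<close> and
  \<open>p a\<close>, so a vanishing off-diagonal entry of the identity matrix survives; only
  \<open>p = id\<close> contributes, and it gives the trace.\<close>

lemma det_derivative_id:
  fixes F :: "'a::real_normed_vector \<Rightarrow> real ^ 'n ^ 'n"
  assumes F: "(F has_derivative F') (at z)" and one: "F z = mat 1"
  shows "((\<lambda>w. det (F w)) has_derivative (\<lambda>v. trace (F' v))) (at z)"
proof -
  have nth: "((\<lambda>w. F w $ i $ j) has_derivative (\<lambda>v. F' v $ i $ j)) (at z)" for i j
    by (rule bounded_linear.has_derivative[OF bounded_linear_vec_nth[of j]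
        bounded_linear.has_derivative[OF bounded_linear_vec_nth[of i] F]])
  have D: "((\<lambda>w. det (F w)) has_derivative (\<lambda>v. \<Sum>p | p permutes UNIV. of_int (sign p) *
      (\<Sum>i\<in>UNIV. F' v $ i $ p i * (\<Prod>j\<in>UNIV - {i}. F z $ j $ p j)))) (at z)"
    unfolding det_def
    by (intro has_derivative_sum has_derivative_mult_right has_derivative_prod nth)
  have T: "(\<Sum>i\<in>UNIV. F' v $ i $ p i * (\<Prod>j\<in>UNIV - {i}. F z $ j $ p j)) = (if p = id then trace (F' v) else 0)"
    if p: "p permutes (UNIV :: 'n set)" for v p
  proof (cases "p = id")
    case True
    then show ?thesis by (simp add: one mat_def trace_def)
  next
    case False
    then obtain a where a: "p a \<noteq> a" by (auto simp: fun_eq_iff)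
    have "(\<Prod>j\<in>UNIV - {i}. F z $ j $ p j) = 0" for i
    proof -
      have "p (p a) \<noteq> p a" using a permutes_inj[OF p] by (meson injD)
      then obtain j where "j \<noteq> i" "p j \<noteq> j" using a by metis
      then show ?thesis by (intro prod_zero) (auto simp: one mat_def intro!: bexI[of _ j])
    qed
    then show ?thesis using False by (simp only: mult_zero_right sum.neutral_const if_False)
  qed
  have "(\<Sum>p | p permutes UNIV. of_int (sign p) * (\<Sum>i\<in>UNIV. F' v $ i $ p i * (\<Prod>j\<in>UNIV - {i}. F z $ j $ p j)))
      = trace (F' v)" (is "?S = _") for v
  proof -
    have "?S = (\<Sum>p | p permutes (UNIV :: 'n set). if p = id then trace (F' v) else 0)"
      by (intro sum.cong refl) (use T in auto)
    also have "\<dots> = trace (F' v)"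
      using sum.delta[OF finite_permutations[of "UNIV :: 'n set"], of id "\<lambda>_. trace (F' v)"]
      by (simp add: permutes_id eq_commute)
    finally show ?thesis .
  qed
  then show ?thesis using D by simp
qed

text \<open>Jacobi's formula. Multiplication by the constant matrix inverse to \<open>F z\<close>
  moves the base point to the identity.\<close>

lemma det_derivative:
  fixes F :: "'a::real_normed_vector \<Rightarrow> real ^ 'n ^ 'n"
  assumes F: "(F has_derivative F') (at z)" and inv: "invertible (F z)"
  shows "((\<lambda>w. det (F w)) has_derivative (\<lambda>v. det (F z) * trace (matrix_inv (F z) ** F' v))) (at z)"
proof -
  let ?A = "matrix_inv (F z)"
  have bl: "bounded_linear (\<lambda>M. ?A ** M)"
    unfolding linear_conv_bounded_linear[symmetric]
    by (rule linearI, rule matrix_add_ldistrib)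
       (simp add: vec_eq_iff matrix_matrix_mult_def sum_distrib_left mult_ac)
  have "((\<lambda>w. det (?A ** F w)) has_derivative (\<lambda>v. trace (?A ** F' v))) (at z)"
    by (rule det_derivative_id[OF bounded_linear.has_derivative[OF bl F]]) (rule invertible_matrix_inv(2)[OF inv])
  then have "((\<lambda>w. det (F z) * det (?A ** F w)) has_derivative (\<lambda>v. det (F z) * trace (?A ** F' v))) (at z)"
    by (rule has_derivative_mult_right)
  moreover have "det (F z) * det ?A = 1"
    using arg_cong[OF invertible_matrix_inv(1)[OF inv], of det] by (simp add: det_mul)
  then have "(\<lambda>w. det (F z) * det (?A ** F w)) = (\<lambda>w. det (F w))"
    by (simp add: det_mul mult.assoc[symmetric])
  ultimately show ?thesis by simp
qed

section \<open>Alternating functions of lists\<close>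

text \<open>Only adjacent exchanges, written with append, since this form fits induction on lists;
  the length condition of \<open>multivector\<close> is kept apart because prefixing or suffixing
  the argument changes the degree.\<close>

definition alternating :: "'m mv \<Rightarrow> bool" where
  "alternating \<alpha> \<longleftrightarrow> (\<forall>A x y B. \<alpha> (A @ x # y # B) = - \<alpha> (A @ y # x # B))"

lemma alternatingD: "alternating \<alpha> \<Longrightarrow> \<alpha> (A @ x # y # B) = - \<alpha> (A @ y # x # B)"
  unfolding alternating_def by blast

lemma alternating_move:
  "alternating \<alpha> \<Longrightarrow> \<alpha> (A @ B @ x # C) = (-1) ^ length B * \<alpha> (A @ x # B @ C)"
proof (induction B arbitrary: A)
  case (Cons b B)
  have "\<alpha> (A @ (b # B) @ x # C) = \<alpha> ((A @ [b]) @ B @ x # C)" by simp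
  also have "\<dots> = (-1) ^ length B * \<alpha> (A @ b # x # B @ C)" using Cons.IH[OF Cons.prems, of "A @ [b]"] by simp
  also have "\<alpha> (A @ b # x # B @ C) = - \<alpha> (A @ x # b # B @ C)" by (rule alternatingD[OF Cons.prems])
  finally show ?case by simp
qed simp

lemma alternating_swap:
  assumes "alternating \<alpha>"
  shows "\<alpha> (A @ x # B @ y # C) = - \<alpha> (A @ y # B @ x # C)"
  using alternating_move[OF assms, of "A @ [x]" B y C] alternating_move[OF assms, of "A @ [y]" B x C]
    alternatingD[OF assms, of A x y "B @ C"]
  by simp

lemma multivector_iff_alternating:
  "multivector p \<alpha> \<longleftrightarrow> (\<forall>I. length I \<noteq> p \<longrightarrow> \<alpha> I = 0) \<and> alternating \<alpha>"
proof
  assume L: "multivector p \<alpha>"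
  have "\<alpha> (A @ x # y # B) = - \<alpha> (A @ y # x # B)" for A x y B
  proof -
    have sw: "\<And>I r s. r < s \<and> s < length I \<Longrightarrow> \<alpha> (I[r := I ! s, s := I ! r]) = - \<alpha> I"
      using L by (simp add: multivector_def)
    show ?thesis
      using sw[of "length A" "Suc (length A)" "A @ y # x # B"] by (simp add: nth_append list_update_append)
  qed
  then show "(\<forall>I. length I \<noteq> p \<longrightarrow> \<alpha> I = 0) \<and> alternating \<alpha>"
    using L unfolding multivector_def alternating_def by blast
next
  assume R: "(\<forall>I. length I \<noteq> p \<longrightarrow> \<alpha> I = 0) \<and> alternating \<alpha>"
  have "\<alpha> (I[r := I ! s, s := I ! r]) = - \<alpha> I" if rs: "r < s" "s < length I" for I r s
  proof -
    define A where "A = take r I"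
    define B where "B = take (s - Suc r) (drop (Suc r) I)"
    define C where "C = drop (Suc s) I"
    have len: "length A = r" "length B = s - Suc r" using rs by (auto simp: A_def B_def)
    have "drop (Suc r) I = B @ I ! s # C"
      using id_take_nth_drop[of "s - Suc r" "drop (Suc r) I"] rs by (simp add: B_def C_def)
    then have I: "I = A @ I ! r # B @ I ! s # C"
      using id_take_nth_drop[of r I] rs by (simp add: A_def)
    have s: "s = Suc (length A + length B)" using rs len by simp
    have "(A @ x # B @ y # C)[r := y, s := x] = A @ y # B @ x # C" for x y
      by (simp add: s len(1)[symmetric] list_update_append)
    then have "I[r := I ! s, s := I ! r] = A @ I ! s # B @ I ! r # C" using I by metis
    then show ?thesis using alternating_swap[of \<alpha> A "I ! s" B "I ! r" C] R I by simp
  qed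
  then show "multivector p \<alpha>" using R by (simp add: multivector_def)
qed

lemma multivector_length: "multivector p \<alpha> \<Longrightarrow> length I \<noteq> p \<Longrightarrow> \<alpha> I = 0"
  by (simp add: multivector_def)

lemma multivector_alternating: "multivector p \<alpha> \<Longrightarrow> alternating \<alpha>"
  by (simp add: multivector_iff_alternating)

lemma alternating_not_distinct:
  assumes "alternating \<alpha>" "\<not> distinct I"
  shows "\<alpha> I = 0"
proof -
  obtain xs y ys zs where I: "I = xs @ [y] @ ys @ [y] @ zs" using not_distinct_decomp[OF assms(2)] by blast
  then show ?thesis using alternating_swap[OF assms(1), of xs y ys y zs] by simp
qed

lemma alternating_prefix: "alternating \<alpha> \<Longrightarrow> alternating (\<lambda>J. \<alpha> (I @ J))"
  unfolding alternating_def by (metis append.assoc)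

lemma alternating_Cons: "alternating \<alpha> \<Longrightarrow> alternating (\<lambda>J. \<alpha> (x # J))"
  using alternating_prefix[of \<alpha> "[x]"] by simp

lemma alternating_suffix: "alternating \<alpha> \<Longrightarrow> alternating (\<lambda>J. \<alpha> (J @ I))"
  unfolding alternating_def by (metis append.assoc append_Cons)

lemma alternating_scale: "alternating \<alpha> \<Longrightarrow> alternating (\<lambda>J. c * \<alpha> J)"
  unfolding alternating_def by (metis mult_minus_right)

lemma alternating_sum: "(\<And>i. i \<in> A \<Longrightarrow> alternating (\<alpha> i)) \<Longrightarrow> alternating (\<lambda>J. \<Sum>i\<in>A. \<alpha> i J)"
  unfolding alternating_def sum_negf[symmetric] by (blast intro: sum.cong)

text \<open>The sign is chosen before \<open>\<alpha>\<close>, hence is common to all alternating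
  functions. An arbitrary one can thereby be compared with a normalized one such as
  \<open>eps\<close>.\<close>

lemma alternating_permutation:
  assumes "mset I = mset J"
  shows "\<exists>s. (s = 1 \<or> s = -1) \<and> (\<forall>\<alpha>. alternating \<alpha> \<longrightarrow> \<alpha> I = s * \<alpha> J)"
  using assms
proof (induction J arbitrary: I)
  case Nil
  then show ?case by (auto intro: exI[of _ 1])
next
  case (Cons x J)
  then have "x \<in> set I" by (metis list.set_intros(1) set_mset_mset)
  then obtain A B where I: "I = A @ x # B" by (meson split_list)
  then have "mset (A @ B) = mset J" using Cons.prems by simp
  then obtain s where s: "s = 1 \<or> s = -1" "\<And>\<alpha>. alternating \<alpha> \<Longrightarrow> \<alpha> (A @ B) = s * \<alpha> J"
    using Cons.IH by blast
  have "\<alpha> I = ((-1) ^ length A * s) * \<alpha> (x # J)" if "alternating \<alpha>" for \<alpha>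
    using alternating_move[OF that, of "[]" A x B] s(2)[OF alternating_Cons[OF that, of x]] by (simp add: I)
  moreover have "(-1) ^ length A * s = 1 \<or> (-1) ^ length A * s = -1"
    using s(1) by (cases "even (length A)") auto
  ultimately show ?case by blast
qed

subsection \<open>The alternating symbol\<close>

definition list_pos :: "'m list \<Rightarrow> 'm \<Rightarrow> nat" where
  "list_pos es i = length (takeWhile (\<lambda>j. j \<noteq> i) es)"

text \<open>The Levi-Civita symbol, as the determinant of a matrix of unit rows. Rows of a matrix
  are indexed by the type \<open>'m\<close>, which carries no order; \<open>list_pos es\<close>
  translates a row index into a position of the list, so that \<open>es\<close> itself gets the
  value 1.\<close>

definition eps :: "'m::finite list \<Rightarrow> 'm mv" where
  "eps es I = (if length I = CARD('m) then det (\<chi> i. axis (I ! list_pos es i) 1 :: real ^ 'm ^ 'm) else 0)"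

locale coordinate_order =
  fixes es :: "'m::finite list"
  assumes dist: "distinct es" and set_es: "set es = UNIV"
begin

lemma length_es: "length es = CARD('m)"
  using distinct_card[OF dist] set_es by simp

lemma list_pos_less: "list_pos es i < CARD('m)" and nth_list_pos: "es ! list_pos es i = i"
proof -
  obtain xs ys where "es = xs @ i # ys" "i \<notin> set xs" using split_list_first[of i es] set_es by auto
  moreover from this have "list_pos es i = length xs"
    unfolding list_pos_def by (subst (1) \<open>es = _\<close>, subst takeWhile_append2) auto
  ultimately show "list_pos es i < CARD('m)" "es ! list_pos es i = i"
    by (auto simp: length_es[symmetric])
qed

lemma list_pos_nth: "r < CARD('m) \<Longrightarrow> list_pos es (es ! r) = r"
  using nth_list_pos[of "es ! r"] list_pos_less[of "es ! r"] dist by (simp add: nth_eq_iff_index_eq length_es)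

lemma bij_list_pos: "bij_betw (list_pos es) UNIV {..<CARD('m)}"
  by (rule bij_betw_byWitness[where f' = "(!) es"]) (auto simp: nth_list_pos list_pos_nth list_pos_less)

lemma eps_self: "eps es es = 1"
proof -
  have "(\<chi> i. axis i 1 :: real ^ 'm ^ 'm) = mat 1" by (simp add: vec_eq_iff axis_def mat_def eq_commute)
  then show ?thesis by (simp add: eps_def length_es nth_list_pos)
qed

text \<open>Exchanging two adjacent entries of the list exchanges the two rows \<open>a\<close> and
  \<open>b\<close> whose positions in \<open>es\<close> are those places.\<close>

lemma eps_multivector: "multivector (CARD('m)) (eps es)"
  unfolding multivector_iff_alternating alternating_def
proof (intro conjI allI impI)
  fix A B :: "'m list" and x y
  show "eps es (A @ x # y # B) = - eps es (A @ y # x # B)"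
  proof (cases "length (A @ x # y # B) = CARD('m)")
    case True
    define I where "I = A @ y # x # B"
    define a where "a = es ! length A"
    define b where "b = es ! Suc (length A)"
    have r: "Suc (length A) < CARD('m)" using True by simp
    have pos: "list_pos es a = length A" "list_pos es b = Suc (length A)"
      using list_pos_nth r by (auto simp: a_def b_def)
    then have "a \<noteq> b" by auto
    have "(A @ x # y # B) ! list_pos es i = I ! list_pos es (Transposition.transpose a b i)" for i
    proof (cases "i = a \<or> i = b")
      case True
      then show ?thesis using pos \<open>a \<noteq> b\<close> by (auto simp: I_def nth_append)
    next
      case False
      then have "list_pos es i \<noteq> length A" "list_pos es i \<noteq> Suc (length A)"
        using nth_list_pos[of i] by (auto simp: a_def b_def)
      then show ?thesis using False
        by (auto simp: I_def nth_append transpose_apply_other nth_Cons' )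
    qed
    then have "det (\<chi> i. axis ((A @ x # y # B) ! list_pos es i) 1 :: real ^ 'm ^ 'm) =
        det (\<chi> i. (\<chi> i. axis (I ! list_pos es i) 1 :: real ^ 'm ^ 'm) $ Transposition.transpose a b i)" by simp
    also have "\<dots> = - det (\<chi> i. axis (I ! list_pos es i) 1 :: real ^ 'm ^ 'm)"
      using \<open>a \<noteq> b\<close> by (subst det_permute_rows) (auto simp: permutes_swap_id sign_swap_id)
    finally show ?thesis using True by (simp add: eps_def I_def)
  qed (simp add: eps_def)
qed (simp add: eps_def)

lemma eps_alternating: "alternating (eps es)"
  by (rule multivector_alternating[OF eps_multivector])

lemma mset_eq_es: "distinct I \<Longrightarrow> length I = CARD('m) \<Longrightarrow> mset I = mset es"
  using set_es dist by (metis card_eq_UNIV_imp_eq_UNIV distinct_card finite set_eq_iff_mset_eq_distinct)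

lemma eps_distinct: "distinct I \<Longrightarrow> length I = CARD('m) \<Longrightarrow> eps es I = 1 \<or> eps es I = -1"
  using alternating_permutation[OF mset_eq_es] eps_alternating eps_self by fastforce

text \<open>The top exterior power is a line: on a list without repetition the values of
  \<open>\<alpha>\<close> and of \<open>eps es\<close> arise from those at \<open>es\<close> by the
  same sign, and elsewhere both vanish.\<close>

lemma top_multivector:
  assumes "multivector (CARD('m)) \<alpha>"
  shows "\<alpha> I = \<alpha> es * eps es I"
proof (cases "length I = CARD('m) \<and> distinct I")
  case True
  then obtain s where s: "\<And>\<alpha>::'m mv. alternating \<alpha> \<Longrightarrow> \<alpha> I = s * \<alpha> es"
    using alternating_permutation[OF mset_eq_es] by blast
  then show ?thesis
    using s[OF multivector_alternating[OF assms]] s[OF eps_alternating] eps_self by simp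
next
  case False
  then show ?thesis
    using multivector_length[OF assms] multivector_length[OF eps_multivector]
      alternating_not_distinct[OF multivector_alternating[OF assms]] alternating_not_distinct[OF eps_alternating]
    by (metis mult_zero_right)
qed

text \<open>The derivation induced by an endomorphism acts on the top exterior power as its trace.
  If \<open>L\<close> is distinct, replacing an entry by a different index creates a repetition, so
  only diagonal entries of \<open>B\<close> survive. If two entries coincide, only these two slots
  can contribute, and their contributions cancel by antisymmetry.\<close>

lemma eps_trace:
  fixes B :: "real ^ 'm ^ 'm"
  assumes "length L = CARD('m)"
  shows "(\<Sum>r<CARD('m). \<Sum>k\<in>UNIV. B $ (L ! r) $ k * eps es (L[r := k])) = trace B * eps es L"
proof (cases "distinct L")
  case True
  have bij: "bij_betw ((!) L) {..<CARD('m)} UNIV"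
    using bij_betw_nth[OF True, of "{..<CARD('m)}" UNIV] assms True
    by (metis card_eq_UNIV_imp_eq_UNIV distinct_card finite)
  have "(\<Sum>k\<in>UNIV. B $ (L ! r) $ k * eps es (L[r := k])) = B $ (L ! r) $ (L ! r) * eps es L"
    if "r < CARD('m)" for r
  proof -
    have "eps es (L[r := k]) = 0" if "k \<noteq> L ! r" for k
    proof (rule alternating_not_distinct[OF eps_alternating])
      have "k \<in> (!) L ` {..<CARD('m)}" using bij by (simp add: bij_betw_def)
      then obtain s where s: "s < CARD('m)" "L ! s = k" by blast
      then show "\<not> distinct (L[r := k])"
        using that \<open>r < CARD('m)\<close> assms nth_eq_iff_index_eq[of "L[r := k]" r s] by auto
    qed
    then have "(\<Sum>k\<in>UNIV. B $ (L ! r) $ k * eps es (L[r := k])) =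
        (\<Sum>k\<in>{L ! r}. B $ (L ! r) $ k * eps es (L[r := k]))"
      by (intro sum.mono_neutral_right) auto
    then show ?thesis by simp
  qed
  then have "(\<Sum>r<CARD('m). \<Sum>k\<in>UNIV. B $ (L ! r) $ k * eps es (L[r := k])) =
      (\<Sum>r<CARD('m). B $ (L ! r) $ (L ! r)) * eps es L"
    by (simp add: sum_distrib_right)
  also have "(\<Sum>r<CARD('m). B $ (L ! r) $ (L ! r)) = trace B"
    using sum.reindex_bij_betw[OF bij, of "\<lambda>i. B $ i $ i"] by (simp add: trace_def)
  finally show ?thesis .
next
  case False
  then obtain a b where ab: "a < b" "b < CARD('m)" "L ! a = L ! b"
    using assms by (metis distinct_conv_nth nat_neq_iff)
  define f where "f r = (\<Sum>k\<in>UNIV. B $ (L ! r) $ k * eps es (L[r := k]))" for r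
  have "f r = 0" if "r \<noteq> a" "r \<noteq> b" for r
  proof -
    have "\<not> distinct (L[r := k])" for k
      using that ab assms nth_eq_iff_index_eq[of "L[r := k]" a b] by auto
    then show ?thesis by (simp add: f_def alternating_not_distinct[OF eps_alternating])
  qed
  then have "(\<Sum>r<CARD('m). f r) = (\<Sum>r\<in>{a, b}. f r)"
    using ab by (intro sum.mono_neutral_right) auto
  also have "\<dots> = f a + f b" using ab by simp
  also have "f b = - f a"
  proof -
    have "eps es (L[b := k]) = - eps es (L[a := k])" for k
    proof -
      have "(L[a := k])[a := L[a := k] ! b, b := L[a := k] ! a] = L[b := k]"
        using ab assms by (simp add: list_update_swap) (metis less_irrefl list_update_id nth_list_update_neq)
      then show ?thesis
        using eps_multivector ab assms unfolding multivector_def by (metis length_list_update)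
    qed
    then show ?thesis using ab(3) by (simp add: f_def sum_negf)
  qed
  finally show ?thesis using False by (simp add: f_def alternating_not_distinct[OF eps_alternating])
qed

text \<open>Lists of full length correspond to functions on the index type through
  \<open>es\<close>; the sum then has the shape produced by expanding a determinant along all its
  rows.\<close>

lemma sum_lists_functions:
  "(\<Sum>J | length J = CARD('m). F J) = (\<Sum>f\<in>(UNIV :: ('m \<Rightarrow> 'm) set). F (map f es))"
proof -
  have "map (\<lambda>i. J ! list_pos es i) es = J" if "length J = CARD('m)" for J :: "'m list"
    by (rule nth_equalityI) (auto simp: length_es list_pos_nth that)
  then show ?thesis
    by (intro sum.reindex_bij_witness[where j = "\<lambda>J i. J ! list_pos es i" and i = "\<lambda>f. map f es"])
       (auto simp: length_es nth_list_pos list_pos_less list_pos_nth intro!: ext)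
qed

text \<open>Multilinearity of the determinant in the rows of \<open>P ** A\<close>, the matrix of
  rows of \<open>A\<close> selected by \<open>L\<close>. As \<open>det P\<close> is the symbol at
  \<open>L\<close>, lists with repetitions are covered too.\<close>

lemma det_eps:
  fixes A :: "real ^ 'm ^ 'm"
  assumes "length L = CARD('m)"
  shows "(\<Sum>J | length J = CARD('m). (\<Prod>r<CARD('m). A $ (L ! r) $ (J ! r)) * eps es J) = det A * eps es L"
proof -
  define P where "P = (\<chi> i. axis (L ! list_pos es i) 1 :: real ^ 'm ^ 'm)"
  have row: "(P ** A) $ i = A $ (L ! list_pos es i)" for i
    by (simp add: P_def matrix_matrix_mult_def vec_eq_iff axis_def if_distrib[of "\<lambda>x. x * _"] cong: if_cong)
  have "(\<Sum>J | length J = CARD('m). (\<Prod>r<CARD('m). A $ (L ! r) $ (J ! r)) * eps es J) =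
      (\<Sum>f\<in>UNIV. (\<Prod>r<CARD('m). A $ (L ! r) $ f (es ! r)) * eps es (map f es))"
    by (subst sum_lists_functions) (intro sum.cong arg_cong2[where f = "(*)"] prod.cong, auto simp: length_es)
  also have "\<dots> = (\<Sum>f\<in>UNIV. det (\<chi> i. (A $ (L ! list_pos es i) $ f i) *s axis (f i) 1 :: real ^ 'm ^ 'm))"
  proof (intro sum.cong refl)
    fix f :: "'m \<Rightarrow> 'm"
    have "(\<Prod>r<CARD('m). A $ (L ! r) $ f (es ! r)) = (\<Prod>i\<in>UNIV. A $ (L ! list_pos es i) $ f i)"
      using prod.reindex_bij_betw[OF bij_list_pos, of "\<lambda>r. A $ (L ! r) $ f (es ! r)"] by (simp add: nth_list_pos)
    moreover have "eps es (map f es) = det (\<chi> i. axis (f i) 1 :: real ^ 'm ^ 'm)"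
      by (simp add: eps_def length_es list_pos_less nth_list_pos)
    ultimately show "(\<Prod>r<CARD('m). A $ (L ! r) $ f (es ! r)) * eps es (map f es) =
        det (\<chi> i. (A $ (L ! list_pos es i) $ f i) *s axis (f i) 1 :: real ^ 'm ^ 'm)"
      by (simp add: det_rows_mul)
  qed
  also have "\<dots> = det (\<chi> i. \<Sum>j\<in>UNIV. (A $ (L ! list_pos es i) $ j) *s axis j 1 :: real ^ 'm ^ 'm)"
    using det_linear_rows_sum[of "UNIV :: 'm set" "\<lambda>i j. (A $ (L ! list_pos es i) $ j) *s (axis j 1 :: real ^ 'm)"]
    by simp
  also have "(\<chi> i. \<Sum>j\<in>UNIV. (A $ (L ! list_pos es i) $ j) *s axis j 1 :: real ^ 'm ^ 'm) = P ** A"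
    by (simp add: vec_eq_iff row axis_def if_distrib[of "\<lambda>x. _ * x"] cong: if_cong)
  finally show ?thesis using assms by (simp add: det_mul P_def eps_def)
qed

end

section \<open>The exterior product\<close>

lemma wedge_Nil: "wedge \<alpha> \<beta> [] = \<alpha> [] * \<beta> []"
  by (simp add: wedge_def shuffle_sign_def)

lemma card_map_prod_Suc: "card (map_prod Suc Suc ` R) = card R"
  by (rule card_image[OF inj_on_subset[OF prod.inj_map[OF inj_Suc inj_Suc] subset_UNIV]])

lemma shuffle_sign_Suc: "shuffle_sign (Suc n) (insert 0 (Suc ` S)) = shuffle_sign n S"
proof -
  have "{(r, s). r < s \<and> s < Suc n \<and> r \<notin> insert 0 (Suc ` S) \<and> s \<in> insert 0 (Suc ` S)} =
      map_prod Suc Suc ` {(r, s). r < s \<and> s < n \<and> r \<notin> S \<and> s \<in> S}"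
    (is "?L = _ ` ?R")
  proof (rule set_eqI, clarify)
    fix r s show "(r, s) \<in> ?L \<longleftrightarrow> (r, s) \<in> map_prod Suc Suc ` ?R"
      by (cases r; cases s) (auto simp: image_iff)
  qed
  then show ?thesis
    by (simp only: shuffle_sign_def card_map_prod_Suc)
qed

text \<open>With position 0 left out, every selected position has to pass it, which adds
  \<open>card S\<close> inversions.\<close>

lemma shuffle_sign_Suc':
  assumes "S \<subseteq> {..<n}"
  shows "shuffle_sign (Suc n) (Suc ` S) = (-1) ^ card S * shuffle_sign n S"
proof -
  let ?R = "{(r, s). r < s \<and> s < n \<and> r \<notin> S \<and> s \<in> S}"
  have fin: "finite S" using assms finite_subset by blast
  have "?R \<subseteq> {..<n} \<times> {..<n}" by auto
  then have finR: "finite ?R" by (rule finite_subset) simp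
  have "{(r, s). r < s \<and> s < Suc n \<and> r \<notin> Suc ` S \<and> s \<in> Suc ` S} =
      Pair 0 ` Suc ` S \<union> map_prod Suc Suc ` ?R" (is "?L = ?U")
  proof (rule set_eqI, clarify)
    fix r s show "(r, s) \<in> ?L \<longleftrightarrow> (r, s) \<in> ?U"
      using assms by (cases r; cases s) (auto simp: image_iff)
  qed
  also have "card \<dots> = card S + card ?R"
    using fin finR by (subst card_Un_disjoint) (auto simp: card_map_prod_Suc card_image inj_on_def)
  finally show ?thesis by (simp add: shuffle_sign_def power_add)
qed

lemma length_nths_subset: "S \<subseteq> {..<length I} \<Longrightarrow> length (nths I S) = card S"
proof -
  assume "S \<subseteq> {..<length I}"
  then have "{i. i < length I \<and> i \<in> S} = S" by auto
  then show ?thesis by (simp add: length_nths)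
qed

text \<open>The set of positions assigned to the first factor either contains the first position or
  does not. In the second case the entry \<open>x\<close> belongs to \<open>\<beta>\<close> and all
  arguments of \<open>\<alpha>\<close> are moved across it, hence the sign by length. The inductions
  over index lists below rest on this recursion.\<close>

lemma wedge_Cons:
  "wedge \<alpha> \<beta> (x # I) =
     wedge (\<lambda>J. \<alpha> (x # J)) \<beta> I + wedge (\<lambda>J. (-1) ^ length J * \<alpha> J) (\<lambda>J. \<beta> (x # J)) I"
proof -
  let ?n = "length I"
  let ?t = "\<lambda>S. shuffle_sign (Suc ?n) S * \<alpha> (nths (x # I) S) * \<beta> (nths (x # I) (- S))"
  have Pow: "Pow {..<Suc ?n} = image Suc ` Pow {..<?n} \<union> insert 0 ` image Suc ` Pow {..<?n}"
    by (simp add: lessThan_Suc_eq_insert_0 Pow_insert image_Pow_surj[OF refl])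
  have disj: "image Suc ` Pow {..<?n} \<inter> insert 0 ` image Suc ` Pow {..<?n} = {}" by auto
  have inj1: "inj_on (image Suc) (Pow {..<?n})" by (auto simp: inj_on_def inj_image_eq_iff)
  have inj2: "inj_on (insert 0) (image Suc ` Pow {..<?n})"
    by (rule inj_onI) (metis (no_types, lifting) Diff_insert_absorb imageE nat.distinct(1))
  have nths1: "nths (x # I) (Suc ` S) = nths I S" "nths (x # I) (- Suc ` S) = x # nths I (- S)"
    "nths (x # I) (insert 0 (Suc ` S)) = x # nths I S" "nths (x # I) (- insert 0 (Suc ` S)) = nths I (- S)" for S
  proof -
    have "{j. Suc j \<in> Suc ` S} = S" "{j. Suc j \<in> - Suc ` S} = - S" "{j. Suc j \<in> insert 0 (Suc ` S)} = S"
      "{j. Suc j \<in> - insert 0 (Suc ` S)} = - S" by auto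
    then show "nths (x # I) (Suc ` S) = nths I S" "nths (x # I) (- Suc ` S) = x # nths I (- S)"
      "nths (x # I) (insert 0 (Suc ` S)) = x # nths I S" "nths (x # I) (- insert 0 (Suc ` S)) = nths I (- S)"
      by (simp_all only: nths_Cons) auto
  qed
  have "wedge \<alpha> \<beta> (x # I) = (\<Sum>S\<in>Pow {..<Suc ?n}. ?t S)"
    by (simp add: wedge_def)
  also have "\<dots> = (\<Sum>S\<in>Pow {..<?n}. ?t (Suc ` S)) + (\<Sum>S\<in>Pow {..<?n}. ?t (insert 0 (Suc ` S)))"
    unfolding Pow by (simp add: sum.union_disjoint disj sum.reindex inj1 inj2)
  also have "(\<Sum>S\<in>Pow {..<?n}. ?t (Suc ` S)) = wedge (\<lambda>J. (-1) ^ length J * \<alpha> J) (\<lambda>J. \<beta> (x # J)) I"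
    unfolding wedge_def
    by (intro sum.cong refl) (simp add: nths1 shuffle_sign_Suc' length_nths_subset)
  also have "(\<Sum>S\<in>Pow {..<?n}. ?t (insert 0 (Suc ` S))) = wedge (\<lambda>J. \<alpha> (x # J)) \<beta> I"
    unfolding wedge_def by (intro sum.cong refl) (simp add: nths1 shuffle_sign_Suc)
  finally show ?thesis by simp
qed

lemma wedge_scale_left: "wedge (\<lambda>J. c * \<alpha> J) \<beta> I = c * wedge \<alpha> \<beta> I"
  by (simp add: wedge_def sum_distrib_left mult_ac)

lemma wedge_scale_right: "wedge \<alpha> (\<lambda>J. c * \<beta> J) I = c * wedge \<alpha> \<beta> I"
  by (simp add: wedge_def sum_distrib_left mult_ac)

lemma wedge_uminus_left: "wedge (\<lambda>J. - \<alpha> J) \<beta> I = - wedge \<alpha> \<beta> I"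
  using wedge_scale_left[of "-1"] by simp

lemma wedge_uminus_right: "wedge \<alpha> (\<lambda>J. - \<beta> J) I = - wedge \<alpha> \<beta> I"
  using wedge_scale_right[of _ "-1"] by simp

lemma wedge_zero: "wedge (\<lambda>J. 0) \<beta> I = 0" "wedge \<alpha> (\<lambda>J. 0) I = 0"
  by (simp_all add: wedge_def)

lemma wedge_add_left: "wedge (\<lambda>J. \<alpha> J + \<alpha>' J) \<beta> I = wedge \<alpha> \<beta> I + wedge \<alpha>' \<beta> I"
  by (simp add: wedge_def sum.distrib[symmetric] algebra_simps)

lemma wedge_add_right: "wedge \<alpha> (\<lambda>J. \<beta> J + \<beta>' J) I = wedge \<alpha> \<beta> I + wedge \<alpha> \<beta>' I"
  by (simp add: wedge_def sum.distrib[symmetric] algebra_simps)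

lemma wedge_diff_right: "wedge \<alpha> (\<lambda>J. \<beta> J - \<beta>' J) I = wedge \<alpha> \<beta> I - wedge \<alpha> \<beta>' I"
  by (simp add: wedge_def sum_subtractf[symmetric] algebra_simps)

lemma wedge_sum_left: "wedge (\<lambda>J. \<Sum>i\<in>A. \<alpha> i J) \<beta> I = (\<Sum>i\<in>A. wedge (\<alpha> i) \<beta> I)"
  by (induction A rule: infinite_finite_induct) (simp_all add: wedge_zero wedge_add_left)

lemma wedge_sum_right: "wedge \<alpha> (\<lambda>J. \<Sum>i\<in>A. \<beta> i J) I = (\<Sum>i\<in>A. wedge \<alpha> (\<beta> i) I)"
  by (induction A rule: infinite_finite_induct) (simp_all add: wedge_zero wedge_add_right)

text \<open>Expanding the first two entries gives four terms. Those with both entries in the same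
  factor change sign by hypothesis; the two mixed ones are interchanged, and the sign by length
  makes them opposite. The induction over the prefix needs arbitrary \<open>\<alpha>\<close> and
  \<open>\<beta>\<close>, since the recursion alters them.\<close>

lemma wedge_alternating:
  assumes "alternating \<alpha>" "alternating \<beta>"
  shows "alternating (wedge \<alpha> \<beta>)"
proof -
  have "wedge \<alpha> \<beta> (A @ x # y # B) = - wedge \<alpha> \<beta> (A @ y # x # B)" for A x y B
    using assms
  proof (induction A arbitrary: \<alpha> \<beta>)
    case Nil
    have "(\<lambda>J. \<alpha> (x # y # J)) = (\<lambda>J. - \<alpha> (y # x # J))" "(\<lambda>J. \<beta> (x # y # J)) = (\<lambda>J. - \<beta> (y # x # J))"
      using alternatingD[OF Nil(1), of "[]" x y] alternatingD[OF Nil(2), of "[]" x y] by auto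
    then show ?case by (simp add: wedge_Cons wedge_uminus_left wedge_uminus_right)
  next
    case (Cons a A)
    have "alternating (\<lambda>J. (-1) ^ length J * \<alpha> J)"
      unfolding alternating_def
    proof (intro allI)
      fix A x y B
      show "(-1) ^ length (A @ x # y # B) * \<alpha> (A @ x # y # B) =
          - ((-1) ^ length (A @ y # x # B) * \<alpha> (A @ y # x # B))"
        using alternatingD[OF Cons.prems(1), of A x y B] by simp
    qed
    then show ?case
      using Cons.IH[OF alternating_Cons[OF Cons.prems(1)] Cons.prems(2)]
        Cons.IH[OF _ alternating_Cons[OF Cons.prems(2)]]
      by (simp add: wedge_Cons)
  qed
  then show ?thesis unfolding alternating_def by blast
qed

lemma wedge_length:
  assumes "\<And>J. length J \<noteq> p \<Longrightarrow> \<alpha> J = 0" "\<And>J. length J \<noteq> q \<Longrightarrow> \<beta> J = 0" "length I \<noteq> p + q"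
  shows "wedge \<alpha> \<beta> I = 0"
  using assms
proof (induction I arbitrary: \<alpha> \<beta> p q)
  case Nil
  then show ?case by (auto simp: wedge_Nil)
next
  case (Cons x I)
  have "wedge (\<lambda>J. \<alpha> (x # J)) \<beta> I = 0"
  proof (cases p)
    case 0
    then show ?thesis using Cons.prems(1) by (simp add: wedge_zero)
  next
    case (Suc p')
    then show ?thesis using Cons.prems by (intro Cons.IH[of p' _ q]) auto
  qed
  moreover have "wedge (\<lambda>J. (-1) ^ length J * \<alpha> J) (\<lambda>J. \<beta> (x # J)) I = 0"
  proof (cases q)
    case 0
    then show ?thesis using Cons.prems(2) by (simp add: wedge_zero)
  next
    case (Suc q')
    then show ?thesis using Cons.prems by (intro Cons.IH[of p _ q']) auto
  qed
  ultimately show ?case by (simp add: wedge_Cons)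
qed

lemma multivector_wedge: "multivector p \<alpha> \<Longrightarrow> multivector q \<beta> \<Longrightarrow> multivector (p + q) (wedge \<alpha> \<beta>)"
  unfolding multivector_iff_alternating using wedge_alternating wedge_length[of p \<alpha> q \<beta>] by blast

lemma wedge_scalar_left:
  assumes "\<And>J. J \<noteq> [] \<Longrightarrow> \<alpha> J = 0"
  shows "wedge \<alpha> \<gamma> K = \<alpha> [] * \<gamma> K"
  using assms
proof (induction K arbitrary: \<alpha> \<gamma>)
  case (Cons x K)
  then show ?case
    using Cons.IH[of "\<lambda>J. (-1) ^ length J * \<alpha> J" "\<lambda>J. \<gamma> (x # J)"] by (simp add: wedge_Cons wedge_zero)
qed (simp add: wedge_Nil)

lemma wedge_scalar_right:
  assumes "\<And>J. J \<noteq> [] \<Longrightarrow> \<gamma> J = 0"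
  shows "wedge \<alpha> \<gamma> K = \<alpha> K * \<gamma> []"
  using assms
proof (induction K arbitrary: \<alpha>)
  case (Cons x K)
  then show ?case using Cons.IH[of "\<lambda>J. \<alpha> (x # J)"] by (simp add: wedge_Cons wedge_zero)
qed (simp add: wedge_Nil)

text \<open>When \<open>\<gamma>\<close> vanishes on every list that meets \<open>I\<close>, the
  only surviving shuffle gives all of \<open>I\<close> to \<open>\<beta>\<close>. Together with the
  mirrored version it lets single components be read off from a product.\<close>

lemma wedge_split_left:
  assumes "\<And>J. length J \<noteq> length I \<Longrightarrow> \<beta> J = 0" "\<And>J. set J \<inter> set I \<noteq> {} \<Longrightarrow> \<gamma> J = 0"
  shows "wedge \<beta> \<gamma> (I @ K) = \<beta> I * \<gamma> K"
  using assms
proof (induction I arbitrary: \<beta>)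
  case Nil
  then show ?case by (simp add: wedge_scalar_left)
next
  case (Cons x I)
  have "(\<lambda>J. \<gamma> (x # J)) = (\<lambda>J. 0)" using Cons.prems(2) by auto
  then show ?case
    using Cons.IH[of "\<lambda>J. \<beta> (x # J)"] Cons.prems by (auto simp: wedge_Cons wedge_zero)
qed

lemma wedge_split_right:
  assumes "\<And>J. length J \<noteq> length K \<Longrightarrow> \<gamma> J = 0" "\<And>J. set J \<inter> set K \<noteq> {} \<Longrightarrow> \<alpha> J = 0"
  shows "wedge \<alpha> \<gamma> (K @ I) = (-1) ^ (length K * length I) * \<alpha> I * \<gamma> K"
  using assms
proof (induction K arbitrary: \<alpha> \<gamma>)
  case Nil
  then show ?case by (simp add: wedge_scalar_right)
next
  case (Cons x K)
  have "(\<lambda>J. \<alpha> (x # J)) = (\<lambda>J. 0)" using Cons.prems(2) by auto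
  moreover have "wedge (\<lambda>J. (-1) ^ length J * \<alpha> J) (\<lambda>J. \<gamma> (x # J)) (K @ I) =
      (-1) ^ (length K * length I) * ((-1) ^ length I * \<alpha> I) * \<gamma> (x # K)"
    by (rule Cons.IH) (use Cons.prems in auto)
  ultimately show ?case by (simp add: wedge_Cons wedge_zero power_add)
qed

subsection \<open>Products with vectors\<close>

lemma of_vec_Nil [simp]: "of_vec v [] = 0"
  and of_vec_single [simp]: "of_vec v [i] = v $ i"
  and of_vec_Cons_Cons [simp]: "of_vec v (i # j # I) = 0"
  by (simp_all add: of_vec_def)

lemma multivector_of_vec: "multivector 1 (of_vec v)"
  unfolding multivector_iff_alternating alternating_def by (auto simp: of_vec_def)

lemma wedge_of_vec_Nil: "wedge (of_vec v) \<alpha> [] = 0"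
  by (simp add: wedge_Nil)

text \<open>Fixing the first index is contraction with a coordinate covector, which is an
  antiderivation of the exterior product.\<close>

lemma wedge_of_vec_Cons:
  "wedge (of_vec v) \<alpha> (x # L) = v $ x * \<alpha> L - wedge (of_vec v) (\<lambda>J. \<alpha> (x # J)) L"
proof -
  have "(\<lambda>J. (-1) ^ length J * of_vec v J) = (\<lambda>J. - of_vec v J)" by (auto simp: of_vec_def)
  moreover have "wedge (\<lambda>J. of_vec v (x # J)) \<alpha> L = v $ x * \<alpha> L"
    by (subst wedge_scalar_left) (auto simp: of_vec_def)
  ultimately show ?thesis by (simp add: wedge_Cons wedge_uminus_left)
qed

lemma wedge_of_vec_anticommute:
  "wedge (of_vec v) (wedge (of_vec w) \<alpha>) I = - wedge (of_vec w) (wedge (of_vec v) \<alpha>) I"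
proof (induction I arbitrary: \<alpha>)
  case Nil
  then show ?case by (simp add: wedge_of_vec_Nil)
next
  case (Cons x I)
  have "wedge (of_vec v) (wedge (of_vec w) \<alpha>) (x # I) =
      v $ x * wedge (of_vec w) \<alpha> I - w $ x * wedge (of_vec v) \<alpha> I
      + wedge (of_vec v) (wedge (of_vec w) (\<lambda>J. \<alpha> (x # J))) I" for v w
    by (simp add: wedge_of_vec_Cons wedge_diff_right wedge_scale_right)
  then show ?case using Cons.IH by simp
qed

text \<open>Graded commutativity with a vector. The sign sits inside the argument because
  \<open>\<gamma>\<close> is not assumed to be homogeneous.\<close>

lemma wedge_of_vec_right:
  "wedge \<gamma> (of_vec v) K = wedge (of_vec v) (\<lambda>J. (-1) ^ length J * \<gamma> J) K"
proof (induction K arbitrary: \<gamma>)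
  case Nil
  then show ?case by (simp add: wedge_Nil)
next
  case (Cons x K)
  have "wedge (\<lambda>J. (-1) ^ length J * \<gamma> J) (\<lambda>J. of_vec v (x # J)) K = (-1) ^ length K * \<gamma> K * v $ x"
    by (subst wedge_scalar_right) (auto simp: of_vec_def)
  moreover have "(\<lambda>J. - ((-1) ^ length J * \<gamma> (x # J))) = (\<lambda>J. (-1) ^ length (x # J) * \<gamma> (x # J))" by simp
  ultimately show ?case
    using Cons.IH[of "\<lambda>J. \<gamma> (x # J)"] by (simp add: wedge_Cons[of \<gamma>] wedge_of_vec_Cons wedge_uminus_right)
qed

lemma of_vec_expansion: "of_vec v = (\<lambda>J. \<Sum>k\<in>UNIV. v $ k * of_vec (axis k 1) J)"
  by (rule ext) (auto simp: of_vec_def axis_def if_distrib[of "\<lambda>x. _ * x"] cong: if_cong)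

lemma sum_lists_Suc:
  "(\<Sum>I | length I = Suc n. F I) = (\<Sum>x\<in>UNIV. \<Sum>I | length I = n. F (x # I))"
  for F :: "'m::finite list \<Rightarrow> real"
proof -
  have "(\<Sum>x\<in>UNIV. \<Sum>I | length I = n. F (x # I)) =
      (\<Sum>y\<in>UNIV \<times> {I. length I = n}. case y of (x, I) \<Rightarrow> F (x # I))"
    by (rule sum.cartesian_product)
  also have "\<dots> = (\<Sum>I | length I = Suc n. F I)"
    by (rule sum.reindex_bij_witness[where i = "\<lambda>I. (hd I, tl I)" and j = "\<lambda>(x, I). x # I"])
       (auto simp: length_Suc_conv)
  finally show ?thesis by simp
qed

section \<open>Exterior products of lists of vectors\<close>

lemma wedge_list_Cons: "wedge_list (v # vs) = wedge (of_vec v) (wedge_list vs)"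
  by (simp add: wedge_list_def)

lemma multivector_wedge_list: "multivector (length vs) (wedge_list vs)"
proof (induction vs)
  case Nil
  then show ?case by (auto simp: wedge_list_def mv_one_def multivector_iff_alternating alternating_def)
next
  case (Cons v vs)
  then show ?case using multivector_wedge[OF multivector_of_vec Cons.IH] by (simp add: wedge_list_Cons)
qed

abbreviation wedge_basis :: "'m::finite list \<Rightarrow> 'm mv" where
  "wedge_basis J \<equiv> wedge_list (map (\<lambda>j. axis j 1) J)"

lemma wedge_list_expansion:
  "wedge_list vs I = (\<Sum>J | length J = length vs. (\<Prod>r<length vs. vs ! r $ (J ! r)) * wedge_basis J I)"
proof (induction vs arbitrary: I)
  case Nil
  then show ?case by simp
next
  case (Cons v vs)
  have "wedge_list (v # vs) I =
      (\<Sum>k\<in>UNIV. \<Sum>J | length J = length vs. v $ k * ((\<Prod>r<length vs. vs ! r $ (J ! r)) *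
        wedge (of_vec (axis k 1)) (wedge_basis J) I))"
    unfolding wedge_list_Cons
    by (subst of_vec_expansion, subst ext[OF Cons.IH])
       (simp add: wedge_sum_left wedge_sum_right wedge_scale_left wedge_scale_right sum_distrib_left)
  then show ?case
    by (simp add: sum_lists_Suc wedge_list_Cons prod.lessThan_Suc_shift mult_ac del: prod.lessThan_Suc)
qed

lemma wedge_basis_swap: "wedge_basis (A @ x # y # B) I = - wedge_basis (A @ y # x # B) I"
proof (induction A arbitrary: I)
  case Nil
  then show ?case using wedge_of_vec_anticommute by (simp add: wedge_list_Cons)
next
  case (Cons a A)
  then have "wedge_basis (A @ x # y # B) = (\<lambda>I. - wedge_basis (A @ y # x # B) I)" by blast
  then show ?case by (simp add: wedge_list_Cons wedge_uminus_right)
qed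

lemma wedge_basis_notin: "x \<notin> set J \<Longrightarrow> wedge_basis J (x # K) = 0"
proof (induction J arbitrary: K)
  case Nil
  then show ?case by (simp add: wedge_list_def mv_one_def)
next
  case (Cons j J)
  then show ?case by (simp add: wedge_list_Cons wedge_of_vec_Cons axis_def wedge_zero)
qed

lemma wedge_basis_self: "distinct J \<Longrightarrow> wedge_basis J J = 1"
proof (induction J)
  case Nil
  then show ?case by (simp add: wedge_list_def mv_one_def)
next
  case (Cons j J)
  then show ?case by (simp add: wedge_list_Cons wedge_of_vec_Cons wedge_basis_notin wedge_zero)
qed

section \<open>Inner products given by a Gram matrix\<close>

lemma ip_add_left: "ip G (u + v) w = ip G u w + ip G v w"
  and ip_add_right: "ip G w (u + v) = ip G w u + ip G w v"
  and ip_diff_left: "ip G (u - v) w = ip G u w - ip G v w"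
  and ip_diff_right: "ip G w (u - v) = ip G w u - ip G w v"
  and ip_minus_left: "ip G (- u) w = - ip G u w"
  and ip_minus_right: "ip G w (- u) = - ip G w u"
  and ip_scaleR_left: "ip G (c *\<^sub>R u) w = c * ip G u w"
  and ip_scaleR_right: "ip G w (c *\<^sub>R u) = c * ip G w u"
  and ip_zero_left: "ip G 0 w = 0"
  and ip_zero_right: "ip G w 0 = 0"
  by (simp_all add: ip_def inner_add_left inner_add_right inner_diff_left inner_diff_right
      matrix_vector_right_distrib matrix_vector_mult_diff_distrib matrix_vector_mult_scaleR
      vec.neg)

lemma ip_sum_left: "ip G (\<Sum>i\<in>A. f i) w = (\<Sum>i\<in>A. ip G (f i) w)"
  by (induction A rule: infinite_finite_induct) (simp_all add: ip_add_left ip_zero_left)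

lemma ip_sum_right: "ip G w (\<Sum>i\<in>A. f i) = (\<Sum>i\<in>A. ip G w (f i))"
  by (induction A rule: infinite_finite_induct) (simp_all add: ip_add_right ip_zero_right)

lemmas ip_simps = ip_add_left ip_add_right ip_diff_left ip_diff_right ip_minus_left ip_minus_right
  ip_scaleR_left ip_scaleR_right ip_zero_left ip_zero_right

lemma ip_commute: "transpose G = G \<Longrightarrow> ip G v w = ip G w v"
  unfolding ip_def by (metis dot_lmul_matrix inner_commute vector_transpose_matrix)

lemma ip_axis: "ip G (axis i 1) (axis j 1) = G $ i $ j"
  by (simp add: ip_def matrix_vector_mult_basis inner_axis' column_def)

lemma ip_axis_right: "ip G x (axis j 1) = (\<Sum>k\<in>UNIV. x $ k * G $ k $ j)"
  by (simp add: ip_def matrix_vector_mult_basis inner_vec_def column_def)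

lemma ip_axis_left: "ip G (axis i 1) x = (\<Sum>k\<in>UNIV. G $ i $ k * x $ k)"
  by (simp add: ip_def inner_axis' matrix_vector_mult_def)

lemma ip_expand: "ip G v w = (\<Sum>i\<in>UNIV. \<Sum>j\<in>UNIV. v $ i * (G $ i $ j * w $ j))"
  by (simp add: ip_def inner_vec_def matrix_vector_mult_def sum_distrib_left)

lemma ip_has_derivative:
  fixes F :: "'a::real_normed_vector \<Rightarrow> real ^ 'n ^ 'n"
  assumes "(F has_derivative F') (at z)" "(\<xi> has_derivative \<xi>') (at z)" "(\<eta> has_derivative \<eta>') (at z)"
  shows "((\<lambda>z. ip (F z) (\<xi> z) (\<eta> z)) has_derivative
    (\<lambda>v. ip (F' v) (\<xi> z) (\<eta> z) + ip (F z) (\<xi>' v) (\<eta> z) + ip (F z) (\<xi> z) (\<eta>' v))) (at z)"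
proof -
  have "((\<lambda>z. \<Sum>i\<in>UNIV. \<Sum>j\<in>UNIV. \<xi> z $ i * (F z $ i $ j * \<eta> z $ j)) has_derivative
    (\<lambda>v. \<Sum>i\<in>UNIV. \<Sum>j\<in>UNIV. \<xi> z $ i * (F z $ i $ j * \<eta>' v $ j + F' v $ i $ j * \<eta> z $ j)
        + \<xi>' v $ i * (F z $ i $ j * \<eta> z $ j))) (at z)"
    by (intro has_derivative_sum has_derivative_mult has_derivative_nth assms)
  then show ?thesis
    unfolding ip_expand by (simp add: sum.distrib[symmetric] algebra_simps)
qed

lemma smooth_on_ip:
  assumes "open S" "smooth_on S F" "smooth_on S \<xi>" "smooth_on S \<eta>"
  shows "smooth_on S (\<lambda>z. ip (F z) (\<xi> z) (\<eta> z))"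
  unfolding ip_expand by (intro smooth_on_sum smooth_on_mult smooth_on_nth assms)

lemma gram_orthonormal:
  assumes "\<And>i j. ip G (E $ i) (E $ j) = (if i = j then 1 else 0)"
  shows "(det E)\<^sup>2 * det G = 1"
proof -
  have "(E ** G ** transpose E) $ i $ j = ip G (E $ i) (E $ j)" for i j
    unfolding matrix_mul_assoc[symmetric]
    by (simp add: ip_def matrix_matrix_mult_def matrix_vector_mult_def transpose_def inner_vec_def)
  then have "E ** G ** transpose E = mat 1" using assms by (simp add: vec_eq_iff mat_def)
  then have "det E * det G * det (transpose E) = 1" by (metis det_I det_mul)
  then show ?thesis by (simp add: power2_eq_square mult_ac)
qed

text \<open>The determinant of a positive orthonormal basis depends on the Gram matrix alone. The
  condition on all bases in \<open>hodge\<close> is therefore the condition on a single one.\<close>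

lemma pos_onb_det:
  assumes "pos_onb G E"
  shows "det G > 0" "det E = 1 / sqrt (det G)"
proof -
  have *: "(det E)\<^sup>2 * det G = 1" and pos: "det E > 0"
    using assms gram_orthonormal[of G E] by (auto simp: pos_onb_def)
  show "det G > 0" using * pos by (metis zero_less_mult_pos zero_less_one zero_less_power)
  then have "det E * sqrt (det G) = 1"
    using * pos real_sqrt_mult[of "(det E)\<^sup>2" "det G"] by simp
  then show "det E = 1 / sqrt (det G)" using \<open>det G > 0\<close> by (simp add: field_simps)
qed

subsection \<open>Existence of positive orthonormal bases\<close>

lemma gram_schmidt:
  fixes G :: "real ^ 'm ^ 'm"
  assumes sym: "transpose G = G" and pos: "\<And>v. v \<noteq> 0 \<Longrightarrow> ip G v v > 0"
  shows "n \<le> CARD('m) \<Longrightarrow>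
    \<exists>vs. length vs = n \<and> (\<forall>i<n. \<forall>j<n. ip G (vs ! i) (vs ! j) = (if i = j then 1 else 0))"
proof (induction n)
  case (Suc n)
  then obtain vs :: "(real ^ 'm) list" where vs: "length vs = n"
    "\<And>i j. i < n \<Longrightarrow> j < n \<Longrightarrow> ip G (vs ! i) (vs ! j) = (if i = j then 1 else 0)" by auto
  \<comment> \<open>Here \<open>n\<close> is smaller than the dimension, so the vectors found so far
    cannot span and there is a next vector to orthogonalize.\<close>
  have "dim (span (set vs)) \<le> n"
    using dim_le_card'[of "set vs"] card_length[of vs] vs(1) by (simp add: dim_span)
  moreover have "dim (UNIV :: (real ^ 'm) set) = CARD('m)" by simp
  ultimately have "span (set vs) \<noteq> UNIV" using Suc.prems by (metis Suc_n_not_le_n le_trans)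
  then obtain x where x: "x \<notin> span (set vs)" by blast
  define y where "y = x - (\<Sum>i<n. ip G x (vs ! i) *\<^sub>R vs ! i)"
  have "y \<noteq> 0"
  proof
    assume "y = 0"
    then have "x = (\<Sum>i<n. ip G x (vs ! i) *\<^sub>R vs ! i)" by (simp add: y_def)
    also have "\<dots> \<in> span (set vs)"
      using vs(1) by (intro span_sum span_scale span_base) auto
    finally show False using x by simp
  qed
  then have "ip G y y > 0" by (rule pos)
  have yv: "ip G y (vs ! j) = 0" if "j < n" for j
  proof -
    have "(\<Sum>i<n. ip G x (vs ! i) * ip G (vs ! i) (vs ! j)) = (\<Sum>i<n. if i = j then ip G x (vs ! i) else 0)"
      using vs(2)[OF _ that] by (intro sum.cong) auto
    then show ?thesis using that by (simp add: y_def ip_diff_left ip_sum_left ip_scaleR_left)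
  qed
  define w where "w = (1 / sqrt (ip G y y)) *\<^sub>R y"
  have "ip G w w = 1" using \<open>ip G y y > 0\<close> by (simp add: w_def ip_scaleR_left ip_scaleR_right)
  moreover have "ip G w (vs ! j) = 0" "ip G (vs ! j) w = 0" if "j < n" for j
    using yv[OF that] ip_commute[OF sym, of "vs ! j" w] by (simp_all add: w_def ip_scaleR_left)
  ultimately have "\<forall>i<Suc n. \<forall>j<Suc n. ip G ((vs @ [w]) ! i) ((vs @ [w]) ! j) = (if i = j then 1 else 0)"
    using vs by (auto simp: less_Suc_eq nth_append)
  then show ?case using vs(1) by (intro exI[of _ "vs @ [w]"]) simp
qed simp

lemma pos_onb_exists:
  fixes G :: "real ^ 'm ^ 'm"
  assumes "transpose G = G" and "\<And>v. v \<noteq> 0 \<Longrightarrow> ip G v v > 0"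
  shows "\<exists>E. pos_onb G E"
proof -
  obtain es :: "'m list" where es: "set es = UNIV" "distinct es"
    using finite_distinct_list[of "UNIV :: 'm set"] by auto
  interpret coordinate_order es by unfold_locales (use es in auto)
  obtain vs :: "(real ^ 'm) list" where vs:
    "\<And>i j. i < CARD('m) \<Longrightarrow> j < CARD('m) \<Longrightarrow> ip G (vs ! i) (vs ! j) = (if i = j then 1 else 0)"
    using gram_schmidt[OF assms, of "CARD('m)"] by auto
  define E :: "real ^ 'm ^ 'm" where "E = (\<chi> i. vs ! list_pos es i)"
  have "list_pos es i = list_pos es j \<longleftrightarrow> i = j" for i j by (metis nth_list_pos)
  then have E: "ip G (E $ i) (E $ j) = (if i = j then 1 else 0)" for i j
    using vs[OF list_pos_less list_pos_less] by (simp add: E_def)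
  \<comment> \<open>Reversing one vector, no matter which, keeps orthonormality and changes the sign
    of the determinant, so one of \<open>E\<close> and \<open>E'\<close> is positive.\<close>
  define a :: 'm where "a = undefined"
  define E' :: "real ^ 'm ^ 'm" where "E' = (\<chi> i. if i = a then (-1) *s E $ i else E $ i)"
  have E': "ip G (E' $ i) (E' $ j) = (if i = j then 1 else 0)" for i j
    using E[of i j] by (auto simp: E'_def scalar_mult_eq_scaleR ip_minus_left ip_minus_right)
  have "det E' = - det E"
    unfolding E'_def by (subst det_row_mul) (simp add: if_distrib[symmetric] cong: if_cong)
  moreover have "det E \<noteq> 0" using gram_orthonormal[of G E] E by auto
  ultimately have "det E > 0 \<or> det E' > 0" by linarith
  then show ?thesis using E E' unfolding pos_onb_def by blast
qed

section \<open>Hodge operators\<close>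

context coordinate_order
begin

lemma wedge_list_basis: "wedge_list (map (($) E) es) = (\<lambda>I. det E * eps es I)"
proof -
  \<comment> \<open>The roles are exchanged: the evaluation list is fixed at \<open>es\<close> and
    the basis multivector varies. As a function of its indices this is again alternating of top
    degree, hence the symbol.\<close>
  define F where "F J = (if length J = CARD('m) then wedge_basis J es else 0)" for J :: "'m list"
  have "multivector (CARD('m)) F"
    unfolding multivector_iff_alternating alternating_def
  proof (intro conjI allI impI)
    fix A x y B show "F (A @ x # y # B) = - F (A @ y # x # B)"
      using wedge_basis_swap[of A x y B es] by (simp add: F_def)
  qed (simp add: F_def)
  from top_multivector[OF this] have F: "F J = eps es J" for J
    by (simp add: F_def[of es] length_es wedge_basis_self[OF dist])
  have "wedge_list (map (($) E) es) es =
      (\<Sum>J | length J = CARD('m). (\<Prod>r<CARD('m). E $ (es ! r) $ (J ! r)) * wedge_basis J es)"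
    unfolding wedge_list_expansion[of "map (($) E) es"] by (simp add: length_es)
  also have "\<dots> = (\<Sum>J | length J = CARD('m). (\<Prod>r<CARD('m). E $ (es ! r) $ (J ! r)) * eps es J)"
    by (intro sum.cong) (auto simp: F[symmetric] F_def)
  also have "\<dots> = det E" using det_eps[OF length_es] by (simp add: eps_self)
  finally have "wedge_list (map (($) E) es) es = det E" .
  moreover have *: "multivector (CARD('m)) (wedge_list (map (($) E) es))"
    using multivector_wedge_list[of "map (($) E) es"] by (simp add: length_es)
  ultimately show ?thesis using top_multivector[OF *] by (intro ext) metis
qed

lemma distinct_complement:
  fixes I :: "'m list"
  assumes "distinct I"
  obtains K where "distinct (I @ K)" "length (I @ K) = CARD('m)"
proof -
  obtain K where K: "set K = UNIV - set I" "distinct K"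
    using finite_distinct_list[of "UNIV - set I"] by auto
  then have d: "distinct (I @ K)" using assms by auto
  moreover have "set (I @ K) = UNIV" using K by auto
  ultimately have "length (I @ K) = CARD('m)" using distinct_card by metis
  then show ?thesis using d that by blast
qed

text \<open>The symbols with prefix \<open>I\<close> act as a dual basis under the wedge pairing.
  For distinct \<open>I\<close>, completing \<open>I\<close> to a full list by \<open>K\<close>
  leaves a single shuffle, and the unit value of \<open>eps es\<close> on it cancels.\<close>

lemma wedge_eps:
  assumes "multivector p \<beta>" "length I = p"
  shows "wedge \<beta> (\<lambda>K. eps es (I @ K)) es = \<beta> I"
proof (cases "distinct I")
  case False
  then have "(\<lambda>K. eps es (I @ K)) = (\<lambda>K. 0)" using alternating_not_distinct[OF eps_alternating] by auto
  then show ?thesis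
    using False alternating_not_distinct[OF multivector_alternating[OF assms(1)]] by (simp add: wedge_zero)
next
  case True
  then obtain K where K: "distinct (I @ K)" "length (I @ K) = CARD('m)" by (rule distinct_complement)
  let ?\<gamma> = "\<lambda>K. eps es (I @ K)"
  have "multivector (CARD('m) - p) ?\<gamma>"
    unfolding multivector_iff_alternating
    using multivector_length[OF eps_multivector] alternating_prefix[OF eps_alternating] assms(2) K(2) by auto
  then have "multivector (CARD('m)) (wedge \<beta> ?\<gamma>)"
    using multivector_wedge[OF assms(1)] assms(2) K(2) by fastforce
  then have "wedge \<beta> ?\<gamma> (I @ K) = wedge \<beta> ?\<gamma> es * eps es (I @ K)" by (rule top_multivector)
  moreover have "wedge \<beta> ?\<gamma> (I @ K) = \<beta> I * eps es (I @ K)"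
  proof (rule wedge_split_left)
    show "\<beta> J = 0" if "length J \<noteq> length I" for J using that assms multivector_length by blast
    show "eps es (I @ J) = 0" if "set J \<inter> set I \<noteq> {}" for J
      using that by (intro alternating_not_distinct[OF eps_alternating]) auto
  qed
  ultimately show ?thesis using eps_distinct[OF K] by auto
qed

text \<open>Nondegeneracy of the wedge pairing: the component at \<open>K\<close> is isolated by
  testing with the symbol that has \<open>K\<close> as suffix.\<close>

lemma wedge_determines:
  assumes pq: "p + q = CARD('m)" and "multivector q \<gamma>" "multivector q \<gamma>'"
    and eq: "\<And>\<beta>. multivector p \<beta> \<Longrightarrow> wedge \<beta> \<gamma> es = wedge \<beta> \<gamma>' es"
  shows "\<gamma> = \<gamma>'"
proof (rule ext)
  fix K
  show "\<gamma> K = \<gamma>' K"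
  proof (cases "length K = q \<and> distinct K")
    case False
    then show ?thesis
      using assms(2,3) multivector_length alternating_not_distinct multivector_alternating by metis
  next
    case True
    then obtain I where I: "distinct (K @ I)" "length (K @ I) = CARD('m)" using distinct_complement by blast
    define \<beta> where "\<beta> = (\<lambda>J. eps es (J @ K))"
    have \<beta>: "multivector p \<beta>"
      unfolding multivector_iff_alternating \<beta>_def
      using multivector_length[OF eps_multivector] alternating_suffix[OF eps_alternating] True pq by auto
    have *: "wedge \<beta> \<gamma> es * eps es (K @ I) = (-1) ^ (length K * length I) * \<beta> I * \<gamma> K"
      if "multivector q \<gamma>" for \<gamma>
    proof -
      have "wedge \<beta> \<gamma> (K @ I) = (-1) ^ (length K * length I) * \<beta> I * \<gamma> K"
      proof (rule wedge_split_right)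
        show "\<gamma> J = 0" if "length J \<noteq> length K" for J
          using that True \<open>multivector q \<gamma>\<close> multivector_length by blast
        show "\<beta> J = 0" if "set J \<inter> set K \<noteq> {}" for J
          unfolding \<beta>_def using that by (intro alternating_not_distinct[OF eps_alternating]) auto
      qed
      then show ?thesis
        using top_multivector[of "wedge \<beta> \<gamma>" "K @ I"] multivector_wedge[OF \<beta> that] pq by simp
    qed
    have "\<beta> I \<noteq> 0" unfolding \<beta>_def using eps_distinct[of "I @ K"] I by fastforce
    then show ?thesis using *[OF assms(2)] *[OF assms(3)] eq[OF \<beta>] by simp
  qed
qed

text \<open>Resolves the definite description. Products of complementary degree lie on a line, so
  comparing them at \<open>es\<close> suffices, and all positive bases share \<open>det E\<close>;
  uniqueness is \<open>wedge_determines\<close>.\<close>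

lemma hodgeI:
  assumes "p \<le> CARD('m)" "pos_onb G E" "multivector (CARD('m) - p) \<gamma>"
    and eq: "\<And>\<beta>. multivector p \<beta> \<Longrightarrow> wedge \<beta> \<gamma> es = mv_ip G p \<beta> \<alpha> * det E"
  shows "hodge G es p \<alpha> = \<gamma>"
  unfolding hodge_def
proof (rule the_equality)
  have "wedge \<beta> \<gamma> = (\<lambda>I. mv_ip G p \<beta> \<alpha> * wedge_list (map (($) E') es) I)"
    if "multivector p \<beta>" "pos_onb G E'" for \<beta> E'
  proof
    fix I
    have "multivector (CARD('m)) (wedge \<beta> \<gamma>)" using multivector_wedge[OF that(1) assms(3)] assms(1) by simp
    moreover have "det E' = det E" using that(2) assms(2) pos_onb_det(2) by metis
    ultimately show "wedge \<beta> \<gamma> I = mv_ip G p \<beta> \<alpha> * wedge_list (map (($) E') es) I"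
      using top_multivector[of "wedge \<beta> \<gamma>" I] eq[OF that(1)] by (simp add: wedge_list_basis)
  qed
  then show "multivector (CARD('m) - p) \<gamma> \<and> (\<forall>\<beta> E. multivector p \<beta> \<longrightarrow> pos_onb G E \<longrightarrow>
      wedge \<beta> \<gamma> = (\<lambda>I. mv_ip G p \<beta> \<alpha> * wedge_list (map (($) E) es) I))"
    using assms(3) by blast
next
  fix \<gamma>'
  assume g: "multivector (CARD('m) - p) \<gamma>' \<and> (\<forall>\<beta> E. multivector p \<beta> \<longrightarrow> pos_onb G E \<longrightarrow>
      wedge \<beta> \<gamma>' = (\<lambda>I. mv_ip G p \<beta> \<alpha> * wedge_list (map (($) E) es) I))"
  show "\<gamma>' = \<gamma>"
  proof (rule wedge_determines[of p "CARD('m) - p"])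
    fix \<beta> :: "'m mv" assume b: "multivector p \<beta>"
    then have "wedge \<beta> \<gamma>' = (\<lambda>I. mv_ip G p \<beta> \<alpha> * (det E * eps es I))"
      using g assms(2) by (simp add: wedge_list_basis)
    then show "wedge \<beta> \<gamma>' es = wedge \<beta> \<gamma> es" using eq[OF b] by (simp add: eps_self)
  qed (use g assms in auto)
qed

text \<open>\<open>eps1\<close> and \<open>eps2\<close> contract the symbol with one or two
  covectors in the first slots. With covectors lowered by \<open>G\<close> and the factor
  \<open>det E\<close> they are the Hodge duals of a vector and of a simple bivector.\<close>

definition eps1 :: "real ^ 'm \<Rightarrow> 'm mv" where
  "eps1 p K = (\<Sum>i\<in>UNIV. p $ i * eps es (i # K))"

definition eps2 :: "real ^ 'm \<Rightarrow> real ^ 'm \<Rightarrow> 'm mv" where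
  "eps2 p q K = (\<Sum>i\<in>UNIV. \<Sum>j\<in>UNIV. p $ i * q $ j * eps es (i # j # K))"

lemma multivector_eps1: "multivector (CARD('m) - 1) (eps1 p)"
  unfolding multivector_iff_alternating eps1_def
  using multivector_length[OF eps_multivector]
  by (auto intro!: sum.neutral alternating_sum alternating_scale alternating_Cons eps_alternating)

lemma multivector_eps2: "2 \<le> CARD('m) \<Longrightarrow> multivector (CARD('m) - 2) (eps2 p q)"
  unfolding multivector_iff_alternating eps2_def
  using multivector_length[OF eps_multivector]
  by (auto intro!: sum.neutral alternating_sum alternating_scale alternating_Cons eps_alternating)

lemma multivector_scale: "multivector q \<gamma> \<Longrightarrow> multivector q (\<lambda>K. c * \<gamma> K)"
  unfolding multivector_iff_alternating using alternating_scale by auto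

lemma hodge_vector:
  assumes "pos_onb G E"
  shows "hodge G es 1 (of_vec w) = (\<lambda>K. det E * eps1 (G *v w) K)"
proof (rule hodgeI[OF _ assms])
  fix \<beta> :: "'m mv" assume b: "multivector 1 \<beta>"
  have "wedge \<beta> (\<lambda>K. det E * eps1 (G *v w) K) es = det E * (\<Sum>i\<in>UNIV. (G *v w) $ i * \<beta> [i])"
    using wedge_eps[OF b, of "[i]" for i]
    by (simp add: eps1_def wedge_scale_right wedge_sum_right)
  moreover have "mv_ip G 1 \<beta> (of_vec w) = (\<Sum>i\<in>UNIV. (G *v w) $ i * \<beta> [i])"
    by (simp add: mv_ip_def sum_lists_Suc matrix_vector_mult_def sum_distrib_left sum_distrib_right mult_ac)
  ultimately show "wedge \<beta> (\<lambda>K. det E * eps1 (G *v w) K) es = mv_ip G 1 \<beta> (of_vec w) * det E" by simp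
qed (use multivector_scale[OF multivector_eps1] in auto)

lemma wedge_of_vec_of_vec: "wedge (of_vec a) (of_vec b) [i, j] = a $ i * b $ j - a $ j * b $ i"
  by (simp add: wedge_of_vec_Cons wedge_of_vec_Nil)

text \<open>Antisymmetry of \<open>\<beta>\<close> makes the two terms of the bivector contribute
  equally, which absorbs the factor 1/2 in \<open>mv_ip\<close>; pairing with \<open>eps2\<close> is
  evaluated by \<open>wedge_eps\<close>.\<close>

lemma hodge_bivector:
  assumes "pos_onb G E" "2 \<le> CARD('m)"
  shows "hodge G es 2 (wedge (of_vec a) (of_vec b)) = (\<lambda>K. det E * eps2 (G *v a) (G *v b) K)"
proof (rule hodgeI[OF assms(2,1)])
  fix \<beta> :: "'m mv" assume b: "multivector 2 \<beta>"
  let ?p = "G *v a" and ?q = "G *v b"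
  have swap: "\<beta> [i, j] = - \<beta> [j, i]" for i j
    using alternatingD[OF multivector_alternating[OF b], of "[]" i j "[]"] by simp
  have "wedge \<beta> (\<lambda>K. det E * eps2 ?p ?q K) es = det E * (\<Sum>i\<in>UNIV. \<Sum>j\<in>UNIV. ?p $ i * ?q $ j * \<beta> [i, j])"
    using wedge_eps[OF b, of "[i, j]" for i j]
    by (simp add: eps2_def wedge_scale_right wedge_sum_right)
  moreover have "mv_ip G 2 \<beta> (wedge (of_vec a) (of_vec b)) = (\<Sum>i\<in>UNIV. \<Sum>j\<in>UNIV. ?p $ i * ?q $ j * \<beta> [i, j])"
  proof -
    have "mv_ip G 2 \<beta> (wedge (of_vec a) (of_vec b)) =
        (1/2) * (\<Sum>i\<in>UNIV. \<Sum>j\<in>UNIV. \<Sum>k\<in>UNIV. \<Sum>l\<in>UNIV.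
          G $ i $ k * G $ j $ l * \<beta> [i, j] * (a $ k * b $ l - a $ l * b $ k))"
      by (simp add: mv_ip_def numeral_2_eq_2 sum_lists_Suc wedge_of_vec_of_vec lessThan_Suc mult_ac)
    also have "\<dots> = (1/2) * (\<Sum>i\<in>UNIV. \<Sum>j\<in>UNIV. \<beta> [i, j] * (?p $ i * ?q $ j - ?q $ i * ?p $ j))"
    proof -
      have "(G *v a) $ i * (G *v b) $ j = (\<Sum>k\<in>UNIV. \<Sum>l\<in>UNIV. (G $ i $ k * a $ k) * (G $ j $ l * b $ l))" for a b i j
        by (simp add: matrix_vector_mult_def sum_product)
      then show ?thesis
        by (simp only:) (simp add: right_diff_distrib sum_subtractf sum_distrib_left mult_ac)
    qed
    also have "\<dots> = (1/2) * ((\<Sum>i\<in>UNIV. \<Sum>j\<in>UNIV. \<beta> [i, j] * (?p $ i * ?q $ j))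
        - (\<Sum>i\<in>UNIV. \<Sum>j\<in>UNIV. \<beta> [i, j] * (?q $ i * ?p $ j)))"
      by (simp add: right_diff_distrib sum_subtractf)
    also have "(\<Sum>i\<in>UNIV. \<Sum>j\<in>UNIV. \<beta> [i, j] * (?q $ i * ?p $ j)) =
        (\<Sum>j\<in>UNIV. \<Sum>i\<in>UNIV. \<beta> [i, j] * (?q $ i * ?p $ j))" by (rule sum.swap)
    also have "\<dots> = - (\<Sum>i\<in>UNIV. \<Sum>j\<in>UNIV. \<beta> [i, j] * (?p $ i * ?q $ j))"
      unfolding sum_negf[symmetric] by (intro sum.cong refl, subst swap) simp
    finally show ?thesis by (simp add: mult_ac)
  qed
  ultimately show "wedge \<beta> (\<lambda>K. det E * eps2 ?p ?q K) es =
      mv_ip G 2 \<beta> (wedge (of_vec a) (of_vec b)) * det E" by simp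
qed (rule multivector_scale[OF multivector_eps2[OF assms(2)]])

text \<open>Only lists without repetition that avoid \<open>k\<close> contribute, there are as many
  as the factorial says, and each gives the same number: permuting the list changes both factors by
  the same sign.\<close>

lemma sum_multivector_eps:
  assumes "multivector (CARD('m) - 1) \<beta>"
  shows "(\<Sum>I | length I = CARD('m) - 1. \<beta> I * eps es (k # I)) =
    fact (CARD('m) - 1) * ((-1) ^ (CARD('m) - 1) * wedge \<beta> (of_vec (axis k 1)) es)"
proof -
  let ?n = "CARD('m) - 1" and ?W = "wedge \<beta> (of_vec (axis k 1))"
  let ?D = "{I. length I = ?n \<and> distinct I \<and> set I \<subseteq> UNIV - {k}}"
  have m: "CARD('m) = Suc ?n" by simp
  have fin: "finite {I :: 'm list. length I = ?n}" using finite_lists_length_eq[of "UNIV :: 'm set" ?n] by simp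
  have "(\<Sum>I | length I = ?n. \<beta> I * eps es (k # I)) = (\<Sum>I\<in>?D. \<beta> I * eps es (k # I))"
    using fin by (intro sum.mono_neutral_right) (auto intro!: alternating_not_distinct[OF eps_alternating])
  also have "\<dots> = (\<Sum>I\<in>?D. (-1) ^ ?n * ?W es)"
  proof (rule sum.cong[OF refl])
    fix I assume I: "I \<in> ?D"
    have e: "eps es (k # I) = 1 \<or> eps es (k # I) = -1"
      using I m by (intro eps_distinct) auto
    have "?W (I @ [k]) = \<beta> I * of_vec (axis k 1) [k]"
      using I multivector_length[OF assms] by (intro wedge_split_left) (auto simp: of_vec_def axis_def length_Suc_conv)
    moreover have "?W (I @ [k]) = ?W es * eps es (I @ [k])"
      using multivector_wedge[OF assms multivector_of_vec] m by (intro top_multivector) simp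
    moreover have "eps es (I @ [k]) = (-1) ^ ?n * eps es (k # I)"
      using alternating_move[OF eps_alternating, of "[]" I k "[]"] I by simp
    ultimately have "\<beta> I = ?W es * ((-1) ^ ?n * eps es (k # I))" by simp
    then show "\<beta> I * eps es (k # I) = (-1) ^ ?n * ?W es" using e by auto
  qed
  also have "\<dots> = of_nat (card ?D) * ((-1) ^ ?n * ?W es)" by simp
  also have "card ?D = fact ?n"
    using card_lists_distinct_length_eq[of "UNIV - {k}" ?n] by (simp add: fact_prod card_Diff_singleton)
  finally show ?thesis by simp
qed

text \<open>The double Hodge dual of a vector is the vector up to the sign (-1)^(m-1). Lowering all
  indices of a contracted symbol produces \<open>det G\<close>, which the two factors
  \<open>det E\<close> cancel because \<open>det E\<close> squared times \<open>det G\<close> is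
  1.\<close>

lemma hodge_codim_one:
  assumes "pos_onb G E" "transpose G = G"
  shows "hodge G es (CARD('m) - 1) (\<lambda>K. det E * eps1 (G *v w) K) = (\<lambda>K. (-1) ^ (CARD('m) - 1) * of_vec w K)"
proof -
  define n where "n = CARD('m) - 1"
  have m: "CARD('m) = Suc n" by (simp add: n_def)
  show ?thesis
    unfolding n_def[symmetric]
  proof (rule hodgeI[OF _ assms(1)])
    show "multivector (CARD('m) - n) (\<lambda>K. (-1) ^ n * of_vec w K)"
      using multivector_scale[OF multivector_of_vec] by (simp add: m)
    fix \<beta> :: "'m mv" assume b: "multivector n \<beta>"
    have Gw: "(G *v w) $ j = (\<Sum>k\<in>UNIV. w $ k * G $ k $ j)" for j
    proof -
      have "G $ j $ k = G $ k $ j" for k by (metis assms(2) transpose_def vec_lambda_beta)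
      then show ?thesis by (simp add: matrix_vector_mult_def mult_ac)
    qed
    \<comment> \<open>This is \<open>det_eps\<close> for \<open>G\<close> on the list
      \<open>k # I\<close>, contracted with \<open>w\<close> in the first slot: the first row of
      \<open>G\<close> combines with \<open>w\<close> into the lowered vector.\<close>
    have inner: "(\<Sum>J | length J = n. (\<Prod>r<n. G $ (I ! r) $ (J ! r)) * eps1 (G *v w) J) =
        det G * (\<Sum>k\<in>UNIV. w $ k * eps es (k # I))" if "length I = n" for I :: "'m list"
    proof -
      have "det G * eps es (k # I) =
          (\<Sum>j\<in>UNIV. \<Sum>J | length J = n. G $ k $ j * (\<Prod>r<n. G $ (I ! r) $ (J ! r)) * eps es (j # J))" for k
      proof -
        have "det G * eps es (k # I) =
            (\<Sum>J | length J = Suc n. (\<Prod>r<Suc n. G $ ((k # I) ! r) $ (J ! r)) * eps es J)"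
          using det_eps[of "k # I" G] that m by simp
        then show ?thesis
          by (simp add: sum_lists_Suc prod.lessThan_Suc_shift del: prod.lessThan_Suc)
      qed
      note expand = this
      let ?f = "\<lambda>k j J. w $ k * (G $ k $ j * (\<Prod>r<n. G $ (I ! r) $ (J ! r)) * eps es (j # J))"
      have "det G * (\<Sum>k\<in>UNIV. w $ k * eps es (k # I)) = (\<Sum>k\<in>UNIV. w $ k * (det G * eps es (k # I)))"
        by (simp add: sum_distrib_left mult_ac)
      also have "\<dots> = (\<Sum>k\<in>UNIV. \<Sum>j\<in>UNIV. \<Sum>J | length J = n. ?f k j J)"
        by (simp only: expand sum_distrib_left)
      also have "\<dots> = (\<Sum>k\<in>UNIV. \<Sum>J | length J = n. \<Sum>j\<in>UNIV. ?f k j J)"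
        by (intro sum.cong refl sum.swap)
      also have "\<dots> = (\<Sum>J | length J = n. \<Sum>k\<in>UNIV. \<Sum>j\<in>UNIV. ?f k j J)" by (rule sum.swap)
      also have "\<dots> = (\<Sum>J | length J = n. \<Sum>j\<in>UNIV. \<Sum>k\<in>UNIV. ?f k j J)"
        by (intro sum.cong refl sum.swap)
      also have "\<dots> = (\<Sum>J | length J = n. (\<Prod>r<n. G $ (I ! r) $ (J ! r)) * eps1 (G *v w) J)"
        by (intro sum.cong refl) (simp add: eps1_def Gw sum_distrib_left sum_distrib_right mult_ac)
      finally show ?thesis by simp
    qed
    have "mv_ip G n \<beta> (\<lambda>K. det E * eps1 (G *v w) K) =
        (1 / fact n) * (\<Sum>I | length I = n. \<beta> I * (det E *
          (\<Sum>J | length J = n. (\<Prod>r<n. G $ (I ! r) $ (J ! r)) * eps1 (G *v w) J)))"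
      by (simp add: mv_ip_def sum_distrib_left mult_ac)
    also have "\<dots> = (1 / fact n) * (\<Sum>I | length I = n. \<Sum>k\<in>UNIV. det E * det G * w $ k * (\<beta> I * eps es (k # I)))"
      by (intro arg_cong2[where f = "(*)"] refl sum.cong)
         (simp only: mem_Collect_eq inner, simp add: sum_distrib_left mult_ac)
    also have "\<dots> = (1 / fact n) * (\<Sum>k\<in>UNIV. det E * det G * w $ k * (\<Sum>I | length I = n. \<beta> I * eps es (k # I)))"
      by (subst sum.swap) (simp add: sum_distrib_left)
    also have "\<dots> = det E * det G * (-1) ^ n * (\<Sum>k\<in>UNIV. w $ k * wedge \<beta> (of_vec (axis k 1)) es)"
      by (simp add: sum_multivector_eps[folded n_def, OF b] sum_distrib_left mult_ac)
    also have "(\<Sum>k\<in>UNIV. w $ k * wedge \<beta> (of_vec (axis k 1)) es) = wedge \<beta> (of_vec w) es"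
      by (subst (2) of_vec_expansion) (simp add: wedge_sum_right wedge_scale_right)
    finally have "mv_ip G n \<beta> (\<lambda>K. det E * eps1 (G *v w) K) * det E =
        ((det E)\<^sup>2 * det G) * ((-1) ^ n * wedge \<beta> (of_vec w) es)"
      by (simp add: power2_eq_square mult_ac)
    also have "(det E)\<^sup>2 * det G = 1" using gram_orthonormal[of G E] assms(1) by (simp add: pos_onb_def)
    finally show "wedge \<beta> (\<lambda>K. (-1) ^ n * of_vec w K) es =
        mv_ip G n \<beta> (\<lambda>K. det E * eps1 (G *v w) K) * det E"
      by (simp add: wedge_scale_right)
  qed (simp add: m)
qed

text \<open>The interior identity is the vanishing of the \<open>(m+1)\<close>-vector \<open>X \<and> eps\<close>, contracted with two covectors.\<close>

lemma wedge_eps2: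
  assumes "2 \<le> CARD('m)"
  shows "wedge (eps2 p q) (of_vec X) K = (-1) ^ CARD('m) * (inner q X * eps1 p K - inner p X * eps1 q K)"
proof -
  have top: "wedge (of_vec X) (eps es) L = 0" for L
  proof (cases "length L = 1 + CARD('m)")
    case True
    have "\<not> distinct L" using True distinct_card[of L] card_mono[of UNIV "set L"] by fastforce
    then show ?thesis
      using alternating_not_distinct multivector_alternating[OF multivector_wedge[OF multivector_of_vec eps_multivector]]
      by blast
  next
    case False
    then show ?thesis
      using multivector_length[OF multivector_wedge[OF multivector_of_vec eps_multivector]] by blast
  qed
  have sgn: "(\<lambda>J. (-1) ^ length J * eps2 p q J) = (\<lambda>J. (-1) ^ CARD('m) * eps2 p q J)"
  proof
    fix J show "(-1) ^ length J * eps2 p q J = (-1) ^ CARD('m) * eps2 p q J"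
    proof (cases "length J = CARD('m) - 2")
      case True
      then have "CARD('m) = Suc (Suc (length J))" using assms by simp
      then show ?thesis by simp
    next
      case False
      then show ?thesis using multivector_length[OF multivector_eps2[OF assms]] by simp
    qed
  qed
  have wij: "wedge (of_vec X) (\<lambda>J. eps es (i # j # J)) K = X $ j * eps es (i # K) - X $ i * eps es (j # K)" for i j
    using top[of "i # j # K"] by (simp add: wedge_of_vec_Cons)
  have "wedge (eps2 p q) (of_vec X) K = (-1) ^ CARD('m) * wedge (of_vec X) (eps2 p q) K"
    by (simp add: wedge_of_vec_right sgn wedge_scale_right)
  also have "wedge (of_vec X) (eps2 p q) K =
      (\<Sum>i\<in>UNIV. \<Sum>j\<in>UNIV. p $ i * q $ j * (X $ j * eps es (i # K) - X $ i * eps es (j # K)))"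
    by (simp add: eps2_def[abs_def] wedge_sum_right wedge_scale_right wij)
  also have "\<dots> = eps1 p K * inner q X - inner p X * eps1 q K"
  proof -
    have "eps1 p K * inner q X = (\<Sum>i\<in>UNIV. \<Sum>j\<in>UNIV. p $ i * eps es (i # K) * (q $ j * X $ j))"
      "inner p X * eps1 q K = (\<Sum>i\<in>UNIV. \<Sum>j\<in>UNIV. p $ i * X $ i * (q $ j * eps es (j # K)))"
      by (simp_all add: eps1_def inner_vec_def sum_product)
    then show ?thesis by (simp only:) (simp add: right_diff_distrib sum_subtractf mult_ac)
  qed
  finally show ?thesis by (simp only: mult.commute)
qed

lemma inner_gram: "inner (G *v a) X = ip G X a"
  by (simp add: ip_def inner_commute)

lemma eps1_diff: "eps1 (p - q) K = eps1 p K - eps1 q K"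
  and eps1_add: "eps1 (p + q) K = eps1 p K + eps1 q K"
  and eps1_scaleR: "eps1 (c *\<^sub>R p) K = c * eps1 p K"
  by (simp_all add: eps1_def algebra_simps sum_subtractf sum.distrib sum_distrib_left)

text \<open>Puts the product of a dual bivector with \<open>X\<close> into the form of the dual of a
  vector, the shape that \<open>hodge_codim_one\<close> inverts.\<close>

lemma wedge_dual_bivector:
  assumes "2 \<le> CARD('m)"
  shows "wedge (\<lambda>K. \<kappa> * eps2 (G *v a) (G *v b) K) (of_vec X) K =
     \<kappa> * eps1 (G *v ((-1) ^ CARD('m) *\<^sub>R (ip G X b *\<^sub>R a - ip G X a *\<^sub>R b))) K"
  by (simp add: wedge_scale_left wedge_eps2[OF assms] inner_gram eps1_diff eps1_scaleR
      matrix_vector_mult_scaleR matrix_vector_mult_diff_distrib)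

lemma eps2_add_left: "eps2 (p + p') q K = eps2 p q K + eps2 p' q K"
  and eps2_add_right: "eps2 p (q + q') K = eps2 p q K + eps2 p q' K"
  by (simp_all add: eps2_def algebra_simps sum.distrib)

lemma eps1_minus: "eps1 (- p) K = - eps1 p K"
  by (simp add: eps1_def sum_negf)

text \<open>\<open>eps_trace\<close> is applied to the full list \<open>i # j # I\<close>. The terms
  in which \<open>B\<close> hits one of the two contracted slots are moved to the other side, where
  they become its transpose acting on the covectors.\<close>

lemma eps2_trace:
  fixes B :: "real ^ 'm ^ 'm"
  assumes "2 \<le> CARD('m)"
  shows "(\<Sum>r<length I. \<Sum>k\<in>UNIV. B $ (I ! r) $ k * eps2 p q (I[r := k])) =
    trace B * eps2 p q I - eps2 (transpose B *v p) q I - eps2 p (transpose B *v q) I"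
proof (cases "length I = CARD('m) - 2")
  case False
  then show ?thesis using multivector_length[OF multivector_eps2[OF assms]] by simp
next
  case True
  then have len: "CARD('m) = Suc (Suc (length I))" using assms by simp
  have tr: "(\<Sum>r<length I. \<Sum>k\<in>UNIV. B $ (I ! r) $ k * eps es (i # j # I[r := k])) =
      trace B * eps es (i # j # I) - (\<Sum>k\<in>UNIV. B $ i $ k * eps es (k # j # I))
      - (\<Sum>k\<in>UNIV. B $ j $ k * eps es (i # k # I))" for i j
    using eps_trace[of "i # j # I" B] unfolding len
    by (simp add: sum.lessThan_Suc_shift del: sum.lessThan_Suc)
  have "(\<Sum>r<length I. \<Sum>k\<in>UNIV. B $ (I ! r) $ k * eps2 p q (I[r := k])) =
      (\<Sum>r<length I. \<Sum>k\<in>UNIV. \<Sum>i\<in>UNIV. \<Sum>j\<in>UNIV. p $ i * q $ j * (B $ (I ! r) $ k * eps es (i # j # I[r := k])))"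
    by (simp add: eps2_def sum_distrib_left mult_ac)
  also have "\<dots> = (\<Sum>r<length I. \<Sum>i\<in>UNIV. \<Sum>k\<in>UNIV. \<Sum>j\<in>UNIV. p $ i * q $ j * (B $ (I ! r) $ k * eps es (i # j # I[r := k])))"
    by (intro sum.cong refl sum.swap)
  also have "\<dots> = (\<Sum>i\<in>UNIV. \<Sum>r<length I. \<Sum>k\<in>UNIV. \<Sum>j\<in>UNIV. p $ i * q $ j * (B $ (I ! r) $ k * eps es (i # j # I[r := k])))"
    by (rule sum.swap)
  also have "\<dots> = (\<Sum>i\<in>UNIV. \<Sum>r<length I. \<Sum>j\<in>UNIV. \<Sum>k\<in>UNIV. p $ i * q $ j * (B $ (I ! r) $ k * eps es (i # j # I[r := k])))"
    by (intro sum.cong refl sum.swap)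
  also have "\<dots> = (\<Sum>i\<in>UNIV. \<Sum>j\<in>UNIV. \<Sum>r<length I. \<Sum>k\<in>UNIV. p $ i * q $ j * (B $ (I ! r) $ k * eps es (i # j # I[r := k])))"
    by (intro sum.cong refl sum.swap)
  also have "\<dots> = (\<Sum>i\<in>UNIV. \<Sum>j\<in>UNIV. p $ i * q $ j * (trace B * eps es (i # j # I)
      - (\<Sum>k\<in>UNIV. B $ i $ k * eps es (k # j # I)) - (\<Sum>k\<in>UNIV. B $ j $ k * eps es (i # k # I))))"
    by (simp only: sum_distrib_left[symmetric] tr)
  also have "\<dots> = trace B * eps2 p q I
      - (\<Sum>i\<in>UNIV. \<Sum>j\<in>UNIV. \<Sum>k\<in>UNIV. p $ i * q $ j * B $ i $ k * eps es (k # j # I))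
      - (\<Sum>i\<in>UNIV. \<Sum>j\<in>UNIV. \<Sum>k\<in>UNIV. p $ i * q $ j * B $ j $ k * eps es (i # k # I))"
    by (simp add: eps2_def right_diff_distrib sum_subtractf sum_distrib_left mult_ac)
  also have "(\<Sum>i\<in>UNIV. \<Sum>j\<in>UNIV. \<Sum>k\<in>UNIV. p $ i * q $ j * B $ i $ k * eps es (k # j # I)) =
      eps2 (transpose B *v p) q I"
  proof -
    have "eps2 (transpose B *v p) q I =
        (\<Sum>k\<in>UNIV. \<Sum>j\<in>UNIV. \<Sum>i\<in>UNIV. p $ i * q $ j * B $ i $ k * eps es (k # j # I))"
      by (simp add: eps2_def matrix_vector_mult_def transpose_def sum_distrib_left sum_distrib_right mult_ac)
    also have "\<dots> = (\<Sum>j\<in>UNIV. \<Sum>k\<in>UNIV. \<Sum>i\<in>UNIV. p $ i * q $ j * B $ i $ k * eps es (k # j # I))"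
      by (rule sum.swap)
    also have "\<dots> = (\<Sum>j\<in>UNIV. \<Sum>i\<in>UNIV. \<Sum>k\<in>UNIV. p $ i * q $ j * B $ i $ k * eps es (k # j # I))"
      by (intro sum.cong refl sum.swap)
    also have "\<dots> = (\<Sum>i\<in>UNIV. \<Sum>j\<in>UNIV. \<Sum>k\<in>UNIV. p $ i * q $ j * B $ i $ k * eps es (k # j # I))"
      by (rule sum.swap)
    finally show ?thesis by simp
  qed
  also have "(\<Sum>i\<in>UNIV. \<Sum>j\<in>UNIV. \<Sum>k\<in>UNIV. p $ i * q $ j * B $ j $ k * eps es (i # k # I)) =
      eps2 p (transpose B *v q) I"
  proof -
    have "eps2 p (transpose B *v q) I =
        (\<Sum>i\<in>UNIV. \<Sum>k\<in>UNIV. \<Sum>j\<in>UNIV. p $ i * q $ j * B $ j $ k * eps es (i # k # I))"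
      by (simp add: eps2_def matrix_vector_mult_def transpose_def sum_distrib_left sum_distrib_right mult_ac)
    also have "\<dots> = (\<Sum>i\<in>UNIV. \<Sum>j\<in>UNIV. \<Sum>k\<in>UNIV. p $ i * q $ j * B $ j $ k * eps es (i # k # I))"
      by (intro sum.cong refl sum.swap)
    finally show ?thesis by simp
  qed
  finally show ?thesis .
qed

end

section \<open>The Levi-Civita connection in a chart\<close>

lemma Gam_add_left: "Gam h y (u + v) w = Gam h y u w + Gam h y v w"
  and Gam_add_right: "Gam h y w (u + v) = Gam h y w u + Gam h y w v"
  and Gam_scaleR_left: "Gam h y (c *\<^sub>R u) w = c *\<^sub>R Gam h y u w"
  and Gam_scaleR_right: "Gam h y w (c *\<^sub>R u) = c *\<^sub>R Gam h y w u"
  by (simp_all add: Gam_def vec_eq_iff sum.distrib[symmetric] sum_distrib_left algebra_simps)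

lemma linear_Gam_left: "linear (\<lambda>u. Gam h y u w)"
  by (auto intro!: linearI simp: Gam_add_left Gam_scaleR_left)

lemmas Gam_diff_left = linear_diff[OF linear_Gam_left]
  and Gam_0_left = linear_0[OF linear_Gam_left]

lemma Gam_axis_expansion:
  "Gam h y u v = (\<Sum>i\<in>UNIV. \<Sum>j\<in>UNIV. (u $ i * v $ j) *\<^sub>R Gam h y (axis i 1) (axis j 1))"
proof -
  have "Gam h y (axis i 1) (axis j 1) $ k = christoffel h y k i j" for i j k
    by (simp add: Gam_def axis_def if_distrib[of "\<lambda>x. _ * x"] cong: if_cong)
  then show ?thesis by (simp add: vec_eq_iff Gam_def mult_ac)
qed

lemma Riem_eq:
  "Riem h y u v w = frechet_derivative (\<lambda>y. Gam h y v w) (at y) u - frechet_derivative (\<lambda>y. Gam h y u w) (at y) v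
     + Gam h y u (Gam h y v w) - Gam h y v (Gam h y u w)"
proof -
  have "nabla h (\<lambda>_. v) (\<lambda>_. w) = (\<lambda>y. Gam h y v w)" for v w by (simp add: nabla_def fun_eq_iff)
  moreover have "lie_bracket (\<lambda>_. u) (\<lambda>_. v) = (\<lambda>_. 0)" by (simp add: lie_bracket_def fun_eq_iff)
  ultimately show ?thesis
    unfolding Riem_def Riem_field_def by (simp add: nabla_def Gam_0_left)
qed

section \<open>Koszul formula, metric compatibility and symmetry of the connection\<close>

locale metric_chart =
  fixes h :: "real ^ 'm::finite \<Rightarrow> real ^ 'm ^ 'm" and V :: "(real ^ 'm) set"
  assumes open_V: "open V"
    and smooth_h: "smooth_on V h"
    and sym_h: "y \<in> V \<Longrightarrow> transpose (h y) = h y"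
    and pos_h: "y \<in> V \<Longrightarrow> v \<noteq> 0 \<Longrightarrow> ip (h y) v v > 0"
begin

lemma det_h: "y \<in> V \<Longrightarrow> det (h y) > 0"
  using pos_onb_exists[OF sym_h pos_h] pos_onb_det(1) by blast

lemma nondegenerate: "y \<in> V \<Longrightarrow> (\<And>w. ip (h y) u w = ip (h y) v w) \<Longrightarrow> u = v"
  using pos_h[of y "u - v"] by (fastforce simp: ip_diff_left)

lemma sym_dh: "y \<in> V \<Longrightarrow> frechet_derivative h (at y) u $ i $ j = frechet_derivative h (at y) u $ j $ i"
proof -
  assume y: "y \<in> V"
  have d: "h differentiable (at y)" by (rule smooth_on_differentiable[OF smooth_h y])
  have t: "bounded_linear (transpose :: real ^ 'm ^ 'm \<Rightarrow> _)"
    unfolding linear_conv_bounded_linear[symmetric] by (rule linearI) (simp_all add: transpose_def vec_eq_iff)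
  have "frechet_derivative h (at y) u = frechet_derivative (\<lambda>y. transpose (h y)) (at y) u"
    using frechet_derivative_transform_within_open[OF d open_V y, of "\<lambda>y. transpose (h y)"] sym_h by simp
  also have "\<dots> = transpose (frechet_derivative h (at y) u)"
    by (rule frechet_derivative_bounded_linear[OF t d])
  finally have "frechet_derivative h (at y) u $ i $ j = transpose (frechet_derivative h (at y) u) $ i $ j" by (rule arg_cong)
  then show ?thesis by (simp only: transpose_def vec_lambda_beta)
qed

text \<open>Multiplication by the metric cancels the inverse matrix in the Christoffel symbols and
  leaves the three derivative terms. Compatibility and symmetry of the connection are then read off
  without coordinates.\<close>

lemma koszul:
  assumes "y \<in> V"
  shows "ip (h y) (Gam h y u v) w =
    (ip (frechet_derivative h (at y) u) v w + ip (frechet_derivative h (at y) v) u w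
      - ip (frechet_derivative h (at y) w) u v) / 2"
proof -
  let ?D = "frechet_derivative h (at y)"
  define c :: "real ^ 'm" where "c = (\<chi> l. (1/2) * (\<Sum>i\<in>UNIV. \<Sum>j\<in>UNIV.
      (partial h i y $ j $ l + partial h j y $ i $ l - partial h l y $ i $ j) * (u $ i * v $ j)))"
  have D: "?D x $ a $ b = (\<Sum>i\<in>UNIV. x $ i * partial h i y $ a $ b)" for x a b
  proof -
    have "?D x = (\<Sum>i\<in>UNIV. x $ i *\<^sub>R ?D (axis i 1))"
      using smooth_on_linear_derivative[OF smooth_h assms]
      by (subst basis_expansion[of x, symmetric]) (simp add: linear_sum linear_scale scalar_mult_eq_scaleR)
    then show ?thesis by (simp add: partial_def)
  qed
  have inv: "invertible (h y)" using det_h[OF assms] by (simp add: invertible_det_nz)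
  have "Gam h y u v = matrix_inv (h y) *v c"
  proof (subst vec_eq_iff, rule allI)
    fix k
    let ?p = "\<lambda>i j l. partial h i y $ j $ l + partial h j y $ i $ l - partial h l y $ i $ j"
    have "Gam h y u v $ k = (\<Sum>i\<in>UNIV. \<Sum>j\<in>UNIV. \<Sum>l\<in>UNIV. matrix_inv (h y) $ k $ l * ((1/2) * (?p i j l * (u $ i * v $ j))))"
      by (simp add: Gam_def christoffel_def sum_distrib_left sum_distrib_right mult_ac)
    also have "\<dots> = (\<Sum>i\<in>UNIV. \<Sum>l\<in>UNIV. \<Sum>j\<in>UNIV. matrix_inv (h y) $ k $ l * ((1/2) * (?p i j l * (u $ i * v $ j))))"
      by (intro sum.cong refl sum.swap)
    also have "\<dots> = (\<Sum>l\<in>UNIV. \<Sum>i\<in>UNIV. \<Sum>j\<in>UNIV. matrix_inv (h y) $ k $ l * ((1/2) * (?p i j l * (u $ i * v $ j))))"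
      by (rule sum.swap)
    also have "\<dots> = (matrix_inv (h y) *v c) $ k"
      by (simp only: matrix_vector_mult_def c_def vec_lambda_beta sum_distrib_left)
    finally show "Gam h y u v $ k = (matrix_inv (h y) *v c) $ k" .
  qed
  then have "h y *v Gam h y u v = c"
    by (simp add: matrix_vector_mul_assoc invertible_matrix_inv(1)[OF inv])
  then have "ip (h y) (Gam h y u v) w = inner w c"
    using ip_commute[OF sym_h[OF assms], of "Gam h y u v" w] by (simp add: ip_def)
  also have "\<dots> = ((\<Sum>l\<in>UNIV. \<Sum>i\<in>UNIV. \<Sum>j\<in>UNIV. w $ l * u $ i * v $ j * partial h i y $ j $ l)
      + (\<Sum>l\<in>UNIV. \<Sum>i\<in>UNIV. \<Sum>j\<in>UNIV. w $ l * u $ i * v $ j * partial h j y $ i $ l)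
      - (\<Sum>l\<in>UNIV. \<Sum>i\<in>UNIV. \<Sum>j\<in>UNIV. w $ l * u $ i * v $ j * partial h l y $ i $ j)) / 2"
    by (simp add: inner_vec_def c_def sum_distrib_left sum_divide_distrib sum.distrib[symmetric]
        sum_subtractf[symmetric] field_simps)
  also have "(\<Sum>l\<in>UNIV. \<Sum>i\<in>UNIV. \<Sum>j\<in>UNIV. w $ l * u $ i * v $ j * partial h i y $ j $ l) = ip (?D u) v w"
  proof -
    have "ip (?D u) v w = (\<Sum>j\<in>UNIV. \<Sum>l\<in>UNIV. \<Sum>i\<in>UNIV. w $ l * u $ i * v $ j * partial h i y $ j $ l)"
      by (simp add: ip_def inner_vec_def matrix_vector_mult_def D sum_distrib_left sum_distrib_right mult_ac)
    also have "\<dots> = (\<Sum>l\<in>UNIV. \<Sum>j\<in>UNIV. \<Sum>i\<in>UNIV. w $ l * u $ i * v $ j * partial h i y $ j $ l)"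
      by (rule sum.swap)
    also have "\<dots> = (\<Sum>l\<in>UNIV. \<Sum>i\<in>UNIV. \<Sum>j\<in>UNIV. w $ l * u $ i * v $ j * partial h i y $ j $ l)"
      by (intro sum.cong refl sum.swap)
    finally show ?thesis by simp
  qed
  also have "(\<Sum>l\<in>UNIV. \<Sum>i\<in>UNIV. \<Sum>j\<in>UNIV. w $ l * u $ i * v $ j * partial h j y $ i $ l) = ip (?D v) u w"
  proof -
    have "ip (?D v) u w = (\<Sum>i\<in>UNIV. \<Sum>l\<in>UNIV. \<Sum>j\<in>UNIV. w $ l * u $ i * v $ j * partial h j y $ i $ l)"
      by (simp add: ip_def inner_vec_def matrix_vector_mult_def D sum_distrib_left sum_distrib_right mult_ac)
    also have "\<dots> = (\<Sum>l\<in>UNIV. \<Sum>i\<in>UNIV. \<Sum>j\<in>UNIV. w $ l * u $ i * v $ j * partial h j y $ i $ l)"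
      by (rule sum.swap)
    finally show ?thesis by simp
  qed
  also have "(\<Sum>l\<in>UNIV. \<Sum>i\<in>UNIV. \<Sum>j\<in>UNIV. w $ l * u $ i * v $ j * partial h l y $ i $ j) = ip (?D w) u v"
  proof -
    have "ip (?D w) u v = (\<Sum>i\<in>UNIV. \<Sum>j\<in>UNIV. \<Sum>l\<in>UNIV. w $ l * u $ i * v $ j * partial h l y $ i $ j)"
      by (simp add: ip_def inner_vec_def matrix_vector_mult_def D sum_distrib_left sum_distrib_right mult_ac)
    also have "\<dots> = (\<Sum>i\<in>UNIV. \<Sum>l\<in>UNIV. \<Sum>j\<in>UNIV. w $ l * u $ i * v $ j * partial h l y $ i $ j)"
      by (intro sum.cong refl sum.swap)
    also have "\<dots> = (\<Sum>l\<in>UNIV. \<Sum>i\<in>UNIV. \<Sum>j\<in>UNIV. w $ l * u $ i * v $ j * partial h l y $ i $ j)"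
      by (rule sum.swap)
    finally show ?thesis by simp
  qed
  finally show ?thesis .
qed

lemma ip_dh_commute: "y \<in> V \<Longrightarrow> ip (frechet_derivative h (at y) u) v w = ip (frechet_derivative h (at y) u) w v"
  by (rule ip_commute) (simp add: transpose_def vec_eq_iff sym_dh)

text \<open>The Koszul formulas for the two terms on the right have two derivative terms in common
  with opposite signs; the remaining halves add up.\<close>

lemma metric_compatible:
  assumes y: "y \<in> V"
  shows "ip (frechet_derivative h (at y) u) v w = ip (h y) (Gam h y u v) w + ip (h y) v (Gam h y u w)"
proof -
  let ?D = "frechet_derivative h (at y)"
  have "ip (h y) v (Gam h y u w) = (ip (?D u) v w + ip (?D w) u v - ip (?D v) u w) / 2"
    unfolding ip_commute[OF sym_h[OF y], of v] koszul[OF y, of u w v] ip_dh_commute[OF y, of u w v] ..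
  moreover have "a = (a + b - c) / 2 + d" if "d = (a + c - b) / 2" for a b c d :: real
    using that by (simp add: field_simps)
  ultimately show ?thesis unfolding koszul[OF y, of u v w] by blast
qed

lemma Gam_commute:
  assumes y: "y \<in> V"
  shows "Gam h y u v = Gam h y v u"
proof (rule nondegenerate[OF y])
  fix w show "ip (h y) (Gam h y u v) w = ip (h y) (Gam h y v u) w"
    unfolding koszul[OF y, of u v w] koszul[OF y, of v u w] ip_dh_commute[OF y, of w v u] by simp
qed

lemma smooth_christoffel: "smooth_on V (\<lambda>y. christoffel h y k i j)"
  unfolding christoffel_def partial_def
  by (intro smooth_on_mult smooth_on_sum smooth_on_const smooth_on_diff smooth_on_add open_V
      smooth_on_matrix_inv_nth smooth_on_nth smooth_on_derivative_const smooth_h)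
     (use det_h in force)

lemma smooth_Gam: "smooth_on V (\<lambda>y. Gam h y u v)"
  unfolding Gam_def
  by (intro smooth_on_vec smooth_on_sum smooth_on_mult smooth_on_const smooth_christoffel open_V)

end

section \<open>Covariant derivatives along an immersed disc\<close>

text \<open>\<open>V\<close> stands for the image of the chart and \<open>U\<close> for the part of
  the disc lying over it. The frame is orthonormal on all of the open set \<open>U\<close>, since
  its relations are differentiated.\<close>

locale immersed_patch = coordinate_order "coord_order P" + metric_chart "met P" V
  for P :: "'m::finite patch" and V :: "(real ^ 'm) set" +
  fixes U :: "(real ^ 2) set"
  assumes open_U: "open U"
    and smooth_imm: "smooth_on U (imm P)"
    and imm_in: "z \<in> U \<Longrightarrow> imm P z \<in> V"
    and smooth_frm: "smooth_on U (frm P i)"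
    and frame: "z \<in> U \<Longrightarrow> pos_orthonormal_frame P z"
    and dim_ge_2: "2 \<le> CARD('m)"
begin

lemma linear_push: "z \<in> U \<Longrightarrow> linear (push P z)"
  unfolding push_def[abs_def] by (rule smooth_on_linear_derivative[OF smooth_imm])

lemma smooth_push: "smooth_on U X \<Longrightarrow> smooth_on U (\<lambda>z. push P z (X z))"
  unfolding push_def by (rule smooth_on_derivative[OF open_U smooth_imm])

lemma smooth_compose_imm: "smooth_on V g \<Longrightarrow> smooth_on U (\<lambda>z. g (imm P z))"
  by (rule smooth_on_compose[OF open_U open_V _ _ smooth_imm]) (use imm_in in auto)

lemma smooth_Gam_along:
  assumes "smooth_on U X" "smooth_on U Y"
  shows "smooth_on U (\<lambda>z. Gam (met P) (imm P z) (X z) (Y z))"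
  by (subst Gam_axis_expansion)
     (intro smooth_on_sum smooth_on_scaleR smooth_on_mult smooth_on_nth smooth_compose_imm smooth_Gam assms open_U)

lemma smooth_cov: "smooth_on U X \<Longrightarrow> smooth_on U \<xi> \<Longrightarrow> smooth_on U (\<lambda>z. cov P (X z) \<xi> z)"
  unfolding cov_def
  by (intro smooth_on_add smooth_on_derivative smooth_Gam_along smooth_push open_U)

lemma smooth_ip_M: "smooth_on U \<xi> \<Longrightarrow> smooth_on U \<eta> \<Longrightarrow> smooth_on U (\<lambda>z. ip_M P z (\<xi> z) (\<eta> z))"
  unfolding ip_M_def by (intro smooth_on_ip open_U smooth_compose_imm smooth_h)

text \<open>The expression depends on the point in three ways, through the base point and both
  vector arguments. Expansion over coordinate vectors separates them, so that the ordinary product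
  rule applies.\<close>

lemma Gam_has_derivative:
  assumes z: "z \<in> U" and X: "(X has_derivative X') (at z)" and Y: "(Y has_derivative Y') (at z)"
  shows "((\<lambda>z. Gam (met P) (imm P z) (X z) (Y z)) has_derivative
    (\<lambda>v. frechet_derivative (\<lambda>y. Gam (met P) y (X z) (Y z)) (at (imm P z)) (push P z v)
      + Gam (met P) (imm P z) (X' v) (Y z) + Gam (met P) (imm P z) (X z) (Y' v))) (at z)"
proof -
  let ?C = "\<lambda>i j y. Gam (met P) y (axis i 1) (axis j 1)"
  let ?dC = "\<lambda>i j. frechet_derivative (?C i j) (at (imm P z))"
  have C: "(?C i j has_derivative ?dC i j) (at (imm P z))" for i j
    by (rule smooth_on_has_derivative[OF smooth_Gam imm_in[OF z]])
  have Cz: "((\<lambda>z. ?C i j (imm P z)) has_derivative (\<lambda>v. ?dC i j (push P z v))) (at z)" for i j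
    unfolding push_def by (rule has_derivative_compose[OF smooth_on_has_derivative[OF smooth_imm z] C])
  have dGam: "frechet_derivative (\<lambda>y. Gam (met P) y a b) (at (imm P z)) u =
      (\<Sum>i\<in>UNIV. \<Sum>j\<in>UNIV. (a $ i * b $ j) *\<^sub>R ?dC i j u)" for a b u
  proof -
    have "((\<lambda>y. \<Sum>i\<in>UNIV. \<Sum>j\<in>UNIV. (a $ i * b $ j) *\<^sub>R ?C i j y) has_derivative
        (\<lambda>u. \<Sum>i\<in>UNIV. \<Sum>j\<in>UNIV. (a $ i * b $ j) *\<^sub>R ?dC i j u)) (at (imm P z))"
      by (intro has_derivative_sum has_derivative_scaleR_right C)
    then show ?thesis by (subst Gam_axis_expansion) (simp add: frechet_derivativeI)
  qed
  have "((\<lambda>z. \<Sum>i\<in>UNIV. \<Sum>j\<in>UNIV. (X z $ i * Y z $ j) *\<^sub>R ?C i j (imm P z)) has_derivative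
      (\<lambda>v. \<Sum>i\<in>UNIV. \<Sum>j\<in>UNIV. (X z $ i * Y z $ j) *\<^sub>R ?dC i j (push P z v)
        + (X z $ i * Y' v $ j + X' v $ i * Y z $ j) *\<^sub>R ?C i j (imm P z))) (at z)"
    by (intro has_derivative_sum has_derivative_scaleR has_derivative_mult has_derivative_nth X Y Cz)
  moreover have "(\<lambda>z. \<Sum>i\<in>UNIV. \<Sum>j\<in>UNIV. (X z $ i * Y z $ j) *\<^sub>R ?C i j (imm P z)) =
      (\<lambda>z. Gam (met P) (imm P z) (X z) (Y z))"
    by (simp add: Gam_axis_expansion[of _ _ "X _"])
  moreover have "(\<lambda>v. \<Sum>i\<in>UNIV. \<Sum>j\<in>UNIV. (X z $ i * Y z $ j) *\<^sub>R ?dC i j (push P z v)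
        + (X z $ i * Y' v $ j + X' v $ i * Y z $ j) *\<^sub>R ?C i j (imm P z)) =
      (\<lambda>v. frechet_derivative (\<lambda>y. Gam (met P) y (X z) (Y z)) (at (imm P z)) (push P z v)
      + Gam (met P) (imm P z) (X' v) (Y z) + Gam (met P) (imm P z) (X z) (Y' v))"
    unfolding dGam[of "X z" "Y z"]
    by (simp add: Gam_axis_expansion[of _ _ "X' _"] Gam_axis_expansion[of _ _ "X z"]
        sum.distrib scaleR_add_left add_ac)
  ultimately show ?thesis by simp
qed

lemma cov_cong:
  assumes "z \<in> U" "\<And>w. w \<in> U \<Longrightarrow> \<xi> w = \<eta> w" "smooth_on U \<xi>"
  shows "cov P v \<xi> z = cov P v \<eta> z"
  unfolding cov_def
  using frechet_derivative_transform_within_open[OF smooth_on_differentiable[OF assms(3,1)] open_U assms(1), of \<eta>] assms(1,2)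
  by simp

lemma linear_cov: "z \<in> U \<Longrightarrow> smooth_on U \<xi> \<Longrightarrow> linear (\<lambda>v. cov P v \<xi> z)"
  unfolding cov_def
  using smooth_on_linear_derivative[of U \<xi> z] linear_push[of z]
  by (auto intro!: linearI simp: linear_add linear_scale Gam_add_left Gam_scaleR_left scaleR_add_right)

lemma cov_add:
  assumes "z \<in> U" "smooth_on U \<xi>" "smooth_on U \<eta>"
  shows "cov P v (\<lambda>w. \<xi> w + \<eta> w) z = cov P v \<xi> z + cov P v \<eta> z"
  unfolding cov_def
  using frechet_derivativeI[OF has_derivative_add[OF smooth_on_has_derivative[OF assms(2,1)] smooth_on_has_derivative[OF assms(3,1)]]]
  by (simp add: Gam_add_right)

lemma cov_scaleR:
  assumes "z \<in> U" "smooth_on U f" "smooth_on U \<xi>"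
  shows "cov P v (\<lambda>w. f w *\<^sub>R \<xi> w) z = frechet_derivative f (at z) v *\<^sub>R \<xi> z + f z *\<^sub>R cov P v \<xi> z"
  unfolding cov_def
  using frechet_derivativeI[OF has_derivative_scaleR[OF smooth_on_has_derivative[OF assms(2,1)] smooth_on_has_derivative[OF assms(3,1)]]]
  by (simp add: Gam_scaleR_right scaleR_add_right)

lemma cov_ip:
  assumes z: "z \<in> U" and "smooth_on U \<xi>" "smooth_on U \<eta>"
  shows "frechet_derivative (\<lambda>w. ip_M P w (\<xi> w) (\<eta> w)) (at z) v =
    ip_M P z (cov P v \<xi> z) (\<eta> z) + ip_M P z (\<xi> z) (cov P v \<eta> z)"
proof -
  have m: "((\<lambda>w. met P (imm P w)) has_derivative
      (\<lambda>v. frechet_derivative (met P) (at (imm P z)) (push P z v))) (at z)"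
    unfolding push_def
    by (rule has_derivative_compose[OF smooth_on_has_derivative[OF smooth_imm z]
          smooth_on_has_derivative[OF smooth_h imm_in[OF z]]])
  show ?thesis
    unfolding ip_M_def
    using frechet_derivativeI[OF ip_has_derivative[OF m smooth_on_has_derivative[OF assms(2) z] smooth_on_has_derivative[OF assms(3) z]]]
    by (simp add: metric_compatible[OF imm_in[OF z]] cov_def ip_add_left ip_add_right)
qed

text \<open>Vanishing torsion along the immersion: the second derivatives of \<open>imm P\<close>
  and the Christoffel terms are both symmetric, so only the Lie bracket of the two fields
  remains.\<close>

lemma cov_push:
  assumes z: "z \<in> U" and X: "smooth_on U X" and Y: "smooth_on U Y"
  shows "cov P (X z) (\<lambda>w. push P w (Y w)) z - cov P (Y z) (\<lambda>w. push P w (X w)) z =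
    push P z (frechet_derivative Y (at z) (X z) - frechet_derivative X (at z) (Y z))"
proof -
  note D = frechet_derivativeI[OF derivative_along[OF open_U smooth_imm z smooth_on_has_derivative[OF _ z]]]
  show ?thesis
    unfolding cov_def push_def D[OF X] D[OF Y]
    using second_derivative_symmetric[OF open_U smooth_imm z, of "X z" "Y z"]
      Gam_commute[OF imm_in[OF z], of "frechet_derivative (imm P) (at z) (X z)"]
      linear_diff[OF smooth_on_linear_derivative[OF smooth_imm z]]
    by simp
qed

text \<open>The second derivatives of the section and of the immersion cancel by symmetry, and the
  derivatives of the direction fields are absorbed by the bracket term. What remains are derivatives
  and products of the connection coefficients, the coordinate expression of the curvature.\<close>

lemma cov_commute:
  assumes z: "z \<in> U" and X: "smooth_on U X" and Y: "smooth_on U Y" and \<xi>: "smooth_on U \<xi>"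
  shows "cov P (X z) (\<lambda>w. cov P (Y w) \<xi> w) z - cov P (Y z) (\<lambda>w. cov P (X w) \<xi> w) z
     - cov P (frechet_derivative Y (at z) (X z) - frechet_derivative X (at z) (Y z)) \<xi> z
     = Riem (met P) (imm P z) (push P z (X z)) (push P z (Y z)) (\<xi> z)"
proof -
  let ?h = "met P" and ?y = "imm P z" and ?d = "frechet_derivative \<xi> (at z)"
  let ?S = "\<lambda>u v. frechet_derivative (\<lambda>w. frechet_derivative \<xi> (at w) u) (at z) v"
  let ?I = "\<lambda>u v. frechet_derivative (\<lambda>w. frechet_derivative (imm P) (at w) u) (at z) v"
  have D: "cov P u (\<lambda>w. cov P (Y w) \<xi> w) z =
      ?S (Y z) u + ?d (frechet_derivative Y (at z) u)
      + (frechet_derivative (\<lambda>y. Gam ?h y (push P z (Y z)) (\<xi> z)) (at ?y) (push P z u)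
         + Gam ?h ?y (?I (Y z) u + push P z (frechet_derivative Y (at z) u)) (\<xi> z)
         + Gam ?h ?y (push P z (Y z)) (?d u))
      + Gam ?h ?y (push P z u) (?d (Y z) + Gam ?h ?y (push P z (Y z)) (\<xi> z))"
    if Y: "smooth_on U Y" for u and Y :: "real ^ 2 \<Rightarrow> real ^ 2"
  proof -
    have p: "((\<lambda>w. push P w (Y w)) has_derivative
        (\<lambda>u. ?I (Y z) u + push P z (frechet_derivative Y (at z) u))) (at z)"
      unfolding push_def by (rule derivative_along[OF open_U smooth_imm z smooth_on_has_derivative[OF Y z]])
    from has_derivative_add[OF derivative_along[OF open_U \<xi> z smooth_on_has_derivative[OF Y z]]
        Gam_has_derivative[OF z p smooth_on_has_derivative[OF \<xi> z]]]
    show ?thesis unfolding cov_def[of P u] by (subst frechet_derivativeI) (auto simp: cov_def)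
  qed
  have lin: "?d (a - b) = ?d a - ?d b" "push P z (a - b) = push P z a - push P z b" for a b
    using linear_diff[OF smooth_on_linear_derivative[OF \<xi> z]] linear_diff[OF linear_push[OF z]] by auto
  show ?thesis
    unfolding D[OF X] D[OF Y] cov_def[of P "_ - _"] Riem_eq
      second_derivative_symmetric[OF open_U \<xi> z, of "X z" "Y z"]
      second_derivative_symmetric[OF open_U smooth_imm z, of "X z" "Y z"] lin
      Gam_add_left Gam_add_right Gam_diff_left
    by (simp add: algebra_simps)
qed

section \<open>The induced metric and the moving frame\<close>

lemma ip_M_commute: "z \<in> U \<Longrightarrow> ip_M P z v w = ip_M P z w v"
  unfolding ip_M_def by (rule ip_commute[OF sym_h[OF imm_in]])

lemmas ip_M_simps = ip_simps[of "met P (imm P z)" for z, folded ip_M_def]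

lemma ip_pullback:
  assumes "z \<in> U"
  shows "ip (pullback_metric P z) v w = ip_M P z (push P z v) (push P z w)"
proof -
  have push: "push P z v = (\<Sum>i\<in>UNIV. v $ i *\<^sub>R push P z (axis i 1))" for v
  proof -
    have "push P z v = push P z (\<Sum>i\<in>UNIV. v $ i *\<^sub>R axis i 1)"
      using basis_expansion[of v] by (simp add: scalar_mult_eq_scaleR)
    then show ?thesis by (simp add: linear_sum[OF linear_push[OF assms]] linear_scale[OF linear_push[OF assms]])
  qed
  have "ip_M P z (push P z v) (push P z w) =
      (\<Sum>i\<in>UNIV. \<Sum>j\<in>UNIV. v $ i * (w $ j * ip_M P z (push P z (axis i 1)) (push P z (axis j 1))))"
    by (subst (1) push, subst (2) push)
       (simp only: ip_M_def ip_sum_left ip_scaleR_left, simp only: ip_sum_right ip_scaleR_right sum_distrib_left)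
  then show ?thesis by (simp add: ip_expand pullback_metric_def mult_ac)
qed

lemma pos_onb_frm: "z \<in> U \<Longrightarrow> pos_onb (pullback_metric P z) (\<chi> i. frm P i z)"
  using frame by (simp add: pos_orthonormal_frame_def)

lemma ip_frm: "z \<in> U \<Longrightarrow> ip (pullback_metric P z) (frm P i z) (frm P j z) = (if i = j then 1 else 0)"
  using pos_onb_frm[of z] by (simp add: pos_onb_def)

lemma ip_e: "z \<in> U \<Longrightarrow> ip_M P z (e_vec P i z) (e_vec P j z) = (if i = j then 1 else 0)"
  unfolding e_vec_def using ip_pullback ip_frm by metis

text \<open>The reciprocal of the area density sqrt(det g). As a polynomial in the frame it is
  directly related to the bracket of the frame when differentiated.\<close>

definition frm_det :: "real ^ 2 \<Rightarrow> real" where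
  "frm_det z = frm P 1 z $ 1 * frm P 2 z $ 2 - frm P 1 z $ 2 * frm P 2 z $ 1"

lemma det_frm: "det (\<chi> i. frm P i z) = frm_det z"
  by (simp add: det_2 frm_det_def)

lemma frm_det_pos: "z \<in> U \<Longrightarrow> frm_det z > 0"
  using pos_onb_frm[of z] by (simp add: pos_onb_def det_frm)

lemma frm_det_sqrt: "z \<in> U \<Longrightarrow> sqrt (det (pullback_metric P z)) = inverse (frm_det z)"
  using pos_onb_det(2)[OF pos_onb_frm, of z] by (simp add: det_frm)

lemma smooth_frm_det: "smooth_on U frm_det"
  unfolding frm_det_def by (intro smooth_on_diff smooth_on_mult smooth_on_nth smooth_frm open_U)

lemma frame_span:
  assumes "z \<in> U"
  obtains c1 c2 where "v = c1 *\<^sub>R frm P 1 z + c2 *\<^sub>R frm P 2 z"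
proof
  let ?d = "frm_det z"
  have d: "?d \<noteq> 0" using frm_det_pos[OF assms] by simp
  show "v = ((v $ 1 * frm P 2 z $ 2 - v $ 2 * frm P 2 z $ 1) / ?d) *\<^sub>R frm P 1 z
      + ((frm P 1 z $ 1 * v $ 2 - frm P 1 z $ 2 * v $ 1) / ?d) *\<^sub>R frm P 2 z"
    using d by (simp add: vec_eq_iff forall_2 add_divide_distrib[symmetric] eq_divide_eq)
      (simp add: frm_det_def algebra_simps)
qed

lemma smooth_e: "smooth_on U (e_vec P i)"
  unfolding e_vec_def[abs_def] by (rule smooth_push[OF smooth_frm])

subsection \<open>Orthogonal projections\<close>

lemma pi_T_eq:
  assumes z: "z \<in> U"
  shows "pi_T P z X = ip_M P z X (e_vec P 1 z) *\<^sub>R e_vec P 1 z + ip_M P z X (e_vec P 2 z) *\<^sub>R e_vec P 2 z"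
    (is "_ = ?Y")
  unfolding pi_T_def
proof (rule the_equality)
  note lin = linear_add[OF linear_push[OF z]] linear_scale[OF linear_push[OF z]]
  have "?Y = push P z (ip_M P z X (e_vec P 1 z) *\<^sub>R frm P 1 z + ip_M P z X (e_vec P 2 z) *\<^sub>R frm P 2 z)"
    by (simp add: lin e_vec_def)
  then have "?Y \<in> range (push P z)" by blast
  moreover have orth: "ip_M P z (X - ?Y) (push P z v) = 0" for v
  proof -
    obtain c1 c2 where "v = c1 *\<^sub>R frm P 1 z + c2 *\<^sub>R frm P 2 z" using frame_span[OF z] by blast
    then have "push P z v = c1 *\<^sub>R e_vec P 1 z + c2 *\<^sub>R e_vec P 2 z" by (simp add: lin e_vec_def)
    then show ?thesis by (simp add: ip_M_simps ip_e[OF z])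
  qed
  ultimately show "?Y \<in> range (push P z) \<and> (\<forall>v. ip_M P z (X - ?Y) (push P z v) = 0)" by blast
  fix Y assume Y: "Y \<in> range (push P z) \<and> (\<forall>v. ip_M P z (X - Y) (push P z v) = 0)"
  then obtain v where "?Y - Y = push P z v"
    using \<open>?Y \<in> range (push P z)\<close> linear_diff[OF linear_push[OF z]] by (metis rangeE)
  \<comment> \<open>The difference of two candidates is tangential, and both residues are orthogonal
    to tangent vectors, so it is orthogonal to itself; positivity of the metric makes it
    vanish.\<close>
  then have "ip_M P z (?Y - Y) (?Y - Y) = 0"
    using Y orth[of v] ip_M_simps(3)[of z "X - Y" "X - ?Y" "push P z v"] by simp
  then show "Y = ?Y" using pos_h[OF imm_in[OF z], of "?Y - Y"] by (force simp: ip_M_def)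
qed

lemma pi_n_eq: "z \<in> U \<Longrightarrow>
    pi_n P z X = X - (ip_M P z X (e_vec P 1 z) *\<^sub>R e_vec P 1 z + ip_M P z X (e_vec P 2 z) *\<^sub>R e_vec P 2 z)"
  by (simp add: pi_n_def pi_T_eq)

lemma linear_pi_n: "z \<in> U \<Longrightarrow> linear (pi_n P z)"
  by (rule linearI) (simp_all add: pi_n_eq ip_M_simps algebra_simps)

lemma ip_pi_n:
  assumes z: "z \<in> U"
  shows "ip_M P z (pi_n P z X) (e_vec P i z) = 0" "ip_M P z (e_vec P i z) (pi_n P z X) = 0"
proof -
  show "ip_M P z (pi_n P z X) (e_vec P i z) = 0"
    using exhaust_2[of i] by (auto simp: pi_n_eq[OF z] ip_M_simps ip_e[OF z])
  then show "ip_M P z (e_vec P i z) (pi_n P z X) = 0" using ip_M_commute[OF z] by metis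
qed

lemma smooth_pi_n: "smooth_on U \<xi> \<Longrightarrow> smooth_on U (\<lambda>w. pi_n P w (\<xi> w))"
  by (subst smooth_on_cong[OF open_U pi_n_eq])
     (auto intro!: smooth_on_diff smooth_on_add smooth_on_scaleR smooth_ip_M smooth_e open_U)

subsection \<open>Structure equations of the frame\<close>

definition sff :: "2 \<Rightarrow> 2 \<Rightarrow> real ^ 2 \<Rightarrow> real ^ 'm" where
  "sff i j z = II P (frm P i) (frm P j) z"

definition conn :: "2 \<Rightarrow> real ^ 2 \<Rightarrow> real" where
  "conn i z = ip_M P z (cov P (frm P i z) (e_vec P 1) z) (e_vec P 2 z)"

lemma sff_eq: "sff i j z = pi_n P z (cov P (frm P i z) (e_vec P j) z)"
  by (simp add: sff_def II_def e_vec_def[abs_def])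

lemma smooth_sff: "smooth_on U (sff i j)"
  unfolding sff_eq[abs_def] by (intro smooth_pi_n smooth_cov smooth_frm smooth_e)

lemma ip_sff: "z \<in> U \<Longrightarrow> ip_M P z (sff i j z) (e_vec P k z) = 0" "z \<in> U \<Longrightarrow> ip_M P z (e_vec P k z) (sff i j z) = 0"
  by (simp_all add: sff_eq ip_pi_n)

lemma derivative_const_on:
  fixes f :: "real ^ 2 \<Rightarrow> real"
  assumes "z \<in> U" "\<And>w. w \<in> U \<Longrightarrow> f w = c"
  shows "frechet_derivative f (at z) v = 0"
proof -
  have "frechet_derivative f (at z) = frechet_derivative (\<lambda>_. c) (at z)"
    by (rule sym, rule frechet_derivative_transform_within_open[OF differentiable_const open_U assms(1)])
       (simp add: assms(2))
  then show ?thesis by simp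
qed

lemma ip_cov_e:
  assumes z: "z \<in> U"
  shows "ip_M P z (cov P v (e_vec P i) z) (e_vec P j z) = - ip_M P z (cov P v (e_vec P j) z) (e_vec P i z)"
  using cov_ip[OF z smooth_e[of i] smooth_e[of j], of v]
    derivative_const_on[OF z, of "\<lambda>w. ip_M P w (e_vec P i w) (e_vec P j w)" "if i = j then 1 else 0" v] ip_e
    ip_M_commute[OF z, of "e_vec P i z" "cov P v (e_vec P j) z"] by simp

lemma cov_e:
  assumes z: "z \<in> U"
  shows "cov P (frm P i z) (e_vec P 1) z = sff i 1 z + conn i z *\<^sub>R e_vec P 2 z"
    and "cov P (frm P i z) (e_vec P 2) z = sff i 2 z - conn i z *\<^sub>R e_vec P 1 z"
proof -
  have 0: "ip_M P z (cov P (frm P i z) (e_vec P j) z) (e_vec P j z) = 0" for j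
    using ip_cov_e[OF z, of "frm P i z" j j] by simp
  show "cov P (frm P i z) (e_vec P 1) z = sff i 1 z + conn i z *\<^sub>R e_vec P 2 z"
    unfolding sff_eq pi_n_eq[OF z] 0 conn_def by simp
  show "cov P (frm P i z) (e_vec P 2) z = sff i 2 z - conn i z *\<^sub>R e_vec P 1 z"
    unfolding sff_eq pi_n_eq[OF z] 0 conn_def ip_cov_e[OF z, of _ 1 2] by simp
qed

definition bracket :: "real ^ 2 \<Rightarrow> real ^ 2" where
  "bracket z = frechet_derivative (frm P 2) (at z) (frm P 1 z) - frechet_derivative (frm P 1) (at z) (frm P 2 z)"

lemma push_bracket:
  assumes z: "z \<in> U"
  shows "cov P (frm P 1 z) (e_vec P 2) z - cov P (frm P 2 z) (e_vec P 1) z = push P z (bracket z)"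
  unfolding e_vec_def[abs_def] bracket_def by (rule cov_push[OF z smooth_frm smooth_frm])

text \<open>Both claims are parts of the single torsion equation \<open>push_bracket\<close>:
  pairing it with the frame gives the coefficients of the bracket, and its normal part gives the
  symmetry of the second fundamental form.\<close>

lemma bracket_eq:
  assumes z: "z \<in> U"
  shows "bracket z = - (conn 1 z *\<^sub>R frm P 1 z) - conn 2 z *\<^sub>R frm P 2 z" and sff_sym: "sff 1 2 z = sff 2 1 z"
proof -
  obtain c1 c2 where c: "bracket z = c1 *\<^sub>R frm P 1 z + c2 *\<^sub>R frm P 2 z" using frame_span[OF z] by blast
  have "push P z (bracket z) = c1 *\<^sub>R e_vec P 1 z + c2 *\<^sub>R e_vec P 2 z"
    unfolding c e_vec_def by (simp add: linear_add[OF linear_push[OF z]] linear_scale[OF linear_push[OF z]])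
  then have eq: "sff 1 2 z - conn 1 z *\<^sub>R e_vec P 1 z - (sff 2 1 z + conn 2 z *\<^sub>R e_vec P 2 z)
      = c1 *\<^sub>R e_vec P 1 z + c2 *\<^sub>R e_vec P 2 z"
    using push_bracket[OF z] by (simp add: cov_e[OF z])
  have "c1 = - conn 1 z" "c2 = - conn 2 z"
    using arg_cong[OF eq, of "\<lambda>x. ip_M P z x (e_vec P 1 z)"] arg_cong[OF eq, of "\<lambda>x. ip_M P z x (e_vec P 2 z)"]
    by (simp_all add: ip_M_simps ip_e[OF z] ip_sff[OF z])
  then show "bracket z = - (conn 1 z *\<^sub>R frm P 1 z) - conn 2 z *\<^sub>R frm P 2 z" using c by simp
  show "sff 1 2 z = sff 2 1 z" using eq \<open>c1 = _\<close> \<open>c2 = _\<close> by simp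
qed

lemma cov_cov_frame:
  assumes z: "z \<in> U" and \<xi>: "smooth_on U \<xi>"
  shows "Riem (met P) (imm P z) (e_vec P 1 z) (e_vec P 2 z) (\<xi> z) =
    cov P (frm P 1 z) (\<lambda>w. cov P (frm P 2 w) \<xi> w) z - cov P (frm P 2 z) (\<lambda>w. cov P (frm P 1 w) \<xi> w) z
    + conn 1 z *\<^sub>R cov P (frm P 1 z) \<xi> z + conn 2 z *\<^sub>R cov P (frm P 2 z) \<xi> z"
proof -
  have "cov P (bracket z) \<xi> z = - (conn 1 z *\<^sub>R cov P (frm P 1 z) \<xi> z) - conn 2 z *\<^sub>R cov P (frm P 2 z) \<xi> z"
    unfolding bracket_eq[OF z]
    by (simp add: linear_diff[OF linear_cov[OF z \<xi>]] linear_neg[OF linear_cov[OF z \<xi>]] linear_scale[OF linear_cov[OF z \<xi>]])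
  then show ?thesis
    using cov_commute[OF z smooth_frm smooth_frm \<xi>, of 1 2, symmetric] by (simp add: e_vec_def bracket_def)
qed

subsection \<open>The adjoint of the covariant derivative in the frame\<close>

lemma linear_axis_2: "linear f \<Longrightarrow> f v = v $ 1 *\<^sub>R f (axis 1 1) + v $ 2 *\<^sub>R f (axis 2 1)" for v :: "real ^ 2"
proof -
  assume f: "linear f"
  have "f v = f (\<Sum>i\<in>UNIV. v $ i *\<^sub>R axis i 1)" using basis_expansion[of v] by (simp add: scalar_mult_eq_scaleR)
  then show ?thesis by (simp add: sum_2 linear_add[OF f] linear_scale[OF f])
qed

text \<open>The algebra behind the divergence of the frame. \<open>a\<close> and \<open>b\<close>
  are the components of f1 and f2, a further index denotes a partial derivative, \<open>d\<close> is
  the determinant of the frame, and the hypotheses are the two components of the bracket relation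
  with \<open>p\<close> and \<open>q\<close> in place of \<open>conn 1\<close> and
  \<open>conn 2\<close>.\<close>

lemma div_frame_real:
  fixes a1 a2 b1 b2 a11 a12 a21 a22 b11 b12 b21 b22 p q :: real
  assumes "a1 * b11 + a2 * b12 - (b1 * a11 + b2 * a12) = - p * a1 - q * b1"
    and "a1 * b21 + a2 * b22 - (b1 * a21 + b2 * a22) = - p * a2 - q * b2"
  defines "d \<equiv> a1 * b2 - a2 * b1"
    and "d1 \<equiv> a1 * b21 + a11 * b2 - (a2 * b11 + a21 * b1)"
    and "d2 \<equiv> a1 * b22 + a12 * b2 - (a2 * b12 + a22 * b1)"
  shows "d * (a11 + a22) - (a1 * d1 + a2 * d2) = q * d"
    and "d * (b11 + b22) - (b1 * d1 + b2 * d2) = - p * d"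
  unfolding d_def d1_def d2_def using assms(1,2) by algebra+

text \<open>\<open>dv i\<close> is the divergence of f_i for the induced area form, with
  \<open>frm_det\<close> in the role of the inverse density; the bracket of the frame determines
  both divergences.\<close>

lemma divergence_frame:
  assumes z: "z \<in> U"
  defines "dv \<equiv> \<lambda>i. frm_det z *
    (frechet_derivative (\<lambda>w. frm P i w $ 1 * inverse (frm_det w)) (at z) (axis 1 1)
     + frechet_derivative (\<lambda>w. frm P i w $ 2 * inverse (frm_det w)) (at z) (axis 2 1))"
  shows "dv 1 = conn 2 z" "dv 2 = - conn 1 z"
proof -
  let ?d = "frm_det z"
  let ?A = "\<lambda>i k b. frechet_derivative (frm P i) (at z) (axis b 1) $ k"
  let ?d' = "\<lambda>b. frm P 1 z $ 1 * ?A 2 2 b + ?A 1 1 b * frm P 2 z $ 2 - (frm P 1 z $ 2 * ?A 2 1 b + ?A 1 2 b * frm P 2 z $ 1)"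
  have d0: "?d \<noteq> 0" using frm_det_pos[OF z] by simp
  have F: "((\<lambda>w. frm P i w $ k) has_derivative (\<lambda>v. frechet_derivative (frm P i) (at z) v $ k)) (at z)" for i k
    by (rule has_derivative_nth[OF smooth_on_has_derivative[OF smooth_frm z]])
  have d: "(frm_det has_derivative (\<lambda>v. (frm P 1 z $ 1 * frechet_derivative (frm P 2) (at z) v $ 2
      + frechet_derivative (frm P 1) (at z) v $ 1 * frm P 2 z $ 2)
      - (frm P 1 z $ 2 * frechet_derivative (frm P 2) (at z) v $ 1
      + frechet_derivative (frm P 1) (at z) v $ 2 * frm P 2 z $ 1))) (at z)"
    unfolding frm_det_def[abs_def] by (intro has_derivative_diff has_derivative_mult F)
  have fd: "frechet_derivative (\<lambda>w. frm P i w $ k * inverse (frm_det w)) (at z) (axis b 1) =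
      frm P i z $ k * - (inverse ?d * ?d' b * inverse ?d) + ?A i k b * inverse ?d" for i k b
    by (subst frechet_derivativeI[OF has_derivative_mult[OF F Deriv.has_derivative_inverse[OF d0 d]]]) simp
  have br: "bracket z $ k = frm P 1 z $ 1 * ?A 2 k 1 + frm P 1 z $ 2 * ?A 2 k 2
      - (frm P 2 z $ 1 * ?A 1 k 1 + frm P 2 z $ 2 * ?A 1 k 2)" for k
    unfolding bracket_def
      linear_axis_2[OF smooth_on_linear_derivative[OF smooth_frm z], of 2 "frm P 1 z"]
      linear_axis_2[OF smooth_on_linear_derivative[OF smooth_frm z], of 1 "frm P 2 z"] by simp
  have 1: "frm P 1 z $ 1 * ?A 2 1 1 + frm P 1 z $ 2 * ?A 2 1 2 - (frm P 2 z $ 1 * ?A 1 1 1 + frm P 2 z $ 2 * ?A 1 1 2)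
      = - conn 1 z * frm P 1 z $ 1 - conn 2 z * frm P 2 z $ 1"
    unfolding br[symmetric] bracket_eq[OF z] by simp
  have 2: "frm P 1 z $ 1 * ?A 2 2 1 + frm P 1 z $ 2 * ?A 2 2 2 - (frm P 2 z $ 1 * ?A 1 2 1 + frm P 2 z $ 2 * ?A 1 2 2)
      = - conn 1 z * frm P 1 z $ 2 - conn 2 z * frm P 2 z $ 2"
    unfolding br[symmetric] bracket_eq[OF z] by simp
  have dv: "dv i * ?d = ?d * (?A i 1 1 + ?A i 2 2) - (frm P i z $ 1 * ?d' 1 + frm P i z $ 2 * ?d' 2)" for i
    unfolding dv_def fd using d0 by (simp only: field_simps) (simp add: algebra_simps)
  have "dv 1 * ?d = conn 2 z * ?d"
    unfolding dv unfolding frm_det_def by (rule div_frame_real(1)[OF 1 2])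
  then show "dv 1 = conn 2 z" using d0 by simp
  have "dv 2 * ?d = - conn 1 z * ?d"
    unfolding dv unfolding frm_det_def by (rule div_frame_real(2)[OF 1 2])
  then show "dv 2 = - conn 1 z" using d0 mult_right_cancel[of "frm_det z" "dv 2" "- conn 1 z"] by blast
qed

text \<open>Leibniz's rule splits the divergence of W_i \<otimes> f_i into the covariant derivative
  of W_i along f_i and W_i times the divergence of f_i. The coordinate density is thereby gone from
  all later computations.\<close>

lemma D_g_star_frame:
  assumes z: "z \<in> U" and W: "smooth_on U W1" "smooth_on U W2"
    and T: "\<And>w a. w \<in> U \<Longrightarrow> T w $ a = frm P 1 w $ a *\<^sub>R W1 w + frm P 2 w $ a *\<^sub>R W2 w"
  shows "D_g_star P T z =
    - (cov P (frm P 1 z) W1 z + cov P (frm P 2 z) W2 z + conn 2 z *\<^sub>R W1 z - conn 1 z *\<^sub>R W2 z)"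
proof -
  let ?g = "\<lambda>i a w. frm P i w $ a * inverse (frm_det w)"
  let ?dg = "\<lambda>i a. frechet_derivative (?g i a) (at z) (axis a 1)"
  have g: "smooth_on U (?g i a)" for i a
    using frm_det_pos
    by (intro smooth_on_mult smooth_on_nth smooth_frm smooth_on_inverse smooth_frm_det open_U) force
  have cov: "cov P (axis a 1) (\<lambda>w. sqrt (det (pullback_metric P w)) *\<^sub>R T w $ a) z =
      ?dg 1 a *\<^sub>R W1 z + ?g 1 a z *\<^sub>R cov P (axis a 1) W1 z
      + (?dg 2 a *\<^sub>R W2 z + ?g 2 a z *\<^sub>R cov P (axis a 1) W2 z)" for a
  proof -
    have "cov P (axis a 1) (\<lambda>w. sqrt (det (pullback_metric P w)) *\<^sub>R T w $ a) z =
        cov P (axis a 1) (\<lambda>w. ?g 1 a w *\<^sub>R W1 w + ?g 2 a w *\<^sub>R W2 w) z"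
      by (rule cov_cong[OF z, symmetric])
         (simp add: T frm_det_sqrt algebra_simps, intro smooth_on_add smooth_on_scaleR g W open_U)
    then show ?thesis
      using g W by (simp add: cov_add[OF z] cov_scaleR[OF z] smooth_on_scaleR open_U)
  qed
  have lin: "cov P (frm P i z) W z = frm P i z $ 1 *\<^sub>R cov P (axis 1 1) W z + frm P i z $ 2 *\<^sub>R cov P (axis 2 1) W z"
    if "smooth_on U W" for W i
    by (rule linear_axis_2[OF linear_cov[OF z that]])
  have cancel: "frm_det z * (inverse (frm_det z) * x) = x" for x
    using frm_det_pos[OF z] by (simp add: mult.assoc[symmetric])
  have "D_g_star P T z = - ((frm_det z * (?dg 1 1 + ?dg 1 2)) *\<^sub>R W1 z + cov P (frm P 1 z) W1 z
      + ((frm_det z * (?dg 2 1 + ?dg 2 2)) *\<^sub>R W2 z + cov P (frm P 2 z) W2 z))"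
    unfolding D_g_star_def sum_2 cov frm_det_sqrt[OF z] lin[OF W(1)] lin[OF W(2)]
    by (simp add: algebra_simps divide_inverse cancel)
  also have "\<dots> = - (conn 2 z *\<^sub>R W1 z + cov P (frm P 1 z) W1 z + ((- conn 1 z) *\<^sub>R W2 z + cov P (frm P 2 z) W2 z))"
    unfolding divergence_frame[OF z] ..
  finally show ?thesis by (simp add: algebra_simps)
qed

subsection \<open>The Gauss map\<close>

abbreviation gram :: "real ^ 2 \<Rightarrow> real ^ 'm ^ 'm" where
  "gram z \<equiv> met P (imm P z)"

definition vol_coeff :: "real ^ 2 \<Rightarrow> real" where
  "vol_coeff z = 1 / sqrt (det (gram z))"

lemma obtain_pos_onb:
  assumes "z \<in> U"
  obtains E where "pos_onb (gram z) E" "det E = vol_coeff z"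
  using pos_onb_exists[OF sym_h[OF imm_in[OF assms]] pos_h[OF imm_in[OF assms]]] pos_onb_det(2)
  unfolding vol_coeff_def by blast

lemma gauss_map_eq:
  "z \<in> U \<Longrightarrow> gauss_map P z = (\<lambda>K. vol_coeff z * eps2 (gram z *v e_vec P 1 z) (gram z *v e_vec P 2 z) K)"
  unfolding gauss_map_def star_h_def by (metis obtain_pos_onb hodge_bivector dim_ge_2)

definition Gam_matrix :: "real ^ 2 \<Rightarrow> real ^ 2 \<Rightarrow> real ^ 'm ^ 'm" where
  "Gam_matrix z v = (\<chi> l k. Gam (met P) (imm P z) (push P z v) (axis k 1) $ l)"

lemma derivative_gram:
  assumes z: "z \<in> U"
  shows "frechet_derivative (met P) (at (imm P z)) (push P z v) =
    transpose (Gam_matrix z v) ** gram z + gram z ** Gam_matrix z v"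
proof -
  let ?D = "frechet_derivative (met P) (at (imm P z)) (push P z v)"
  have "?D $ i $ j = (transpose (Gam_matrix z v) ** gram z + gram z ** Gam_matrix z v) $ i $ j" for i j
  proof -
    have "?D $ i $ j = ip ?D (axis i 1) (axis j 1)" by (simp add: ip_axis)
    also have "\<dots> = ip (gram z) (Gam (met P) (imm P z) (push P z v) (axis i 1)) (axis j 1)
        + ip (gram z) (axis i 1) (Gam (met P) (imm P z) (push P z v) (axis j 1))"
      by (rule metric_compatible[OF imm_in[OF z]])
    finally show ?thesis
      unfolding ip_axis_right ip_axis_left by (simp add: matrix_matrix_mult_def transpose_def Gam_matrix_def)
  qed
  then show ?thesis by (simp add: vec_eq_iff)
qed

text \<open>Since \<open>vol_coeff\<close> is the coefficient of the volume form, this says that the volume form is parallel.\<close>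

lemma vol_coeff_has_derivative:
  assumes z: "z \<in> U"
  shows "(vol_coeff has_derivative (\<lambda>v. - vol_coeff z * trace (Gam_matrix z v))) (at z)"
proof -
  have pos: "det (gram z) > 0" by (rule det_h[OF imm_in[OF z]])
  then have inv: "invertible (gram z)" by (simp add: invertible_det_nz)
  have m: "((\<lambda>w. gram w) has_derivative (\<lambda>v. frechet_derivative (met P) (at (imm P z)) (push P z v))) (at z)"
    unfolding push_def
    by (rule has_derivative_compose[OF smooth_on_has_derivative[OF smooth_imm z]
          smooth_on_has_derivative[OF smooth_h imm_in[OF z]]])
  have tr: "trace (matrix_inv (gram z) ** (transpose B ** gram z + gram z ** B)) = 2 * trace B" for B
  proof -
    have "trace (matrix_inv (gram z) ** (transpose B ** gram z)) = trace (transpose B ** (gram z ** matrix_inv (gram z)))"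
      by (metis matrix_mul_assoc trace_mul_sym)
    also have "\<dots> = trace B" by (simp add: invertible_matrix_inv(1)[OF inv] trace_def transpose_def)
    moreover have "matrix_inv (gram z) ** (gram z ** B) = B"
      by (simp add: matrix_mul_assoc invertible_matrix_inv(2)[OF inv])
    ultimately show ?thesis by (simp add: matrix_add_ldistrib trace_add)
  qed
  have "((\<lambda>w. det (gram w)) has_derivative (\<lambda>v. det (gram z) * (2 * trace (Gam_matrix z v)))) (at z)"
    using det_derivative[OF m inv] by (simp add: derivative_gram[OF z] tr)
  moreover have "((\<lambda>x. 1 / sqrt x) has_derivative (\<lambda>r. - 1 / (2 * det (gram z) * sqrt (det (gram z))) * r)) (at (det (gram z)))"
    unfolding has_field_derivative_def[symmetric]
    using pos by (auto intro!: derivative_eq_intros simp: field_simps)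
  ultimately have "((\<lambda>w. 1 / sqrt (det (gram w))) has_derivative
      (\<lambda>v. - 1 / (2 * det (gram z) * sqrt (det (gram z))) * (det (gram z) * (2 * trace (Gam_matrix z v))))) (at z)"
    by (rule has_derivative_compose)
  then show ?thesis
    unfolding vol_coeff_def[abs_def]
    by (rule has_derivative_eq_rhs) (use pos in \<open>auto simp: fun_eq_iff\<close>)
qed

text \<open>A component of the lowered vector is its inner product with a constant coordinate
  vector, so \<open>cov_ip\<close> applies; the covariant derivative of that constant vector
  produces the transposed connection matrix.\<close>

lemma lowered_has_derivative:
  assumes z: "z \<in> U" and \<xi>: "smooth_on U \<xi>"
  shows "((\<lambda>w. (gram w *v \<xi> w) $ i) has_derivative
    (\<lambda>v. (transpose (Gam_matrix z v) *v (gram z *v \<xi> z)) $ i + (gram z *v cov P v \<xi> z) $ i)) (at z)"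
proof -
  have eq: "(\<lambda>w. (gram w *v \<xi> w) $ i) = (\<lambda>w. ip_M P w (axis i 1) (\<xi> w))"
    by (simp add: ip_M_def ip_def inner_axis')
  have c: "smooth_on U (\<lambda>w. axis i 1 :: real ^ 'm)" by (rule smooth_on_const[OF open_U])
  have "(\<lambda>w. (gram w *v \<xi> w) $ i) differentiable (at z)"
    unfolding eq by (rule smooth_on_differentiable[OF smooth_ip_M[OF c \<xi>] z])
  moreover have "frechet_derivative (\<lambda>w. (gram w *v \<xi> w) $ i) (at z) =
    (\<lambda>v. (transpose (Gam_matrix z v) *v (gram z *v \<xi> z)) $ i + (gram z *v cov P v \<xi> z) $ i)"
  proof
    fix v
    have "ip_M P z (cov P v (\<lambda>w. axis i 1) z) (\<xi> z) = (transpose (Gam_matrix z v) *v (gram z *v \<xi> z)) $ i"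
      by (simp add: cov_def ip_M_def ip_def inner_vec_def matrix_vector_mult_def transpose_def Gam_matrix_def)
    then show "frechet_derivative (\<lambda>w. (gram w *v \<xi> w) $ i) (at z) v =
      (transpose (Gam_matrix z v) *v (gram z *v \<xi> z)) $ i + (gram z *v cov P v \<xi> z) $ i"
      unfolding eq cov_ip[OF z c \<xi>] by (simp add: ip_M_def ip_def inner_axis')
  qed
  ultimately show ?thesis unfolding frechet_derivative_works by (simp only:)
qed

text \<open>Connection terms arise in three places: a trace from the volume coefficient, transposes
  from lowering the frame vectors, and the index terms of \<open>cov_mv\<close>. By
  \<open>eps2_trace\<close> they cancel completely, so the Hodge operator commutes with the
  covariant derivative here.\<close>

lemma cov_mv_gauss_map:
  assumes z: "z \<in> U"
  shows "cov_mv P v (gauss_map P) z = (\<lambda>I. vol_coeff z *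
    (eps2 (gram z *v cov P v (e_vec P 1) z) (gram z *v e_vec P 2 z) I
     + eps2 (gram z *v e_vec P 1 z) (gram z *v cov P v (e_vec P 2) z) I))"
proof
  fix I
  let ?B = "Gam_matrix z v" and ?\<kappa> = "vol_coeff z"
  let ?p = "gram z *v e_vec P 1 z" and ?q = "gram z *v e_vec P 2 z"
  let ?p' = "transpose ?B *v ?p + gram z *v cov P v (e_vec P 1) z"
  let ?q' = "transpose ?B *v ?q + gram z *v cov P v (e_vec P 2) z"
  have D: "((\<lambda>w. vol_coeff w * (\<Sum>i\<in>UNIV. \<Sum>j\<in>UNIV.
      (gram w *v e_vec P 1 w) $ i * (gram w *v e_vec P 2 w) $ j * eps (coord_order P) (i # j # I))) has_derivative
    (\<lambda>v. vol_coeff z * (\<Sum>i\<in>UNIV. \<Sum>j\<in>UNIV.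
      (?p $ i * ((transpose (Gam_matrix z v) *v ?q) $ j + (gram z *v cov P v (e_vec P 2) z) $ j)
      + ((transpose (Gam_matrix z v) *v ?p) $ i + (gram z *v cov P v (e_vec P 1) z) $ i) * ?q $ j)
        * eps (coord_order P) (i # j # I))
      + (- vol_coeff z * trace (Gam_matrix z v)) * (\<Sum>i\<in>UNIV. \<Sum>j\<in>UNIV.
         ?p $ i * ?q $ j * eps (coord_order P) (i # j # I)))) (at z)"
    by (intro has_derivative_mult[OF vol_coeff_has_derivative[OF z]] has_derivative_sum has_derivative_mult_left
        has_derivative_mult lowered_has_derivative[OF z smooth_e])
  from frechet_derivativeI[OF D]
  have "frechet_derivative (\<lambda>w. vol_coeff w * eps2 (gram w *v e_vec P 1 w) (gram w *v e_vec P 2 w) I) (at z) v =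
      ?\<kappa> * (eps2 ?p ?q' I + eps2 ?p' ?q I) - ?\<kappa> * trace ?B * eps2 ?p ?q I"
    by (simp add: eps2_def distrib_right sum.distrib)
  moreover have "frechet_derivative (\<lambda>w. vol_coeff w * eps2 (gram w *v e_vec P 1 w) (gram w *v e_vec P 2 w) I) (at z) =
      frechet_derivative (\<lambda>w. gauss_map P w I) (at z)"
  proof (rule frechet_derivative_transform_within_open[OF _ open_U z])
    show "(\<lambda>w. vol_coeff w * eps2 (gram w *v e_vec P 1 w) (gram w *v e_vec P 2 w) I) differentiable (at z)"
      unfolding eps2_def differentiable_def using D by blast
  qed (simp add: gauss_map_eq)
  moreover have "(\<Sum>r<length I. \<Sum>k\<in>UNIV.
        Gam (met P) (imm P z) (push P z v) (axis k 1) $ (I ! r) * gauss_map P z (I[r := k])) =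
      ?\<kappa> * (trace ?B * eps2 ?p ?q I - eps2 (transpose ?B *v ?p) ?q I - eps2 ?p (transpose ?B *v ?q) I)"
    unfolding eps2_trace[OF dim_ge_2, symmetric]
    by (simp add: gauss_map_eq[OF z] Gam_matrix_def sum_distrib_left mult_ac)
  ultimately show "cov_mv P v (gauss_map P) z I = ?\<kappa> *
    (eps2 (gram z *v cov P v (e_vec P 1) z) ?q I + eps2 ?p (gram z *v cov P v (e_vec P 2) z) I)"
    by (simp add: cov_mv_def eps2_add_left eps2_add_right algebra_simps)
qed

subsection \<open>The Hodge term of the divergence form\<close>

lemma star_g_eq:
  assumes z: "z \<in> U"
  shows "star_g P z v $ 1 = - frm_det z * (pullback_metric P z *v v) $ 2"
    and "star_g P z v $ 2 = frm_det z * (pullback_metric P z *v v) $ 1"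
proof -
  interpret o2: coordinate_order "[1, 2] :: 2 list" by unfold_locales (auto simp: UNIV_2)
  have e: "eps [1, 2] [1, 2 :: 2] = 1" "eps [1, 2] [2, 1 :: 2] = -1" "eps [1, 2] [i, i :: 2] = 0" for i :: 2
    using o2.eps_self alternatingD[OF o2.eps_alternating, of "[]" 2 1 "[]"]
      alternating_not_distinct[OF o2.eps_alternating, of "[i, i]"] by simp_all
  have "star_g P z v $ k = frm_det z * o2.eps1 (pullback_metric P z *v v) [k]" for k
    unfolding star_g_def o2.hodge_vector[OF pos_onb_frm[OF z]] by (simp add: to_vec_def det_frm)
  then show "star_g P z v $ 1 = - frm_det z * (pullback_metric P z *v v) $ 2"
    "star_g P z v $ 2 = frm_det z * (pullback_metric P z *v v) $ 1"
    by (simp_all add: o2.eps1_def sum_2 e)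
qed

lemma linear_star_g: "z \<in> U \<Longrightarrow> linear (star_g P z)"
  by (rule linearI)
     (simp_all add: vec_eq_iff forall_2 star_g_eq matrix_vector_right_distrib matrix_vector_mult_scaleR algebra_simps)

text \<open>Orthonormality is a linear system for the lowered frame vectors whose determinant is
  \<open>frm_det\<close>; solving it turns \<open>star_g_eq\<close> into the rotation of the
  frame.\<close>

lemma star_g_frm:
  assumes z: "z \<in> U"
  shows "star_g P z (frm P 1 z) = frm P 2 z" "star_g P z (frm P 2 z) = - frm P 1 z"
proof -
  have i: "frm P i z $ 1 * (pullback_metric P z *v frm P j z) $ 1 + frm P i z $ 2 * (pullback_metric P z *v frm P j z) $ 2
      = (if i = j then 1 else 0)" for i j
    using ip_frm[OF z, of i j] by (simp add: ip_def inner_vec_def sum_2)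
  show "star_g P z (frm P 1 z) = frm P 2 z"
    using i[of 1 1] i[of 2 1] by (simp add: vec_eq_iff forall_2 star_g_eq[OF z] frm_det_def) algebra
  show "star_g P z (frm P 2 z) = - frm P 1 z"
    using i[of 1 2] i[of 2 2] by (simp add: vec_eq_iff forall_2 star_g_eq[OF z] frm_det_def) algebra
qed

lemma star_g_tensor_eq:
  assumes z: "z \<in> U"
  shows "star_g_tensor P z (D_g_mv P \<xi> z) $ b =
    (\<lambda>I. frm P 2 z $ b * cov_mv P (frm P 1 z) \<xi> z I - frm P 1 z $ b * cov_mv P (frm P 2 z) \<xi> z I)"
proof
  fix I
  have s: "frm P i z $ 1 * star_g P z (axis 1 1) $ b + frm P i z $ 2 * star_g P z (axis 2 1) $ b = star_g P z (frm P i z) $ b" for i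
    using linear_axis_2[OF linear_star_g[OF z], of "frm P i z"] by simp
  have "(star_g_tensor P z (D_g_mv P \<xi> z) $ b) I =
      (frm P 1 z $ 1 * star_g P z (axis 1 1) $ b + frm P 1 z $ 2 * star_g P z (axis 2 1) $ b) * cov_mv P (frm P 1 z) \<xi> z I
      + (frm P 2 z $ 1 * star_g P z (axis 1 1) $ b + frm P 2 z $ 2 * star_g P z (axis 2 1) $ b) * cov_mv P (frm P 2 z) \<xi> z I"
    by (simp add: star_g_tensor_def D_g_mv_def sum_2 algebra_simps)
  then show "(star_g_tensor P z (D_g_mv P \<xi> z) $ b) I =
      frm P 2 z $ b * cov_mv P (frm P 1 z) \<xi> z I - frm P 1 z $ b * cov_mv P (frm P 2 z) \<xi> z I"
    by (simp add: s star_g_frm[OF z])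
qed

text \<open>\<open>S i\<close> is the interior product of \<open>X\<close> with the covariant
  derivative of e1 \<and> e2 in the direction f_i. Moving \<open>X\<close> past the dual bivector
  costs (-1)^m and the double dual (-1)^(m-1); their product -1 cancels the minus sign in front of
  \<open>S i\<close>.\<close>

lemma star_h_tensor_eq:
  fixes X :: "real ^ 'm"
  assumes z: "z \<in> U"
  defines "S \<equiv> \<lambda>i. ip_M P z X (cov P (frm P i z) (e_vec P 1) z) *\<^sub>R e_vec P 2 z
      - ip_M P z X (e_vec P 2 z) *\<^sub>R cov P (frm P i z) (e_vec P 1) z
      + ip_M P z X (e_vec P 1 z) *\<^sub>R cov P (frm P i z) (e_vec P 2) z
      - ip_M P z X (cov P (frm P i z) (e_vec P 2) z) *\<^sub>R e_vec P 1 z"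
  shows "star_h_tensor P z (wedge_M (star_g_tensor P z (D_g_mv P (gauss_map P) z)) (of_vec X)) $ b =
    frm P 2 z $ b *\<^sub>R S 1 - frm P 1 z $ b *\<^sub>R S 2"
proof -
  let ?G = "gram z" and ?m = "CARD('m)"
  note linear = eps1_scaleR eps1_diff eps1_add eps1_minus matrix_vector_mult_scaleR
    matrix_vector_mult_diff_distrib matrix_vector_right_distrib vec.neg algebra_simps
  obtain E where E: "pos_onb ?G E" "det E = vol_coeff z" using obtain_pos_onb[OF z] .
  have D: "wedge (cov_mv P (frm P i z) (gauss_map P) z) (of_vec X) K =
      det E * eps1 (?G *v ((-1) ^ ?m *\<^sub>R - S i)) K" for i K
  proof -
    let ?e1 = "e_vec P 1 z" and ?e2 = "e_vec P 2 z"
    let ?d1 = "cov P (frm P i z) (e_vec P 1) z" and ?d2 = "cov P (frm P i z) (e_vec P 2) z"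
    have "wedge (cov_mv P (frm P i z) (gauss_map P) z) (of_vec X) K =
        wedge (\<lambda>I. det E * eps2 (?G *v ?d1) (?G *v ?e2) I) (of_vec X) K
        + wedge (\<lambda>I. det E * eps2 (?G *v ?e1) (?G *v ?d2) I) (of_vec X) K"
      unfolding cov_mv_gauss_map[OF z] E(2) distrib_left wedge_add_left ..
    also have "\<dots> = det E * eps1 (?G *v ((-1) ^ ?m *\<^sub>R - S i)) K"
      unfolding wedge_dual_bivector[OF dim_ge_2]
      by (simp add: S_def ip_M_def linear)
    finally show ?thesis .
  qed
  define W where "W = frm P 2 z $ b *\<^sub>R S 1 - frm P 1 z $ b *\<^sub>R S 2"
  have "wedge_M (star_g_tensor P z (D_g_mv P (gauss_map P) z)) (of_vec X) $ b =
      (\<lambda>K. det E * eps1 (?G *v ((-1) ^ ?m *\<^sub>R - W)) K)"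
  proof
    fix K
    have "(wedge_M (star_g_tensor P z (D_g_mv P (gauss_map P) z)) (of_vec X) $ b) K =
        frm P 2 z $ b * (det E * eps1 (?G *v ((-1) ^ ?m *\<^sub>R - S 1)) K)
        + (- frm P 1 z $ b) * (det E * eps1 (?G *v ((-1) ^ ?m *\<^sub>R - S 2)) K)"
      unfolding D[symmetric] wedge_scale_left[symmetric] wedge_add_left[symmetric]
      by (simp add: wedge_M_def star_g_tensor_eq[OF z])
    also have "\<dots> = det E * eps1 (?G *v ((-1) ^ ?m *\<^sub>R - W)) K"
      by (simp add: W_def linear)
    finally show "(wedge_M (star_g_tensor P z (D_g_mv P (gauss_map P) z)) (of_vec X) $ b) K =
        det E * eps1 (?G *v ((-1) ^ ?m *\<^sub>R - W)) K" .
  qed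
  then have "star_h_tensor P z (wedge_M (star_g_tensor P z (D_g_mv P (gauss_map P) z)) (of_vec X)) $ b =
      to_vec (\<lambda>K. (-1) ^ (?m - 1) * of_vec ((-1) ^ ?m *\<^sub>R - W) K)"
    using hodge_codim_one[OF E(1) sym_h[OF imm_in[OF z]]] by (simp add: star_h_tensor_def star_h_def)
  also have "\<dots> = W"
  proof -
    obtain n where n: "?m = Suc n" using dim_ge_2 by (cases ?m) auto
    have "(-1 :: real) ^ n * (-1) ^ n = 1" by (simp add: power_add[symmetric])
    then show ?thesis by (simp add: to_vec_def vec_eq_iff n mult.assoc[symmetric])
  qed
  finally show ?thesis by (simp add: W_def)
qed

subsection \<open>The divergence form of the Willmore operator\<close>

lemma mean_curv_eq: "mean_curv P z = (1/2) *\<^sub>R (sff 1 1 z + sff 2 2 z)"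
  by (simp add: mean_curv_def sff_def)

lemma smooth_mean_curv: "smooth_on U (mean_curv P)"
  unfolding mean_curv_eq[abs_def] by (intro smooth_on_scaleR smooth_on_const smooth_on_add smooth_sff open_U)

lemma ip_mean_curv: "z \<in> U \<Longrightarrow> ip_M P z (mean_curv P z) (e_vec P i z) = 0"
  by (simp add: mean_curv_eq ip_M_simps ip_sff)

section \<open>Components of the derivative of the mean curvature\<close>

definition nH :: "2 \<Rightarrow> real ^ 2 \<Rightarrow> real ^ 'm" where
  "nH i z = pi_n P z (cov P (frm P i z) (mean_curv P) z)"

definition hh :: "2 \<Rightarrow> 2 \<Rightarrow> real ^ 2 \<Rightarrow> real" where
  "hh i j z = ip_M P z (mean_curv P z) (sff i j z)"

lemma smooth_nH: "smooth_on U (nH i)"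
  unfolding nH_def[abs_def] by (intro smooth_pi_n smooth_cov smooth_frm smooth_mean_curv)

lemma smooth_hh: "smooth_on U (hh i j)"
  unfolding hh_def[abs_def] by (intro smooth_ip_M smooth_mean_curv smooth_sff)

lemma ip_nH: "z \<in> U \<Longrightarrow> ip_M P z (nH i z) (e_vec P k z) = 0"
  by (simp add: nH_def ip_pi_n)

lemma hh_sym: "z \<in> U \<Longrightarrow> hh 2 1 z = hh 1 2 z"
  by (simp add: hh_def sff_sym)

lemma derivative_hh_sym:
  assumes "z \<in> U"
  shows "frechet_derivative (hh 2 1) (at z) = frechet_derivative (hh 1 2) (at z)"
  by (rule frechet_derivative_transform_within_open[OF smooth_on_differentiable[OF smooth_hh assms] open_U assms])
     (rule hh_sym)

lemma ip_mean_curv_cov_e: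
  assumes "z \<in> U"
  shows "ip_M P z (mean_curv P z) (cov P (frm P i z) (e_vec P j) z) = hh i j z"
  using exhaust_2[of j] by (auto simp: cov_e[OF assms] ip_M_simps ip_mean_curv[OF assms] hh_def)

text \<open>Weingarten's relation, from differentiating the orthogonality of H to the frame.\<close>

lemma ip_cov_mean_curv:
  assumes z: "z \<in> U"
  shows "ip_M P z (cov P (frm P i z) (mean_curv P) z) (e_vec P j z) = - hh i j z"
  using cov_ip[OF z smooth_mean_curv smooth_e[of j], of "frm P i z"] ip_mean_curv_cov_e[OF z, of i j]
    derivative_const_on[OF z, of "\<lambda>w. ip_M P w (mean_curv P w) (e_vec P j w)" 0 "frm P i z"] ip_mean_curv
  by simp

lemma cov_mean_curv:
  assumes z: "z \<in> U"
  shows "cov P (frm P i z) (mean_curv P) z = nH i z - hh i 1 z *\<^sub>R e_vec P 1 z - hh i 2 z *\<^sub>R e_vec P 2 z"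
  unfolding nH_def pi_n_eq[OF z] ip_cov_mean_curv[OF z] by simp

text \<open>Obtained by differentiating Weingarten's relation along the disc. This is where
  derivatives of \<open>hh\<close> enter the curvature term.\<close>

lemma ip_cov_cov_mean_curv:
  assumes z: "z \<in> U"
  shows "ip_M P z (cov P v (\<lambda>w. cov P (frm P j w) (mean_curv P) w) z) (e_vec P k z) =
    - frechet_derivative (hh j k) (at z) v
    - ip_M P z (cov P (frm P j z) (mean_curv P) z) (cov P v (e_vec P k) z)"
proof -
  let ?F = "\<lambda>w. ip_M P w (cov P (frm P j w) (mean_curv P) w) (e_vec P k w)"
  have s: "smooth_on U (\<lambda>w. cov P (frm P j w) (mean_curv P) w)"
    by (intro smooth_cov smooth_frm smooth_mean_curv)
  have "frechet_derivative (\<lambda>w. - hh j k w) (at z) = frechet_derivative ?F (at z)"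
    by (rule frechet_derivative_transform_within_open[OF _ open_U z])
       (auto simp: ip_cov_mean_curv intro!: smooth_on_differentiable[OF _ z] smooth_on_minus smooth_hh open_U)
  moreover have "frechet_derivative (\<lambda>w. - hh j k w) (at z) = (\<lambda>v. - frechet_derivative (hh j k) (at z) v)"
    by (rule frechet_derivativeI[OF has_derivative_minus[OF smooth_on_has_derivative[OF smooth_hh z]]])
  ultimately have "- frechet_derivative (hh j k) (at z) v = frechet_derivative ?F (at z) v" by metis
  then show ?thesis using cov_ip[OF z s smooth_e[of k], of v] by simp
qed

lemma ip_cov_nH:
  assumes z: "z \<in> U"
  shows "ip_M P z (cov P (frm P i z) (nH i) z) (e_vec P k z) = - ip_M P z (nH i z) (sff i k z)"
proof -
  have "ip_M P z (nH i z) (cov P (frm P i z) (e_vec P k) z) = ip_M P z (nH i z) (sff i k z)"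
    using exhaust_2[of k] by (auto simp: cov_e[OF z] ip_M_simps ip_nH[OF z])
  then show ?thesis
    using cov_ip[OF z smooth_nH[of i] smooth_e[of k], of "frm P i z"]
      derivative_const_on[OF z, of "\<lambda>w. ip_M P w (nH i w) (e_vec P k w)" 0 "frm P i z"] ip_nH
    by simp
qed

lemma hh_trace: "z \<in> U \<Longrightarrow> hh 1 1 z + hh 2 2 z = 2 * ip_M P z (mean_curv P z) (mean_curv P z)"
proof -
  have "2 * ip_M P z (mean_curv P z) (mean_curv P z) =
      2 * ip_M P z (mean_curv P z) ((1/2) *\<^sub>R (sff 1 1 z + sff 2 2 z))"
    by (simp only: mean_curv_eq[symmetric])
  then show ?thesis by (simp add: hh_def ip_M_simps)
qed

text \<open>The trace of \<open>hh\<close> is 2 |H|^2, so its derivative is 4 <N_i, H>; writing H as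
  half the trace of the second fundamental form gives the right side. This relation closes the
  comparison of the tangential components.\<close>

lemma derivative_hh_trace:
  assumes z: "z \<in> U"
  shows "frechet_derivative (hh 1 1) (at z) (frm P i z) + frechet_derivative (hh 2 2) (at z) (frm P i z) =
    2 * (ip_M P z (nH i z) (sff 1 1 z) + ip_M P z (nH i z) (sff 2 2 z))"
proof -
  let ?H = "mean_curv P" and ?v = "frm P i z"
  let ?q = "\<lambda>w. ip_M P w (?H w) (?H w)"
  have q: "smooth_on U ?q" by (intro smooth_ip_M smooth_mean_curv)
  have eq: "frechet_derivative (\<lambda>w. hh 1 1 w + hh 2 2 w) (at z) = frechet_derivative (\<lambda>w. 2 * ?q w) (at z)"
    by (rule frechet_derivative_transform_within_open[OF _ open_U z])
       (auto simp: hh_trace intro!: smooth_on_differentiable[OF _ z] smooth_on_add smooth_hh open_U)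
  have sum: "frechet_derivative (\<lambda>w. hh 1 1 w + hh 2 2 w) (at z) =
      (\<lambda>v. frechet_derivative (hh 1 1) (at z) v + frechet_derivative (hh 2 2) (at z) v)"
    by (intro frechet_derivativeI has_derivative_add smooth_on_has_derivative[OF smooth_hh z])
  have double: "frechet_derivative (\<lambda>w. 2 * ?q w) (at z) = (\<lambda>v. 2 * frechet_derivative ?q (at z) v)"
    by (intro frechet_derivativeI has_derivative_mult_right smooth_on_has_derivative[OF q z])
  have "frechet_derivative (hh 1 1) (at z) ?v + frechet_derivative (hh 2 2) (at z) ?v =
      2 * frechet_derivative ?q (at z) ?v"
    using fun_cong[OF eq, of ?v] by (simp only: sum double)
  also have "frechet_derivative ?q (at z) ?v = 2 * ip_M P z (cov P ?v ?H z) (?H z)"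
    using cov_ip[OF z smooth_mean_curv smooth_mean_curv, of ?v] ip_M_commute[OF z, of "?H z" "cov P ?v ?H z"] by simp
  also have "ip_M P z (cov P ?v ?H z) (?H z) = ip_M P z (nH i z) (?H z)"
    using ip_mean_curv[OF z] ip_M_commute[OF z, of _ "?H z"]
    by (simp add: cov_mean_curv[OF z] ip_M_simps)
  also have "\<dots> = (ip_M P z (nH i z) (sff 1 1 z) + ip_M P z (nH i z) (sff 2 2 z)) / 2"
    by (simp add: mean_curv_eq ip_M_simps)
  finally show ?thesis by simp
qed

lemma D_g_frame: "D_g P \<xi> z $ a = frm P 1 z $ a *\<^sub>R cov P (frm P 1 z) \<xi> z + frm P 2 z $ a *\<^sub>R cov P (frm P 2 z) \<xi> z"
  by (simp add: D_g_def sum_2)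

lemma pi_n_tensor_frame:
  assumes "z \<in> U"
  shows "pi_n_tensor P z (D_g P (mean_curv P) z) $ a = frm P 1 z $ a *\<^sub>R nH 1 z + frm P 2 z $ a *\<^sub>R nH 2 z"
  by (simp add: pi_n_tensor_def D_g_frame nH_def linear_add[OF linear_pi_n[OF assms]] linear_scale[OF linear_pi_n[OF assms]])

text \<open>The bracket of the divergence form is \<open>W\<^sub>1 \<otimes> f\<^sub>1 + W\<^sub>2 \<otimes> f\<^sub>2\<close> with the following \<open>W\<^sub>i\<close>; its tangential
  part is trace free.\<close>

definition W1 :: "real ^ 2 \<Rightarrow> real ^ 'm" where
  "W1 z = (- 2) *\<^sub>R nH 1 z + ((hh 2 2 z - hh 1 1 z) *\<^sub>R e_vec P 1 z + (- 2 * hh 1 2 z) *\<^sub>R e_vec P 2 z)"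

definition W2 :: "real ^ 2 \<Rightarrow> real ^ 'm" where
  "W2 z = (- 2) *\<^sub>R nH 2 z + ((- 2 * hh 1 2 z) *\<^sub>R e_vec P 1 z + (hh 1 1 z - hh 2 2 z) *\<^sub>R e_vec P 2 z)"

lemma smooth_W: "smooth_on U W1" "smooth_on U W2"
  unfolding W1_def[abs_def] W2_def[abs_def]
  by (intro smooth_on_add smooth_on_scaleR smooth_on_diff smooth_on_mult smooth_on_const smooth_hh smooth_nH
      smooth_e open_U)+

text \<open>Substituting D_i H for its normal and tangential parts: the normal coefficient is 1 - 3
  = -2, and the Hodge term adds the adjugate of \<open>hh\<close> to minus \<open>hh\<close>,
  doubling the off-diagonal entries and leaving differences on the diagonal.\<close>

lemma bracket_frame:
  assumes z: "z \<in> U"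
  shows "(D_g P (mean_curv P) z - 3 *\<^sub>R pi_n_tensor P z (D_g P (mean_curv P) z)
     + star_h_tensor P z (wedge_M (star_g_tensor P z (D_g_mv P (gauss_map P) z)) (of_vec (mean_curv P z)))) $ a
     = frm P 1 z $ a *\<^sub>R W1 z + frm P 2 z $ a *\<^sub>R W2 z"
  unfolding vector_add_component vector_minus_component vector_scaleR_component
    star_h_tensor_eq[OF z] pi_n_tensor_frame[OF z] D_g_frame
    ip_mean_curv_cov_e[OF z] ip_mean_curv[OF z] cov_mean_curv[OF z] hh_sym[OF z] W1_def W2_def
  by (simp add: algebra_simps scaleR_2[symmetric])
     (simp add: vec_eq_iff algebra_simps)

lemma cov_W:
  assumes z: "z \<in> U"
  defines "d \<equiv> \<lambda>i j k. frechet_derivative (hh j k) (at z) (frm P i z)"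
  shows "cov P (frm P 1 z) W1 z = (- 2) *\<^sub>R cov P (frm P 1 z) (nH 1) z
      + ((d 1 2 2 - d 1 1 1) *\<^sub>R e_vec P 1 z + (hh 2 2 z - hh 1 1 z) *\<^sub>R cov P (frm P 1 z) (e_vec P 1) z
      + (- 2 * d 1 1 2) *\<^sub>R e_vec P 2 z + (- 2 * hh 1 2 z) *\<^sub>R cov P (frm P 1 z) (e_vec P 2) z)"
    and "cov P (frm P 2 z) W2 z = (- 2) *\<^sub>R cov P (frm P 2 z) (nH 2) z
      + ((- 2 * d 2 1 2) *\<^sub>R e_vec P 1 z + (- 2 * hh 1 2 z) *\<^sub>R cov P (frm P 2 z) (e_vec P 1) z
      + (d 2 1 1 - d 2 2 2) *\<^sub>R e_vec P 2 z + (hh 1 1 z - hh 2 2 z) *\<^sub>R cov P (frm P 2 z) (e_vec P 2) z)"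
proof -
  note smooth = smooth_on_add smooth_on_scaleR smooth_on_diff smooth_on_mult smooth_on_const smooth_hh smooth_nH
    smooth_e open_U
  have diff: "frechet_derivative (\<lambda>w. hh i j w - hh k l w) (at z) v =
      frechet_derivative (hh i j) (at z) v - frechet_derivative (hh k l) (at z) v" for i j k l v
    by (subst frechet_derivativeI[OF has_derivative_diff[OF smooth_on_has_derivative[OF smooth_hh z]
          smooth_on_has_derivative[OF smooth_hh z]]]) simp
  have mult: "frechet_derivative (\<lambda>w. - 2 * hh i j w) (at z) v = - 2 * frechet_derivative (hh i j) (at z) v" for i j v
    by (subst frechet_derivativeI[OF has_derivative_mult_right[OF smooth_on_has_derivative[OF smooth_hh z]]]) simp
  have cov: "cov P v (\<lambda>w. (- 2) *\<^sub>R nH k w + (f w *\<^sub>R e_vec P 1 w + g w *\<^sub>R e_vec P 2 w)) z =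
      (- 2) *\<^sub>R cov P v (nH k) z + (frechet_derivative f (at z) v *\<^sub>R e_vec P 1 z + f z *\<^sub>R cov P v (e_vec P 1) z
      + frechet_derivative g (at z) v *\<^sub>R e_vec P 2 z + g z *\<^sub>R cov P v (e_vec P 2) z)"
    if "smooth_on U f" "smooth_on U g" for f g k v
  proof -
    have s: "smooth_on U (\<lambda>w. f w *\<^sub>R e_vec P 1 w)" "smooth_on U (\<lambda>w. g w *\<^sub>R e_vec P 2 w)"
      "smooth_on U (\<lambda>w. f w *\<^sub>R e_vec P 1 w + g w *\<^sub>R e_vec P 2 w)" "smooth_on U (\<lambda>w. (- 2) *\<^sub>R nH k w)"
      by (intro smooth that)+
    show ?thesis
      unfolding cov_add[OF z s(4,3)] cov_add[OF z s(1,2)] cov_scaleR[OF z smooth_on_const[OF open_U] smooth_nH]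
        cov_scaleR[OF z that(1) smooth_e] cov_scaleR[OF z that(2) smooth_e]
      by simp
  qed
  have s: "smooth_on U (\<lambda>w. hh i j w - hh k l w)" "smooth_on U (\<lambda>w. - 2 * hh i j w)" for i j k l
    by (intro smooth)+
  show "cov P (frm P 1 z) W1 z = (- 2) *\<^sub>R cov P (frm P 1 z) (nH 1) z
      + ((d 1 2 2 - d 1 1 1) *\<^sub>R e_vec P 1 z + (hh 2 2 z - hh 1 1 z) *\<^sub>R cov P (frm P 1 z) (e_vec P 1) z
      + (- 2 * d 1 1 2) *\<^sub>R e_vec P 2 z + (- 2 * hh 1 2 z) *\<^sub>R cov P (frm P 1 z) (e_vec P 2) z)"
    unfolding W1_def[abs_def] d_def cov[OF s] diff mult ..
  show "cov P (frm P 2 z) W2 z = (- 2) *\<^sub>R cov P (frm P 2 z) (nH 2) z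
      + ((- 2 * d 2 1 2) *\<^sub>R e_vec P 1 z + (- 2 * hh 1 2 z) *\<^sub>R cov P (frm P 2 z) (e_vec P 1) z
      + (d 2 1 1 - d 2 2 2) *\<^sub>R e_vec P 2 z + (hh 1 1 z - hh 2 2 z) *\<^sub>R cov P (frm P 2 z) (e_vec P 2) z)"
    unfolding W2_def[abs_def] d_def cov[OF s(2,1)] diff mult ..
qed

lemma willmore_divergence_form:
  assumes z: "z \<in> U"
  shows "(1/2) *\<^sub>R D_g_star P (\<lambda>w.
             D_g P (mean_curv P) w
             - 3 *\<^sub>R pi_n_tensor P w (D_g P (mean_curv P) w)
             + star_h_tensor P w
                 (wedge_M (star_g_tensor P w (D_g_mv P (gauss_map P) w)) (of_vec (mean_curv P w)))) z
         = Lap_perp P (mean_curv P) z + A_tilde P z (mean_curv P z)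
           - (2 * ip_M P z (mean_curv P z) (mean_curv P z)) *\<^sub>R mean_curv P z
           - R_perp P z"
proof -
  define d where "d = (\<lambda>i j k. frechet_derivative (hh j k) (at z) (frm P i z))"
  have d: "frechet_derivative (hh j k) (at z) (frm P i z) = d i j k" for i j k by (simp add: d_def)
  define n where "n = (\<lambda>i j k. ip_M P z (nH i z) (sff j k z))"
  define X where "X = cov P (frm P 1 z) (nH 1) z + cov P (frm P 2 z) (nH 2) z
    + conn 2 z *\<^sub>R nH 1 z - conn 1 z *\<^sub>R nH 2 z"
  define R where "R = Riem (met P) (imm P z) (e_vec P 1 z) (e_vec P 2 z) (mean_curv P z)"
  let ?e1 = "e_vec P 1 z" and ?e2 = "e_vec P 2 z" and ?o1 = "conn 1 z" and ?o2 = "conn 2 z"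
  let ?h11 = "hh 1 1 z" and ?h12 = "hh 1 2 z" and ?h22 = "hh 2 2 z"
  let ?s11 = "sff 1 1 z" and ?s12 = "sff 1 2 z" and ?s22 = "sff 2 2 z"
  have D: "D_g_star P (\<lambda>w. D_g P (mean_curv P) w
      - 3 *\<^sub>R pi_n_tensor P w (D_g P (mean_curv P) w)
      + star_h_tensor P w (wedge_M (star_g_tensor P w (D_g_mv P (gauss_map P) w)) (of_vec (mean_curv P w)))) z
    = - (cov P (frm P 1 z) W1 z + cov P (frm P 2 z) W2 z + ?o2 *\<^sub>R W1 z - ?o1 *\<^sub>R W2 z)"
    by (rule D_g_star_frame[OF z smooth_W bracket_frame])
  \<comment> \<open>The \<open>sff\<close> terms appear when the frame vectors in the tangential
    part of the bracket are differentiated by \<open>cov_e\<close>; their coefficients form the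
    trace-free part of \<open>hh\<close>.\<close>
  have lhs: "(1/2) *\<^sub>R D_g_star P (\<lambda>w. D_g P (mean_curv P) w
      - 3 *\<^sub>R pi_n_tensor P w (D_g P (mean_curv P) w)
      + star_h_tensor P w (wedge_M (star_g_tensor P w (D_g_mv P (gauss_map P) w)) (of_vec (mean_curv P w)))) z
    = X + ((?h11 - ?h22) / 2) *\<^sub>R ?s11 + (2 * ?h12) *\<^sub>R ?s12 + ((?h22 - ?h11) / 2) *\<^sub>R ?s22
      + ((d 1 1 1 - d 1 2 2) / 2 + d 2 1 2 - 2 * ?o1 * ?h12 + ?o2 * (?h11 - ?h22)) *\<^sub>R ?e1
      + (d 1 1 2 + (d 2 2 2 - d 2 1 1) / 2 + ?o1 * (?h11 - ?h22) + 2 * ?o2 * ?h12) *\<^sub>R ?e2"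
    unfolding D cov_W[OF z, unfolded d] cov_e[OF z] sff_sym[OF z, symmetric]
      W1_def W2_def X_def
    by (simp add: vec_eq_iff field_simps)
  \<comment> \<open>The projection removes the tangential part of \<open>X\<close>, which by
    \<open>ip_cov_nH\<close> consists of the products of \<open>nH\<close> with the second
    fundamental form; removing it adds the \<open>n\<close> terms.\<close>
  have lap: "Lap_perp P (mean_curv P) z = X + (n 1 1 1 + n 2 1 2) *\<^sub>R ?e1 + (n 1 1 2 + n 2 2 2) *\<^sub>R ?e2"
  proof -
    have "D_g_star P (\<lambda>w. pi_n_tensor P w (D_g P (mean_curv P) w)) z = - X"
      unfolding X_def by (rule D_g_star_frame[OF z smooth_nH smooth_nH pi_n_tensor_frame])
    then have "Lap_perp P (mean_curv P) z = pi_n P z X"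
      unfolding Lap_perp_def using linear_neg[OF linear_pi_n[OF z]] by simp
    moreover have "ip_M P z X ?e1 = - (n 1 1 1 + n 2 1 2)" "ip_M P z X ?e2 = - (n 1 1 2 + n 2 2 2)"
      by (simp_all add: X_def ip_M_simps ip_cov_nH[OF z] ip_nH[OF z] n_def sff_sym[OF z])
    ultimately show ?thesis by (simp add: pi_n_eq[OF z] scaleR_diff_left scaleR_add_left)
  qed
  have A: "A_tilde P z (mean_curv P z) = ?h11 *\<^sub>R ?s11 + (2 * ?h12) *\<^sub>R ?s12 + ?h22 *\<^sub>R ?s22"
    unfolding A_tilde_def sum_2 sff_def[symmetric] sff_sym[OF z, symmetric] ip_M_commute[OF z, of "sff _ _ z"] hh_def[symmetric]
    by (simp add: vec_eq_iff hh_sym[OF z] algebra_simps)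
  \<comment> \<open>Half the trace of \<open>hh\<close> times the trace of the second fundamental
    form; subtracted from \<open>A\<close>, it leaves just the trace-free coefficients of
    \<open>lhs\<close>.\<close>
  have H: "(2 * ip_M P z (mean_curv P z) (mean_curv P z)) *\<^sub>R mean_curv P z =
      ((?h11 + ?h22) / 2) *\<^sub>R (?s11 + ?s22)"
    unfolding hh_trace[OF z, symmetric] by (subst mean_curv_eq) simp
  have cH: "ip_M P z (cov P (frm P i z) (mean_curv P) z) (cov P (frm P j z) (e_vec P 1) z) =
      n i j 1 - conn j z * hh i 2 z"
    "ip_M P z (cov P (frm P i z) (mean_curv P) z) (cov P (frm P j z) (e_vec P 2) z) =
      n i j 2 + conn j z * hh i 1 z" for i j
    by (simp_all add: cov_mean_curv[OF z] cov_e[OF z] ip_M_simps ip_nH[OF z] ip_sff[OF z] ip_e[OF z] n_def)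
  have n21: "n i 2 1 = n i 1 2" for i by (simp add: n_def sff_sym[OF z])
  have d21: "d i 2 1 = d i 1 2" for i by (simp add: d_def derivative_hh_sym[OF z])
  have R1: "ip_M P z R ?e1 = - d 1 1 2 - n 2 1 1 + ?o1 * ?h22 + d 2 1 1 + n 1 1 2 - ?o2 * ?h12 - ?o1 * ?h11 - ?o2 * ?h12"
    unfolding R_def cov_cov_frame[OF z smooth_mean_curv] ip_M_simps ip_cov_cov_mean_curv[OF z] cH
      ip_cov_mean_curv[OF z] hh_sym[OF z] n21 d d21
    by simp
  have R2: "ip_M P z R ?e2 = - d 1 2 2 - n 2 1 2 - ?o1 * ?h12 + d 2 1 2 + n 1 2 2 + ?o2 * ?h11 - ?o1 * ?h12 - ?o2 * ?h22"
    unfolding R_def cov_cov_frame[OF z smooth_mean_curv] ip_M_simps ip_cov_cov_mean_curv[OF z] cH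
      ip_cov_mean_curv[OF z] hh_sym[OF z] d
    by simp
  have Rp: "R_perp P z = ip_M P z R ?e1 *\<^sub>R ?e2 - ip_M P z R ?e2 *\<^sub>R ?e1"
    by (simp add: R_perp_def R_def[symmetric] rot_T_def pi_T_eq[OF z] ip_M_simps ip_e[OF z])
  have t: "d i 1 1 + d i 2 2 = 2 * (n i 1 1 + n i 2 2)" for i
    unfolding d_def n_def by (rule derivative_hh_trace[OF z])
  \<comment> \<open>After inserting \<open>R2\<close> the two sides differ by half of the two sides
    of \<open>t\<close> in direction 1; \<open>c2\<close> is the same with \<open>R1\<close> and
    direction 2.\<close>
  have c1: "(d 1 1 1 - d 1 2 2) / 2 + d 2 1 2 - 2 * ?o1 * ?h12 + ?o2 * (?h11 - ?h22) =
      n 1 1 1 + n 2 1 2 + ip_M P z R ?e2"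
    using t[of 1] unfolding R2 by (simp add: field_simps)
  have c2: "d 1 1 2 + (d 2 2 2 - d 2 1 1) / 2 + ?o1 * (?h11 - ?h22) + 2 * ?o2 * ?h12 =
      n 1 1 2 + n 2 2 2 - ip_M P z R ?e1"
    using t[of 2] unfolding R1 by (simp add: field_simps)
  show ?thesis
    unfolding lhs lap A H Rp c1 c2
    by (simp add: vec_eq_iff field_simps)
qed

end

section \<open>Passage from the manifold to a patch in a chart\<close>

theorem theorem1:
  fixes A :: "('a::{t2_space, second_countable_topology}, 'm::finite) chart set"
    and h :: "('a, 'm) chart \<Rightarrow> real ^ 'm \<Rightarrow> real ^ 'm ^ 'm"
    and \<Phi> :: "real ^ 2 \<Rightarrow> 'a"
    and f :: "2 \<Rightarrow> real ^ 2 \<Rightarrow> real ^ 2"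
    and es :: "'m list"
    and P :: "'m patch"
  assumes "CARD('m) \<ge> 3"
    and "smooth_atlas A" and "compact (UNIV :: 'a set)" and "connected (UNIV :: 'a set)"
    and "riemannian_metric A h"
    and "smooth_immersion A \<Phi>"
    and "smooth_pos_orthonormal_frame A h \<Phi> f"
    and "z \<in> disc" and "c \<in> A" and "\<Phi> z \<in> fst c"
    and "distinct es" and "set es = UNIV"
    and "P = patch_in h \<Phi> f c es"
  shows "(1/2) *\<^sub>R D_g_star P (\<lambda>w.
             D_g P (mean_curv P) w
             - 3 *\<^sub>R pi_n_tensor P w (D_g P (mean_curv P) w)
             + star_h_tensor P w
                 (wedge_M (star_g_tensor P w (D_g_mv P (gauss_map P) w)) (of_vec (mean_curv P w)))) z
         = Lap_perp P (mean_curv P) z + A_tilde P z (mean_curv P z)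
           - (2 * ip_M P z (mean_curv P z) (mean_curv P z)) *\<^sub>R mean_curv P z
           - R_perp P z"
proof -
  \<comment> \<open>The identity is local, so it suffices to work on the part of the disc that is
    mapped into the domain of the chart \<open>c\<close>, an open set containing
    \<open>z\<close>.\<close>
  define U where "U = disc \<inter> \<Phi> -` fst c"
  have atlas: "open (fst c)" "open (snd c ` fst c)"
    using \<open>smooth_atlas A\<close> \<open>c \<in> A\<close> by (auto simp: smooth_atlas_def)
  have imm: "continuous_on disc \<Phi>" "smooth_on U (snd c \<circ> \<Phi>)"
    using \<open>smooth_immersion A \<Phi>\<close> \<open>c \<in> A\<close> by (auto simp: smooth_immersion_def U_def)
  have met: "smooth_on (snd c ` fst c) (h c)"
    "\<And>y. y \<in> snd c ` fst c \<Longrightarrow> transpose (h c y) = h c y"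
    "\<And>y v. y \<in> snd c ` fst c \<Longrightarrow> v \<noteq> 0 \<Longrightarrow> ip (h c y) v v > 0"
    using \<open>riemannian_metric A h\<close> \<open>c \<in> A\<close> by (auto simp: riemannian_metric_def)
  have frm: "\<And>i. smooth_on disc (f i)" "\<And>w. w \<in> U \<Longrightarrow> pos_orthonormal_frame (patch_in h \<Phi> f c []) w"
    using \<open>smooth_pos_orthonormal_frame A h \<Phi> f\<close> \<open>c \<in> A\<close> by (auto simp: smooth_pos_orthonormal_frame_def U_def)
  have P: "met P = h c" "imm P = snd c \<circ> \<Phi>" "frm P = f" "coord_order P = es"
    using \<open>P = _\<close> by (simp_all add: patch_in_def)
  \<comment> \<open>The frame hypothesis is stated for the patch with the empty coordinate order;
    the push-forward does not involve the order, so the hypothesis carries over to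
    \<open>P\<close>.\<close>
  have push: "push P w = push (patch_in h \<Phi> f c []) w" for w
    by (simp add: push_def[abs_def] P patch_in_def)
  interpret immersed_patch P "snd c ` fst c" U
  proof unfold_locales
    show "distinct (coord_order P)" "set (coord_order P) = UNIV"
      using \<open>distinct es\<close> \<open>set es = UNIV\<close> by (simp_all add: P)
    show "open (snd c ` fst c)" "smooth_on (snd c ` fst c) (met P)"
      using atlas met by (simp_all add: P)
    show "transpose (met P y) = met P y" if "y \<in> snd c ` fst c" for y using met that by (simp add: P)
    show "ip (met P y) v v > 0" if "y \<in> snd c ` fst c" "v \<noteq> 0" for y v using met that by (simp add: P)
    show "open U" unfolding U_def by (rule continuous_open_preimage[OF imm(1) open_ball atlas(1)])
    show "smooth_on U (imm P)" using imm by (simp add: P)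
    show "imm P w \<in> snd c ` fst c" if "w \<in> U" for w using that by (simp add: P U_def)
    show "smooth_on U (frm P i)" for i
      using smooth_on_subset[OF frm(1), of U i] by (simp add: P U_def)
    show "pos_orthonormal_frame P w" if "w \<in> U" for w
      using frm(2)[OF that]
      by (simp add: pos_orthonormal_frame_def pullback_metric_def ip_M_def push P) (simp add: patch_in_def)
    show "2 \<le> CARD('m)" using \<open>CARD('m) \<ge> 3\<close> by simp
  qed
  have "z \<in> U" using assms by (simp add: U_def)
  then show ?thesis by (rule willmore_divergence_form)
qed

end
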